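(* Let $\mathcal{O}$ and $\mathcal{P}$ be smooth orbifolds and let $(f,\{\tilde f_x\},\{\Theta_{f,x}\}):\mathcal{O}\to\mathcal{P}$ be a smooth complete orbifold map. Then the set of critical values of $f$ has measure $0$ in $\mathcal{P}$, and thus the set of regular values of $f$ is everywhere dense in $\mathcal{P}$.
   Context: Smooth means $C^\infty$. Orbifold. An $n$-dimensional smooth orbifold $\mathcal{O}$ consists of a paracompact Hausdorff space $X_{\mathcal{O}}$ (the underlying space) with the following local structure. For each $x\in X_{\mathcal{O}}$ and neighborhood $U$ of $x$ there are a neighborhood $U_x\subset U$ of $x$, an open set $\tilde U_x$ diffeomorphic to $\mathbb{R}^n$, a finite group $\Gamma_x$ acting smoothly and effectively on $\tilde U_x$ and fixing $0\in\tilde U_x$, and a homeomorphism $\phi_x:\tilde U_x/\Gamma_x\to U_x$ with $\phi_x(0)=x$. These satisfy: if $U_z\subset U_x$ is another such neighborhood with data $\tilde U_z,\Gamma_z,\phi_z$, there are a smooth embedding $\tilde\psi_{zx}:\tilde U_z\to\tilde U_x$ and an injective homomorphism $\theta_{zx}:\Gamma_z\to\Gamma_x$ such that $\tilde\psi_{zx}$ is $\theta_{zx}$-equivariant and covers the inclusion $U_z\subset U_x$. The pair $(\tilde U_x,\Gamma_x)$ is called an orbifold chart at $x$, and $\Gamma_x$ the isotropy group of $x$ (well defined up to isomorphism). Write $\tilde x$ for the point $0\in\tilde U_x$ lying over $x$. Complete orbifold map. A smooth complete orbifold map $(f,\{\tilde f_x\},\{\Theta_{f,x}\}):\mathcal{O}\to\mathcal{P}$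 consists of a continuous map $f:X_{\mathcal{O}}\to X_{\mathcal{P}}$ and, for each $x\in\mathcal{O}$, a group homomorphism $\Theta_{f,x}:\Gamma_x\to\Gamma_{f(x)}$ and a smooth $\Theta_{f,x}$-equivariant map $\tilde f_x:\tilde U_x\to\tilde V_{f(x)}$ covering $f|_{U_x}$, where $(\tilde U_x,\Gamma_x)$ and $(\tilde V_{f(x)},\Gamma_{f(x)})$ are orbifold charts at $x$ and $f(x)$. Two such maps are identified if for each $x$ the lifts agree as germs at $\tilde x$ and the homomorphisms agree. Regular and critical values. A point $p\in\mathcal{P}$ is a regular value of $f$ if the differential $d\tilde f_x(\tilde x):T_{\tilde x}\tilde U_x\to T_{\tilde p}\tilde V_p$ is surjective for all $x\in f^{-1}(p)$; otherwise $p$ is a critical value. In particular, points $p\notin f(\mathcal{O})$ are regular values. Measure $0$. A subset of $\mathcal{P}$ has measure $0$ if its preimage in $\tilde V$ has Lebesgue measure zero for every orbifold chart $\tilde V\to\tilde V/\Gamma\cong V$ of $\mathcal{P}$.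
   Formalization: The orbifold O is additionally assumed to have at most countably many connected components; with only paracompact Hausdorff the claim fails (the reals as a discrete 0-dimensional orbifold mapped identically onto the real line has only critical values). *)

theory Defs
  imports "HOL-Analysis.Analysis" "HOL-Algebra.Group_Action"
begin

section \<open>Calculus on coordinate subspaces\<close>

text \<open>
  Euclidean types have positive dimension. In order to include dimension \<open>0\<close>, the space
  \<open>\<real>\<^sup>n\<close> is realised as \<open>span B\<close> for a set \<open>B\<close> of \<open>n\<close> of the standard basis
  vectors of a Euclidean type. For \<open>n \<ge> 1\<close> one can take \<open>B = Basis\<close>, so that \<open>span B = UNIV\<close>.
\<close>

text \<open>
  Below, \<open>U\<close> is open in the linear subspace \<open>E\<close>. The derivative within \<open>U\<close> is then uniquely
  determined on \<open>E\<close>, the space of tangent directions, and only the values of \<open>f\<close> on \<open>U\<close> matter.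
\<close>

primrec Ck_on ::
  "nat \<Rightarrow> 'a::real_normed_vector set \<Rightarrow> 'a set \<Rightarrow> ('a \<Rightarrow> 'b::real_normed_vector) \<Rightarrow> bool" where
  "Ck_on 0 E U f \<longleftrightarrow> continuous_on U f"
| "Ck_on (Suc k) E U f \<longleftrightarrow>
     (\<forall>x\<in>U. f differentiable (at x within U)) \<and>
     (\<forall>v\<in>E. Ck_on k E U (\<lambda>x. frechet_derivative f (at x within U) v))"

definition smooth_on ::
  "'a::real_normed_vector set \<Rightarrow> 'a set \<Rightarrow> ('a \<Rightarrow> 'b::real_normed_vector) \<Rightarrow> bool" where
  "smooth_on E U f \<longleftrightarrow> (\<forall>k. Ck_on k E U f)"

definition diffeomorphic_to_space :: "'a::real_normed_vector set \<Rightarrow> 'a set \<Rightarrow> bool" where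
  "diffeomorphic_to_space E U \<longleftrightarrow>
     (\<exists>h k. smooth_on E U h \<and> smooth_on E E k \<and> h ` U = E \<and> k ` E = U \<and>
            (\<forall>u\<in>U. k (h u) = u) \<and> (\<forall>e\<in>E. h (k e) = e))"

definition smooth_embedding ::
  "'a::real_normed_vector set \<Rightarrow> 'a set \<Rightarrow> 'a set \<Rightarrow> ('a \<Rightarrow> 'a) \<Rightarrow> bool" where
  "smooth_embedding E U V f \<longleftrightarrow>
     f ` U \<subseteq> V \<and> smooth_on E U f \<and>
     (\<forall>u\<in>U. inj_on (frechet_derivative f (at u within U)) E) \<and>
     embedding_map (top_of_set U) (top_of_set V) f"

text \<open>
  Subsets of \<open>span B\<close> of Lebesgue measure zero; the measure is that of the coordinate vectors.
  For \<open>B = {}\<close> the product measure is the unit mass on a point, so only \<open>{}\<close> is null.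
\<close>

definition lebesgue_null :: "'a::euclidean_space set \<Rightarrow> 'a set \<Rightarrow> bool" where
  "lebesgue_null B N \<longleftrightarrow>
     (\<lambda>x. \<lambda>b\<in>B. x \<bullet> b) ` N \<in> null_sets (completion (\<Pi>\<^sub>M b\<in>B. (lborel :: real measure)))"

lemma lebesgue_null_Basis: "lebesgue_null Basis N \<longleftrightarrow> negligible N"
  for N :: "'a::euclidean_space set"
proof -
  define P where "P = (\<Pi>\<^sub>M b\<in>(Basis::'a set). (lborel :: real measure))"
  define c where "c = (\<lambda>x::'a. \<lambda>b\<in>Basis. x \<bullet> b)"
  define d where "d = (\<lambda>f. (\<Sum>b\<in>Basis. f b *\<^sub>R (b::'a)))"
  have dc: "d (c x) = x" for x
    by (simp add: d_def c_def euclidean_representation)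
  have cd: "c (d f) = f" if "f \<in> space P" for f
    using that by (auto simp: P_def space_PiM c_def d_def PiE_def extensional_def fun_eq_iff)
  have csp: "c x \<in> space P" for x
    by (auto simp: P_def space_PiM c_def)
  have comp: "(\<lambda>f. f b) \<in> borel_measurable P" if "b \<in> Basis" for b :: 'a
    using measurable_component_singleton[OF that, of "\<lambda>_. lborel :: real measure"]
    by (simp add: P_def)
  have dm: "d \<in> measurable P borel"
    unfolding d_def using comp
    by (intro borel_measurable_sum borel_measurable_scaleR borel_measurable_const)
  have cm: "c \<in> measurable borel P"
    unfolding P_def c_def by (rule measurable_restrict) auto
  have lb: "lborel = distr P borel d"
    unfolding P_def d_def by (rule lborel_eq)
  have null: "emeasure lborel A = emeasure P (d -` A \<inter> space P)" if "A \<in> sets borel" for A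
    unfolding lb using dm that by (rule emeasure_distr)
  have neg: "negligible N \<longleftrightarrow> (\<exists>A\<in>null_sets lborel. N \<subseteq> A)"
    unfolding negligible_iff_null_sets null_sets_completion_iff2 by blast
  have iff: "(\<exists>A\<in>null_sets lborel. N \<subseteq> A) \<longleftrightarrow> (\<exists>A\<in>null_sets P. c ` N \<subseteq> A)"
  proof
    assume "\<exists>A\<in>null_sets lborel. N \<subseteq> A"
    then obtain A where A: "A \<in> null_sets lborel" "N \<subseteq> A" by blast
    have bA: "A \<in> sets borel" using null_setsD2[OF A(1)] by simp
    have "emeasure P (d -` A \<inter> space P) = 0"
      using null[OF bA] null_setsD1[OF A(1)] by simp
    then have "d -` A \<inter> space P \<in> null_sets P"
      using measurable_sets[OF dm bA] by (rule null_setsI)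
    moreover have "c ` N \<subseteq> d -` A \<inter> space P"
      using A(2) dc csp by auto
    ultimately show "\<exists>A\<in>null_sets P. c ` N \<subseteq> A" by (rule bexI[rotated])
  next
    assume "\<exists>A\<in>null_sets P. c ` N \<subseteq> A"
    then obtain A where A: "A \<in> null_sets P" "c ` N \<subseteq> A" by blast
    have sA: "A \<subseteq> space P" by (rule sets.sets_into_space[OF null_setsD2[OF A(1)]])
    have m: "c -` A \<in> sets borel"
      using measurable_sets[OF cm null_setsD2[OF A(1)]] by simp
    have "d -` (c -` A) \<inter> space P = A"
      using sA cd by fastforce
    then have "emeasure lborel (c -` A) = 0"
      using null[OF m] null_setsD1[OF A(1)] by simp
    then have "c -` A \<in> null_sets lborel"
      using m by (intro null_setsI) simp_all
    moreover have "N \<subseteq> c -` A" using A(2) by (simp only: image_subset_iff_subset_vimage)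
    ultimately show "\<exists>A\<in>null_sets lborel. N \<subseteq> A" by (rule bexI[rotated])
  qed
  have leb: "lebesgue_null Basis N \<longleftrightarrow> (\<exists>A\<in>null_sets P. c ` N \<subseteq> A)"
    unfolding lebesgue_null_def null_sets_completion_iff2 P_def c_def by blast
  show ?thesis unfolding leb neg iff ..
qed


section \<open>Quotients by group actions; paracompactness\<close>

definition orbit_space ::
  "('g, 'm) monoid_scheme \<Rightarrow> 'a::topological_space set \<Rightarrow> ('g \<Rightarrow> 'a \<Rightarrow> 'a) \<Rightarrow> 'a set topology" where
  "orbit_space G U \<rho> =
     topology (\<lambda>W. W \<subseteq> orbits G U \<rho> \<and> openin (top_of_set U) {u \<in> U. orbit G \<rho> u \<in> W})"

lemma openin_orbit_space:
  "openin (orbit_space G U \<rho>) W \<longleftrightarrow>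
     W \<subseteq> orbits G U \<rho> \<and> openin (top_of_set U) {u \<in> U. orbit G \<rho> u \<in> W}"
proof -
  have "istopology (\<lambda>W. W \<subseteq> orbits G U \<rho> \<and> openin (top_of_set U) {u \<in> U. orbit G \<rho> u \<in> W})"
    unfolding istopology_def
  proof (intro conjI allI impI)
    fix S T
    assume S: "S \<subseteq> orbits G U \<rho> \<and> openin (top_of_set U) {u \<in> U. orbit G \<rho> u \<in> S}"
      and T: "T \<subseteq> orbits G U \<rho> \<and> openin (top_of_set U) {u \<in> U. orbit G \<rho> u \<in> T}"
    show "S \<inter> T \<subseteq> orbits G U \<rho>" using S by blast
    have "{u \<in> U. orbit G \<rho> u \<in> S \<inter> T} = {u \<in> U. orbit G \<rho> u \<in> S} \<inter> {u \<in> U. orbit G \<rho> u \<in> T}"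
      by blast
    then show "openin (top_of_set U) {u \<in> U. orbit G \<rho> u \<in> S \<inter> T}"
      using S T by (simp add: openin_Int)
  next
    fix \<K>
    assume K: "\<forall>W\<in>\<K>. W \<subseteq> orbits G U \<rho> \<and> openin (top_of_set U) {u \<in> U. orbit G \<rho> u \<in> W}"
    show "\<Union>\<K> \<subseteq> orbits G U \<rho>" using K by blast
    have "{u \<in> U. orbit G \<rho> u \<in> \<Union>\<K>} = (\<Union>W\<in>\<K>. {u \<in> U. orbit G \<rho> u \<in> W})"
      by blast
    then show "openin (top_of_set U) {u \<in> U. orbit G \<rho> u \<in> \<Union>\<K>}"
      using K by auto
  qed
  then show ?thesis
    by (simp add: orbit_space_def topology_inverse')
qed

lemma topspace_orbit_space: "topspace (orbit_space G U \<rho>) = orbits G U \<rho>"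
proof -
  have "{u \<in> U. orbit G \<rho> u \<in> orbits G U \<rho>} = U"
    by (auto simp: orbits_def)
  then have "openin (orbit_space G U \<rho>) (orbits G U \<rho>)"
    by (simp add: openin_orbit_space)
  then show ?thesis
    by (meson openin_orbit_space openin_subset openin_topspace subset_antisym)
qed

lemma quotient_map_orbit: "quotient_map (top_of_set U) (orbit_space G U \<rho>) (orbit G \<rho>)"
  by (auto simp: quotient_map_def topspace_orbit_space openin_orbit_space orbits_def)

definition paracompact_space :: "'x topology \<Rightarrow> bool" where
  "paracompact_space X \<longleftrightarrow>
     (\<forall>\<U>. (\<forall>U\<in>\<U>. openin X U) \<and> \<Union>\<U> = topspace X \<longrightarrow>
       (\<exists>\<V>. (\<forall>V\<in>\<V>. openin X V) \<and> \<Union>\<V> = topspace X \<and>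
            (\<forall>V\<in>\<V>. \<exists>U\<in>\<U>. V \<subseteq> U) \<and> locally_finite_in X \<V>))"


section \<open>Orbifolds\<close>

text \<open>
  A chart at \<open>x = chart_center c\<close>: the open set \<open>chart_nbhd c\<close> is the quotient of
  \<open>chart_dom c\<close> by the group \<open>chart_group c\<close>, via the homeomorphism \<open>chart_homeo c\<close> defined
  on orbits.
\<close>

record ('a, 'x, 'g) orb_chart =
  chart_center :: 'x
  chart_nbhd :: "'x set"
  chart_dom :: "'a set"
  chart_group :: "'g monoid"
  chart_action :: "'g \<Rightarrow> 'a \<Rightarrow> 'a"
  chart_homeo :: "'a set \<Rightarrow> 'x"

definition chart_proj :: "('a, 'x, 'g) orb_chart \<Rightarrow> 'a \<Rightarrow> 'x" where
  "chart_proj c u = chart_homeo c (orbit (chart_group c) (chart_action c) u)"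

definition orbifold_chart ::
  "'a::euclidean_space set \<Rightarrow> 'x topology \<Rightarrow> ('a, 'x, 'g) orb_chart \<Rightarrow> bool" where
  "orbifold_chart B X c \<longleftrightarrow>
     openin X (chart_nbhd c) \<and> chart_center c \<in> chart_nbhd c \<and>
     openin (top_of_set (span B)) (chart_dom c) \<and> 0 \<in> chart_dom c \<and>
     diffeomorphic_to_space (span B) (chart_dom c) \<and>
     finite (carrier (chart_group c)) \<and>
     faithful_action (chart_group c) (chart_dom c) (chart_action c) \<and>
     (\<forall>g\<in>carrier (chart_group c).
        smooth_on (span B) (chart_dom c) (chart_action c g) \<and> chart_action c g 0 = 0) \<and>
     homeomorphic_map (orbit_space (chart_group c) (chart_dom c) (chart_action c))
       (subtopology X (chart_nbhd c)) (chart_homeo c) \<and>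
     chart_proj c 0 = chart_center c"

definition chart_compatible ::
  "'a::euclidean_space set \<Rightarrow> ('a, 'x, 'g) orb_chart \<Rightarrow> ('a, 'x, 'g) orb_chart \<Rightarrow> bool" where
  "chart_compatible B c d \<longleftrightarrow>
     (\<exists>\<psi> \<theta>. smooth_embedding (span B) (chart_dom c) (chart_dom d) \<psi> \<and>
            \<theta> \<in> hom (chart_group c) (chart_group d) \<and> inj_on \<theta> (carrier (chart_group c)) \<and>
            (\<forall>g\<in>carrier (chart_group c). \<forall>u\<in>chart_dom c.
               \<psi> (chart_action c g u) = chart_action d (\<theta> g) (\<psi> u)) \<and>
            (\<forall>u\<in>chart_dom c. chart_proj d (\<psi> u) = chart_proj c u))"

text \<open>The dimension of an orbifold is \<open>card (orb_coords \<O>)\<close>.\<close>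

record ('a, 'x, 'g) orbifold =
  orb_coords :: "'a set"
  orb_space :: "'x topology"
  orb_charts :: "('a, 'x, 'g) orb_chart set"

definition smooth_orbifold :: "('a::euclidean_space, 'x, 'g) orbifold \<Rightarrow> bool" where
  "smooth_orbifold \<O> \<longleftrightarrow>
     orb_coords \<O> \<subseteq> Basis \<and>
     paracompact_space (orb_space \<O>) \<and> Hausdorff_space (orb_space \<O>) \<and>
     (\<forall>c\<in>orb_charts \<O>. orbifold_chart (orb_coords \<O>) (orb_space \<O>) c) \<and>
     (\<forall>x U. openin (orb_space \<O>) U \<and> x \<in> U \<longrightarrow>
        (\<exists>c\<in>orb_charts \<O>. chart_center c = x \<and> chart_nbhd c \<subseteq> U)) \<and>
     (\<forall>c\<in>orb_charts \<O>. \<forall>d\<in>orb_charts \<O>.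
        chart_nbhd c \<subseteq> chart_nbhd d \<longrightarrow> chart_compatible (orb_coords \<O>) c d)"

definition orbifold_null :: "('b::euclidean_space, 'y, 'h) orbifold \<Rightarrow> 'y set \<Rightarrow> bool" where
  "orbifold_null \<P> A \<longleftrightarrow>
     (\<forall>d\<in>orb_charts \<P>.
        lebesgue_null (orb_coords \<P>) {v \<in> chart_dom d. chart_proj d v \<in> A})"


section \<open>Complete orbifold maps\<close>

text \<open>
  For every point \<open>x\<close> of the source, the data include the charts at \<open>x\<close> and at its image
  between which the lift at \<open>x\<close> is defined.
\<close>

record ('a, 'x, 'g, 'b, 'y, 'h) orb_map =
  map_fun :: "'x \<Rightarrow> 'y"
  map_src :: "'x \<Rightarrow> ('a, 'x, 'g) orb_chart"
  map_tgt :: "'x \<Rightarrow> ('b, 'y, 'h) orb_chart"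
  map_lift :: "'x \<Rightarrow> 'a \<Rightarrow> 'b"
  map_hom :: "'x \<Rightarrow> 'g \<Rightarrow> 'h"

definition complete_orbifold_map ::
  "('a::euclidean_space, 'x, 'g) orbifold \<Rightarrow> ('b::euclidean_space, 'y, 'h) orbifold \<Rightarrow>
   ('a, 'x, 'g, 'b, 'y, 'h) orb_map \<Rightarrow> bool" where
  "complete_orbifold_map \<O> \<P> F \<longleftrightarrow>
     continuous_map (orb_space \<O>) (orb_space \<P>) (map_fun F) \<and>
     (\<forall>x\<in>topspace (orb_space \<O>).
        map_src F x \<in> orb_charts \<O> \<and> chart_center (map_src F x) = x \<and>
        map_tgt F x \<in> orb_charts \<P> \<and> chart_center (map_tgt F x) = map_fun F x \<and>
        map_hom F x \<in> hom (chart_group (map_src F x)) (chart_group (map_tgt F x)) \<and>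
        map_lift F x ` chart_dom (map_src F x) \<subseteq> chart_dom (map_tgt F x) \<and>
        smooth_on (span (orb_coords \<O>)) (chart_dom (map_src F x)) (map_lift F x) \<and>
        (\<forall>g\<in>carrier (chart_group (map_src F x)). \<forall>u\<in>chart_dom (map_src F x).
           map_lift F x (chart_action (map_src F x) g u) =
           chart_action (map_tgt F x) (map_hom F x g) (map_lift F x u)) \<and>
        (\<forall>u\<in>chart_dom (map_src F x).
           map_fun F (chart_proj (map_src F x) u) = chart_proj (map_tgt F x) (map_lift F x u)))"

definition regular_values ::
  "('a::euclidean_space, 'x, 'g) orbifold \<Rightarrow> ('b::euclidean_space, 'y, 'h) orbifold \<Rightarrow>
   ('a, 'x, 'g, 'b, 'y, 'h) orb_map \<Rightarrow> 'y set" where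
  "regular_values \<O> \<P> F =
     {p \<in> topspace (orb_space \<P>).
        \<forall>x\<in>topspace (orb_space \<O>). map_fun F x = p \<longrightarrow>
          frechet_derivative (map_lift F x) (at 0 within chart_dom (map_src F x))
            ` span (orb_coords \<O>) = span (orb_coords \<P>)}"

definition critical_values ::
  "('a::euclidean_space, 'x, 'g) orbifold \<Rightarrow> ('b::euclidean_space, 'y, 'h) orbifold \<Rightarrow>
   ('a, 'x, 'g, 'b, 'y, 'h) orb_map \<Rightarrow> 'y set" where
  "critical_values \<O> \<P> F = topspace (orb_space \<P>) - regular_values \<O> \<P> F"

end

theory Submission
  imports Defs
begin

text \<open>
  Criticality is tested at the centres of charts, by a different lift at every point. Two lifts near
  a common point differ by coordinate changes and by pointwise chosen elements of the finite isotropy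
  group of the target. Their derivatives nevertheless have the same rank, since a vector space is not
  a finite union of proper subspaces. The source is paracompact with countably many components, hence
  covered by countably many charts, and it remains to apply Sard's theorem to the lifts in these
  charts and to use that coordinate changes preserve null sets.

  Sard's theorem itself is proved by induction on dimensions. Where some partial derivative is nonzero,
  a change of coordinates turns one component of the map into a coordinate, and Fubini's theorem
  reduces to slices. Where the derivative vanishes, it is enough to treat one component. At such a
  point either all its iterated derivatives of order up to the dimension vanish, and counting small
  cubes suffices, or some vanishing iterated derivative has a nonzero partial derivative, and its zero
  set is a hyperplane after a change of coordinates.
\<close>

section \<open>Smooth real functions\<close>

text \<open>A type fixes its dimension, whereas both inductions in Sard's theorem lower dimensions.
  They therefore run over sets \<open>B\<close>, \<open>B'\<close> of coordinate vectors: source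
  points keep the coordinates outside \<open>B\<close> equal to those of \<open>p\<close>, and
  target sets are replaced by cylinders that are free in the coordinates outside \<open>B'\<close>.
  Dimension 0 is then an ordinary case. A map on an open part of \<open>span B\<close> is composed
  with the orthogonal projection, so that derivatives are taken on open sets of the whole space,
  where they are unique. Slicing needs measurable sets, so critical values must be shown to be Borel
  before Fubini's theorem applies. Countability of the set of components of the source is
  indispensable: if an uncountable discrete space of dimension 0 is mapped bijectively to a line,
  every value is critical.\<close>

definition pd :: "'a::euclidean_space \<Rightarrow> ('a \<Rightarrow> real) \<Rightarrow> 'a \<Rightarrow> real" where
  "pd a g x = frechet_derivative g (at x) a"

lemma pd_eq: "(g has_derivative g') (at x) \<Longrightarrow> pd a g x = g' a"
  unfolding pd_def by (metis frechet_derivative_at)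

text \<open>Coinduction avoids counting orders: smoothness follows from a class of differentiable
  functions whose partial derivatives stay in the class. Only the values of \<open>f'\<close> on
  \<open>U\<close> are constrained.\<close>

coinductive smooth_fun :: "'a::euclidean_space set \<Rightarrow> ('a \<Rightarrow> real) \<Rightarrow> bool"
  for U :: "'a set" where
  smooth_funI: "(\<forall>x\<in>U. (f has_derivative f' x) (at x)) \<Longrightarrow>
    (\<And>b. b \<in> Basis \<Longrightarrow> smooth_fun U (\<lambda>x. f' x b)) \<Longrightarrow> smooth_fun U f"

lemma smooth_fun_coinduct:
  assumes "X f"
    and step: "\<And>f. X f \<Longrightarrow> \<exists>f'. (\<forall>x\<in>U. (f has_derivative f' x) (at x)) \<and> (\<forall>b\<in>Basis. X (\<lambda>x. f' x b))"
  shows "smooth_fun U f"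
  using assms(1) by (rule smooth_fun.coinduct) (use step in blast)

lemma smooth_funE:
  assumes "smooth_fun U f"
  obtains f' where "\<And>x. x \<in> U \<Longrightarrow> (f has_derivative f' x) (at x)"
    "\<And>b. b \<in> Basis \<Longrightarrow> smooth_fun U (\<lambda>x. f' x b)"
  using assms by (cases rule: smooth_fun.cases) blast

lemma smooth_fun_cong:
  assumes "smooth_fun U f" "open U" "\<And>x. x \<in> U \<Longrightarrow> f x = g x"
  shows "smooth_fun U g"
  using assms(1)
proof (rule smooth_funE)
  fix f' assume f': "\<And>x. x \<in> U \<Longrightarrow> (f has_derivative f' x) (at x)"
    "\<And>b. b \<in> Basis \<Longrightarrow> smooth_fun U (\<lambda>x. f' x b)"
  have "(g has_derivative f' x) (at x)" if "x \<in> U" for x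
    using f'(1)[OF that] assms(2) that by (rule has_derivative_transform_within_open) (rule assms(3))
  with f'(2) show ?thesis by (blast intro: smooth_funI)
qed

lemma smooth_fun_subset:
  assumes "smooth_fun U f" "V \<subseteq> U"
  shows "smooth_fun V f"
  using assms(1)
proof (rule smooth_fun_coinduct[where X = "smooth_fun U"])
  fix f assume "smooth_fun U f"
  then show "\<exists>f'. (\<forall>x\<in>V. (f has_derivative f' x) (at x)) \<and> (\<forall>b\<in>Basis. smooth_fun U (\<lambda>x. f' x b))"
    by (rule smooth_funE) (use assms(2) in blast)
qed

lemma smooth_fun_has_derivative:
  assumes "smooth_fun U f" "x \<in> U"
  shows "(f has_derivative (\<lambda>v. pd v f x)) (at x)"
  using assms(1)
proof (rule smooth_funE)
  fix f' assume "\<And>x. x \<in> U \<Longrightarrow> (f has_derivative f' x) (at x)"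
  then have "(f has_derivative f' x) (at x)" using assms(2) by blast
  then show ?thesis by (simp add: pd_eq)
qed

lemma smooth_fun_pd:
  assumes "smooth_fun U f" "open U" "a \<in> Basis"
  shows "smooth_fun U (pd a f)"
  using assms(1)
proof (rule smooth_funE)
  fix f' assume f': "\<And>x. x \<in> U \<Longrightarrow> (f has_derivative f' x) (at x)"
    "\<And>b. b \<in> Basis \<Longrightarrow> smooth_fun U (\<lambda>x. f' x b)"
  show ?thesis
    by (rule smooth_fun_cong[OF f'(2)[OF assms(3)] assms(2)]) (simp add: pd_eq[OF f'(1)])
qed

lemma smooth_fun_continuous: "smooth_fun U f \<Longrightarrow> continuous_on U f"
  by (meson continuous_at_imp_continuous_on has_derivative_continuous smooth_fun_has_derivative)

lemma smooth_fun_const: "smooth_fun U (\<lambda>x. c)"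
proof (rule smooth_fun_coinduct[where X = "\<lambda>f. \<exists>c. f = (\<lambda>x. c)"])
  fix f :: "'a \<Rightarrow> real" assume "\<exists>c. f = (\<lambda>x. c)"
  then have "(\<forall>x\<in>U. (f has_derivative (\<lambda>_. 0)) (at x)) \<and> (\<forall>b\<in>Basis. \<exists>c. (\<lambda>x::'a. 0::real) = (\<lambda>x. c))"
    by auto
  then show "\<exists>f'. (\<forall>x\<in>U. (f has_derivative f' x) (at x)) \<and> (\<forall>b\<in>Basis. \<exists>c. (\<lambda>x. f' x b) = (\<lambda>x. c))"
    by (rule exI[where x = "\<lambda>_ _. 0"])
qed blast

text \<open>Coinduction up to the algebra operations: the derivative of an expression built from smooth
  functions is again such an expression.\<close>

inductive smooth_expr :: "'a::euclidean_space set \<Rightarrow> ('a \<Rightarrow> real) \<Rightarrow> bool" for U :: "'a set" where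
  base: "smooth_fun U f \<Longrightarrow> smooth_expr U f"
| add: "smooth_expr U f \<Longrightarrow> smooth_expr U g \<Longrightarrow> smooth_expr U (\<lambda>x. f x + g x)"
| mult: "smooth_expr U f \<Longrightarrow> smooth_expr U g \<Longrightarrow> smooth_expr U (\<lambda>x. f x * g x)"
| inverse: "smooth_expr U f \<Longrightarrow> \<forall>x\<in>U. f x \<noteq> 0 \<Longrightarrow> smooth_expr U (\<lambda>x. inverse (f x))"

lemma smooth_expr_imp_smooth_fun:
  assumes "smooth_expr U f"
  shows "smooth_fun U f"
  using assms
proof (rule smooth_fun_coinduct[where X = "smooth_expr U"])
  fix f assume "smooth_expr U f"
  then show "\<exists>f'. (\<forall>x\<in>U. (f has_derivative f' x) (at x)) \<and> (\<forall>b\<in>Basis. smooth_expr U (\<lambda>x. f' x b))"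
  proof induction
    case (base f)
    then show ?case by (metis smooth_funE smooth_expr.base)
  next
    case (add f g)
    from add.IH obtain f' g' where
      "\<forall>x\<in>U. (f has_derivative f' x) (at x)" "\<forall>b\<in>Basis. smooth_expr U (\<lambda>x. f' x b)"
      "\<forall>x\<in>U. (g has_derivative g' x) (at x)" "\<forall>b\<in>Basis. smooth_expr U (\<lambda>x. g' x b)" by blast
    then show ?case
      by (intro exI[where x = "\<lambda>x v. f' x v + g' x v"])
        (auto intro: has_derivative_add smooth_expr.add)
  next
    case (mult f g)
    from mult.IH obtain f' g' where
      "\<forall>x\<in>U. (f has_derivative f' x) (at x)" "\<forall>b\<in>Basis. smooth_expr U (\<lambda>x. f' x b)"
      "\<forall>x\<in>U. (g has_derivative g' x) (at x)" "\<forall>b\<in>Basis. smooth_expr U (\<lambda>x. g' x b)" by blast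
    then show ?case
      by (intro exI[where x = "\<lambda>x v. f x * g' x v + f' x v * g x"])
        (auto intro!: has_derivative_mult smooth_expr.add smooth_expr.mult mult.hyps)
  next
    case (inverse f)
    from inverse.IH obtain f' where f':
      "\<forall>x\<in>U. (f has_derivative f' x) (at x)" "\<forall>b\<in>Basis. smooth_expr U (\<lambda>x. f' x b)" by blast
    have c: "smooth_expr U (\<lambda>x. -1)" by (intro smooth_expr.base smooth_fun_const)
    have i: "smooth_expr U (\<lambda>x. inverse (f x))" using inverse.hyps by (rule smooth_expr.inverse)
    \<comment> \<open>Negation is not among the constructors of expressions, so the derivative of
      the reciprocal is written as a product with the constant \<open>-1\<close>.\<close>
    have "smooth_expr U (\<lambda>x. - 1 * (inverse (f x) * f' x b * inverse (f x)))" if "b \<in> Basis" for b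
      by (intro smooth_expr.mult c i) (use f'(2) that in blast)
    moreover have "((\<lambda>x. inverse (f x)) has_derivative (\<lambda>v. - 1 * (inverse (f x) * f' x v * inverse (f x)))) (at x)"
      if "x \<in> U" for x
      using Deriv.has_derivative_inverse[OF _ bspec[OF f'(1) that]] inverse.hyps that by simp
    ultimately show ?case
      by (intro exI[where x = "\<lambda>x v. - 1 * (inverse (f x) * f' x v * inverse (f x))"]) auto
  qed
qed

lemma smooth_fun_add: "smooth_fun U f \<Longrightarrow> smooth_fun U g \<Longrightarrow> smooth_fun U (\<lambda>x. f x + g x)"
  by (rule smooth_expr_imp_smooth_fun[OF smooth_expr.add[OF smooth_expr.base smooth_expr.base]])

lemma smooth_fun_mult: "smooth_fun U f \<Longrightarrow> smooth_fun U g \<Longrightarrow> smooth_fun U (\<lambda>x. f x * g x)"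
  by (rule smooth_expr_imp_smooth_fun[OF smooth_expr.mult[OF smooth_expr.base smooth_expr.base]])

lemma smooth_fun_diff: "smooth_fun U f \<Longrightarrow> smooth_fun U g \<Longrightarrow> smooth_fun U (\<lambda>x. f x - g x)"
  by (drule smooth_fun_add[OF _ smooth_fun_mult[OF smooth_fun_const[where c = "-1"]]], assumption) simp

lemma smooth_fun_divide:
  assumes "smooth_fun U f" "smooth_fun U g" "\<And>x. x \<in> U \<Longrightarrow> g x \<noteq> 0"
  shows "smooth_fun U (\<lambda>x. f x / g x)"
proof -
  have "smooth_fun U (\<lambda>x. inverse (g x))"
    using smooth_expr_imp_smooth_fun[OF smooth_expr.inverse[OF smooth_expr.base[OF assms(2)]]] assms(3) by blast
  from smooth_fun_mult[OF assms(1) this] show ?thesis by (simp add: divide_inverse)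
qed

text \<open>\<open>k\<close> is the local inverse of \<open>x \<mapsto> x + (g x - x \<bullet> a) a\<close>.\<close>

lemma straighten:
  fixes g :: "'a::euclidean_space \<Rightarrow> real"
  assumes U: "open U" and g: "smooth_fun U g" and a: "a \<in> Basis"
    and x0: "x0 \<in> U" and nz: "pd a g x0 \<noteq> 0"
  obtains W V k c where "open W" "x0 \<in> W" "W \<subseteq> U" "open V" "k ` V = W"
    "\<And>y. y \<in> V \<Longrightarrow> g (k y) = y \<bullet> a"
    "\<And>y b. y \<in> V \<Longrightarrow> b \<in> Basis \<Longrightarrow> b \<noteq> a \<Longrightarrow> k y \<bullet> b = y \<bullet> b"
    "\<And>f. smooth_fun U f \<Longrightarrow> smooth_fun V (\<lambda>y. f (k y))"
    "\<And>f y b. smooth_fun U f \<Longrightarrow> y \<in> V \<Longrightarrow> b \<in> Basis \<Longrightarrow>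
       pd b (\<lambda>y. f (k y)) y = pd b f (k y) + c b y * pd a f (k y)"
proof -
  \<comment> \<open>On \<open>U0\<close> the differential of the map \<open>h\<close> below is
    invertible and quotients by \<open>pd a g\<close> are smooth.\<close>
  define U0 where "U0 = {x \<in> U. pd a g x \<noteq> 0}"
  have "continuous_on U (pd a g)" by (intro smooth_fun_continuous smooth_fun_pd g U a)
  then have "openin (top_of_set U) (U \<inter> pd a g -` (-{0}))"
    by (rule continuous_openin_preimage_gen) auto
  moreover have "U \<inter> pd a g -` (-{0}) = U0" by (auto simp: U0_def)
  ultimately have U0: "open U0" using U by (auto simp: openin_open_eq)
  have U0U: "U0 \<subseteq> U" by (auto simp: U0_def)
  have gd: "(g has_derivative (\<lambda>v. pd v g x)) (at x)" if "x \<in> U" for x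
    using smooth_fun_has_derivative[OF g that] .
  have bl: "bounded_linear (\<lambda>v. pd v g x)" if "x \<in> U" for x
    using gd[OF that] by (rule has_derivative_bounded_linear)
  define h where "h = (\<lambda>x. x + (g x - x \<bullet> a) *\<^sub>R a)"
  define h' where "h' = (\<lambda>x v. v + (pd v g x - v \<bullet> a) *\<^sub>R a)"
  have hd: "(h has_derivative h' x) (at x)" if "x \<in> U" for x
    unfolding h_def h'_def by (auto intro!: derivative_eq_intros gd[OF that])
  have blh: "bounded_linear (h' x)" if "x \<in> U" for x
    using hd[OF that] by (rule has_derivative_bounded_linear)
  \<comment> \<open>\<open>h' x\<close> is a rank-one perturbation of the identity; solving
    \<open>h' x w = v\<close> for \<open>w\<close> in \<open>v\<close> plus the line through
    \<open>a\<close> gives this inverse.\<close>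
  define k' where "k' = (\<lambda>x v. v + ((v \<bullet> a - pd v g x) / pd a g x) *\<^sub>R a)"
  have aa: "a \<bullet> a = 1" using a by simp
  have lin: "pd (v + r *\<^sub>R w) g x = pd v g x + r * pd w g x" if "x \<in> U" for v w r x
    using linear_add[OF bounded_linear.linear[OF bl[OF that]]]
      linear_cmul[OF bounded_linear.linear[OF bl[OF that]]] by simp
  have h'k': "h' x (k' x v) = v" if "x \<in> U0" for x v
  proof -
    define r where "r = (v \<bullet> a - pd v g x) / pd a g x"
    have "pd (v + r *\<^sub>R a) g x = v \<bullet> a"
      using that by (simp add: lin U0_def r_def)
    then show ?thesis
      using aa by (simp add: h'_def k'_def inner_add_left flip: r_def)
  qed
  have k'h': "k' x (h' x v) = v" if "x \<in> U0" for x v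
  proof -
    define r where "r = pd v g x - v \<bullet> a"
    have "(v + r *\<^sub>R a) \<bullet> a = pd v g x" using aa by (simp add: inner_add_left r_def)
    then have "k' x (v + r *\<^sub>R a) = v + (r + (pd v g x - pd (v + r *\<^sub>R a) g x) / pd a g x) *\<^sub>R a"
      by (simp add: k'_def scaleR_add_left)
    also have "\<dots> = v" using that by (simp add: lin U0_def)
    finally show ?thesis by (simp add: h'_def r_def)
  qed
  have blk: "bounded_linear (k' x)" if "x \<in> U" for x
    unfolding k'_def using bl[OF that]
    by (intro bounded_linear_add bounded_linear_ident bounded_linear_scaleR_const
        bounded_linear_sub bounded_linear_inner_left bounded_linear_compose[OF bounded_linear_divide])
  define H where "H = (\<lambda>x. Blinfun (h' x))"
  have H: "blinfun_apply (H x) = h' x" if "x \<in> U" for x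
    unfolding H_def using blh[OF that] by (simp add: bounded_linear_Blinfun_apply)
  have contH: "continuous_on U0 H"
  proof (rule continuous_on_blinfun_componentwise)
    fix i :: 'a assume i: "i \<in> Basis"
    have "continuous_on U0 (pd i g)"
      using smooth_fun_continuous[OF smooth_fun_pd[OF g U i]] U0U by (rule continuous_on_subset)
    then have "continuous_on U0 (\<lambda>x. h' x i)" unfolding h'_def by (intro continuous_intros)
    then show "continuous_on U0 (\<lambda>x. blinfun_apply (H x) i)"
      by (rule continuous_on_eq) (use H U0U in auto)
  qed
  have x0': "x0 \<in> U0" using x0 nz by (simp add: U0_def)
  have inv: "Blinfun (k' x0) o\<^sub>L H x0 = id_blinfun"
    using x0 x0' by (intro blinfun_eqI) (simp add: H bounded_linear_Blinfun_apply[OF blk[OF x0]] k'h')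
  obtain W V k kd where W: "open W" "W \<subseteq> U0" "x0 \<in> W" and V: "open V" and hom: "homeomorphism W V h k"
    and kd: "\<And>y. y \<in> V \<Longrightarrow> (k has_derivative kd y) (at y)"
      "\<And>y. y \<in> V \<Longrightarrow> kd y = inv_into UNIV (blinfun_apply (H (k y)))"
  proof (rule inverse_function_theorem[OF U0 _ contH x0' inv, of h])
    show "(h has_derivative blinfun_apply (H x)) (at x)" if "x \<in> U0" for x
      using hd H U0U that by (metis subsetD)
  qed (rule that, assumption+)
  have kW: "k y \<in> W" if "y \<in> V" for y using hom that by (auto simp: homeomorphism_def)
  have kU: "k y \<in> U" if "y \<in> V" for y using kW[OF that] W U0U by blast
  have hk: "h (k y) = y" if "y \<in> V" for y using hom that by (auto simp: homeomorphism_def)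
  have kd': "(k has_derivative k' (k y)) (at y)" if "y \<in> V" for y
  proof -
    have "inv_into UNIV (blinfun_apply (H (k y))) = k' (k y)"
      using subsetD[OF W(2) kW[OF that]] H[OF kU[OF that]] by (intro inv_equality) (simp_all add: h'k' k'h')
    then show ?thesis using kd that by metis
  qed
  \<comment> \<open>\<open>c b x\<close> is the coefficient of \<open>a\<close> in the correction
    \<open>k' x b - b\<close>. It does not depend on the function being composed with
    \<open>k\<close>, so linear relations between gradients survive the change of
    coordinates.\<close>
  define c where "c = (\<lambda>b x. (b \<bullet> a - pd b g x) / pd a g x)"
  have fk: "((\<lambda>y. f (k y)) has_derivative (\<lambda>v. pd v f (k y) + c v (k y) * pd a f (k y))) (at y)"
    if "smooth_fun U f" "y \<in> V" for f y
  proof -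
    have fd: "(f has_derivative (\<lambda>v. pd v f (k y))) (at (k y))"
      using smooth_fun_has_derivative[OF that(1) kU[OF that(2)]] .
    then have lf: "linear (\<lambda>v. pd v f (k y))" using has_derivative_linear by blast
    then show ?thesis
      using has_derivative_compose[OF kd'[OF that(2)] fd]
      by (simp add: k'_def linear_add[OF lf] linear_cmul[OF lf] c_def)
  qed
  show ?thesis
  proof (rule that[of W V k "\<lambda>b y. c b (k y)"])
    show "k ` V = W" using hom by (auto simp: homeomorphism_def)
    fix y assume y: "y \<in> V"
    have "h (k y) \<bullet> a = g (k y)" using aa by (simp add: h_def inner_add_left)
    then show "g (k y) = y \<bullet> a" using hk[OF y] by simp
    fix b :: 'a assume b: "b \<in> Basis" "b \<noteq> a"
    have "h (k y) \<bullet> b = k y \<bullet> b" using a b by (simp add: h_def inner_add_left inner_not_same_Basis)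
    then show "k y \<bullet> b = y \<bullet> b" using hk[OF y] by simp
  next
    fix f y b assume "smooth_fun U f" "y \<in> V" "b \<in> (Basis::'a set)"
    then show "pd b (\<lambda>y. f (k y)) y = pd b f (k y) + c b (k y) * pd a f (k y)"
      by (intro pd_eq[OF fk])
  next
    fix f assume f: "smooth_fun U f"
    show "smooth_fun V (\<lambda>y. f (k y))"
    \<comment> \<open>The derivative of \<open>k\<close> at \<open>y\<close> depends on
      \<open>k y\<close> only. Hence the composites with \<open>k\<close> of functions smooth on
      \<open>U0\<close> are closed under partial derivatives, and higher derivatives of
      \<open>k\<close> never have to be considered.\<close>
    proof (rule smooth_fun_coinduct[where X = "\<lambda>F. \<exists>f. smooth_fun U0 f \<and> F = (\<lambda>y. f (k y))"])
      show "\<exists>fa. smooth_fun U0 fa \<and> (\<lambda>y. f (k y)) = (\<lambda>y. fa (k y))"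
        using smooth_fun_subset[OF f U0U] by blast
      fix F assume "\<exists>f. smooth_fun U0 f \<and> F = (\<lambda>y. f (k y))"
      then obtain f where f: "smooth_fun U0 f" and F: "F = (\<lambda>y. f (k y))" by blast
      define F' where "F' = (\<lambda>x v. pd v f x + c v x * pd a f x)"
      have "smooth_fun U0 (\<lambda>x. F' x b)" if b: "b \<in> Basis" for b
        unfolding F'_def c_def
        by (intro smooth_fun_add smooth_fun_mult smooth_fun_divide smooth_fun_diff smooth_fun_const
            smooth_fun_pd[OF _ U0] f a b smooth_fun_subset[OF g U0U]) (auto simp: U0_def)
      moreover have "(F has_derivative F' (k y)) (at y)" if "y \<in> V" for y
      proof -
        have fd: "(f has_derivative (\<lambda>v. pd v f (k y))) (at (k y))"
          using smooth_fun_has_derivative[OF f] kW[OF that] W(2) by blast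
        then have lf: "linear (\<lambda>v. pd v f (k y))" using has_derivative_linear by blast
        then show ?thesis
          using has_derivative_compose[OF kd'[OF that] fd]
          by (simp add: F F'_def k'_def linear_add[OF lf] linear_cmul[OF lf] c_def)
      qed
      ultimately show "\<exists>f'. (\<forall>x\<in>V. (F has_derivative f' x) (at x)) \<and>
          (\<forall>b\<in>Basis. \<exists>f. smooth_fun U0 f \<and> (\<lambda>x. f' x b) = (\<lambda>y. f (k y)))"
        by (intro exI[where x = "\<lambda>y. F' (k y)"]) blast
    qed
  qed (use W V U0U in auto)
qed

section \<open>Sard's theorem\<close>

text \<open>Lindelof's theorem reduces nullity to a local question in the index. The sets
  \<open>T z\<close> are left general to cover images, where \<open>T z\<close> is a point, as well
  as cylinders, where it is a fibre of the projection.\<close>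

lemma negligible_UN_local:
  fixes Z :: "'a::second_countable_topology set" and T :: "'a \<Rightarrow> 'b::euclidean_space set"
  assumes "\<And>x. x \<in> Z \<Longrightarrow> \<exists>W. open W \<and> x \<in> W \<and> negligible (\<Union>z\<in>Z \<inter> W. T z)"
  shows "negligible (\<Union>z\<in>Z. T z)"
proof -
  obtain W where W: "\<And>x. x \<in> Z \<Longrightarrow> open (W x) \<and> x \<in> W x \<and> negligible (\<Union>z\<in>Z \<inter> W x. T z)"
    using assms by metis
  obtain \<F> where F: "\<F> \<subseteq> W ` Z" "countable \<F>" "\<Union>\<F> = \<Union>(W ` Z)"
    using Lindelof[of "W ` Z"] W by auto
  have "negligible (\<Union>((\<lambda>S. \<Union>z\<in>Z \<inter> S. T z) ` \<F>))"
    using F W by (intro negligible_countable_Union) auto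
  moreover have "(\<Union>z\<in>Z. T z) \<subseteq> \<Union>((\<lambda>S. \<Union>z\<in>Z \<inter> S. T z) ` \<F>)"
  proof
    fix y assume "y \<in> (\<Union>z\<in>Z. T z)"
    then obtain z where z: "z \<in> Z" "y \<in> T z" by blast
    then have "z \<in> \<Union>\<F>" using W F(3) by blast
    then show "y \<in> \<Union>((\<lambda>S. \<Union>z\<in>Z \<inter> S. T z) ` \<F>)" using z by blast
  qed
  ultimately show ?thesis by (rule negligible_subset)
qed

text \<open>The shear \<open>(y, t) \<mapsto> (y + (t - y \<bullet> b) b, y \<bullet> b)\<close> turns the sheared set into \<open>A \<times> \<real>\<close>.\<close>

lemma negligible_shear:
  fixes A :: "'b::euclidean_space set"
  assumes A: "A \<in> sets borel" and b: "b \<in> Basis"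
    and null: "negligible {(y, t::real). y + (t - y \<bullet> b) *\<^sub>R b \<in> A}"
  shows "negligible A"
proof -
  define \<Phi> where "\<Phi> = (\<lambda>(y::'b, t::real). (y + (t - y \<bullet> b) *\<^sub>R b, y \<bullet> b))"
  have bb: "b \<bullet> b = 1" using b by simp
  have "(\<Phi> has_derivative \<Phi>) (at x within S)" for x S
    unfolding \<Phi>_def split_beta' by (auto intro!: derivative_eq_intros)
  then have "\<Phi> differentiable_on {(y, t). y + (t - y \<bullet> b) *\<^sub>R b \<in> A}"
    unfolding differentiable_on_def differentiable_def by blast
  then have "negligible (\<Phi> ` {(y, t). y + (t - y \<bullet> b) *\<^sub>R b \<in> A})"
    by (rule negligible_differentiable_image_negligible[OF order_refl null])
  moreover have "A \<times> UNIV \<subseteq> \<Phi> ` {(y, t). y + (t - y \<bullet> b) *\<^sub>R b \<in> A}"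
  proof clarify
    fix y :: 'b and s :: real assume y: "y \<in> A"
    let ?p = "(y + (s - y \<bullet> b) *\<^sub>R b, y \<bullet> b)"
    have eq: "(y + (s - y \<bullet> b) *\<^sub>R b) \<bullet> b = s" using bb by (simp add: inner_add_left)
    have eq2: "y + (s - y \<bullet> b) *\<^sub>R b + (y \<bullet> b - s) *\<^sub>R b = y" by (simp add: algebra_simps)
    have "\<Phi> ?p = (y, s)"
      unfolding \<Phi>_def prod.case eq eq2 ..
    moreover have "?p \<in> {(y, t). y + (t - y \<bullet> b) *\<^sub>R b \<in> A}"
      unfolding mem_Collect_eq prod.case eq eq2 by (rule y)
    ultimately show "(y, s) \<in> \<Phi> ` {(y, t). y + (t - y \<bullet> b) *\<^sub>R b \<in> A}" by (rule image_eqI[OF sym])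
  qed
  ultimately have "negligible (A \<times> (UNIV::real set))" by (rule negligible_subset)
  then have "A \<times> (UNIV::real set) \<in> null_sets lebesgue" by (simp add: negligible_iff_null_sets)
  moreover have m: "A \<times> (UNIV::real set) \<in> sets lborel" using A by (simp add: borel_Times)
  ultimately have "emeasure lborel (A \<times> (UNIV::real set)) = 0"
    by (simp only: null_sets_completion_iff) (rule null_setsD1)
  moreover have "emeasure lborel (A \<times> (UNIV::real set)) = emeasure lborel A * emeasure lborel (UNIV::real set)"
    unfolding lborel_prod[symmetric] using A by (intro lborel.emeasure_pair_measure_Times) auto
  \<comment> \<open>The line has infinite measure, so the product vanishes only if the factor of
    \<open>A\<close> does.\<close>
  ultimately have "emeasure lborel A = 0" by (simp add: emeasure_lborel_UNIV)
  then have "A \<in> null_sets lborel" using A by (intro null_setsI) auto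
  then show ?thesis by (simp add: negligible_iff_null_sets null_sets_completionI)
qed

lemma borel_shear:
  assumes "A \<in> sets borel"
  shows "{(y::'b::euclidean_space, t::real). y + (t - y \<bullet> b) *\<^sub>R b \<in> A} \<in> sets lborel"
proof -
  have "(\<lambda>(y::'b, t::real). y + (t - y \<bullet> b) *\<^sub>R b) \<in> borel_measurable borel"
    unfolding split_beta' by (intro borel_measurable_continuous_onI continuous_intros)
  from measurable_sets[OF this assms] show ?thesis by (simp add: vimage_def split_beta')
qed

text \<open>Fubini's theorem for the hyperplanes on which coordinate \<open>b\<close> equals
  \<open>t\<close>. Each slice is recorded as a cylinder: the points that fall into \<open>A\<close>
  once coordinate \<open>b\<close> is replaced by \<open>t\<close>. It lives in the same type as
  \<open>A\<close>, so slicing never changes the space.\<close>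

lemma negligible_slices:
  fixes A :: "'b::euclidean_space set"
  assumes A: "A \<in> sets borel" and b: "b \<in> Basis"
    and null: "\<And>t::real. negligible {y. y + (t - y \<bullet> b) *\<^sub>R b \<in> A}"
  shows "negligible A"
proof (rule negligible_shear[OF A b])
  let ?S = "{(y, t::real). y + (t - y \<bullet> b) *\<^sub>R b \<in> A}"
  have m: "?S \<in> sets lborel" by (rule borel_shear[OF A])
  have "emeasure lborel ?S = (\<integral>\<^sup>+t. emeasure lborel ((\<lambda>x. (x, t)) -` ?S) \<partial>lborel)"
    unfolding lborel_prod[symmetric] by (rule lborel_pair.emeasure_pair_measure_alt2) (rule m[folded lborel_prod])
  also have "\<dots> = (\<integral>\<^sup>+t. 0 \<partial>(lborel :: real measure))"
  proof (rule nn_integral_cong)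
    fix t :: real
    have "(\<lambda>x. (x, t)) -` ?S = {y. y + (t - y \<bullet> b) *\<^sub>R b \<in> A}" by auto
    moreover have "{y. y + (t - y \<bullet> b) *\<^sub>R b \<in> A} \<in> sets lborel"
    proof -
      have "(\<lambda>y. y + (t - y \<bullet> b) *\<^sub>R b) \<in> borel_measurable borel"
        by (intro borel_measurable_continuous_onI continuous_intros)
      from measurable_sets[OF this A] show ?thesis by (simp add: vimage_def)
    qed
    ultimately show "emeasure lborel ((\<lambda>x. (x, t)) -` ?S) = 0"
      using null[of t] by (simp add: negligible_iff_null_sets null_sets_def)
  qed
  finally have "?S \<in> null_sets lborel" using m by (intro null_setsI) auto
  then show "negligible ?S" by (simp add: negligible_iff_null_sets null_sets_completionI)
qed

text \<open>A Borel null set around \<open>S\<close> gives a measurable strip, and the shear turns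
  that strip into the product of the whole space with the null set.\<close>

lemma negligible_strip:
  fixes S :: "real set"
  assumes "negligible S" and b: "b \<in> Basis"
  shows "negligible {y::'b::euclidean_space. y \<bullet> b \<in> S}"
proof -
  obtain N where N: "N \<in> null_sets lborel" "S \<subseteq> N"
    using assms(1) unfolding negligible_iff_null_sets null_sets_completion_iff2 by blast
  have bN: "N \<in> sets borel" using null_setsD2[OF N(1)] by simp
  have bb: "b \<bullet> b = 1" using b by simp
  let ?A = "{y::'b. y \<bullet> b \<in> N}"
  have A: "?A \<in> sets borel"
  proof -
    have "(\<lambda>y::'b. y \<bullet> b) \<in> borel_measurable borel" by simp
    from measurable_sets[OF this bN] show ?thesis by (simp add: vimage_def)
  qed
  have "negligible ?A"
  proof (rule negligible_shear[OF A b])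
    have "{(y::'b, t::real). y + (t - y \<bullet> b) *\<^sub>R b \<in> ?A} = UNIV \<times> N"
      using bb by (auto simp: inner_add_left)
    moreover have "emeasure lborel ((UNIV::'b set) \<times> N) = 0"
      unfolding lborel_prod[symmetric] using null_setsD1[OF N(1)] bN
      by (subst lborel.emeasure_pair_measure_Times) auto
    moreover have "(UNIV::'b set) \<times> N \<in> sets lborel" using bN by (simp add: borel_Times)
    ultimately have "{(y::'b, t::real). y + (t - y \<bullet> b) *\<^sub>R b \<in> ?A} \<in> null_sets lborel"
      by (intro null_setsI) auto
    then show "negligible {(y::'b, t::real). y + (t - y \<bullet> b) *\<^sub>R b \<in> ?A}"
      by (simp add: negligible_iff_null_sets null_sets_completionI)
  qed
  then show ?thesis by (rule negligible_subset) (use N(2) in blast)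
qed

section \<open>Increments at points where many derivatives vanish\<close>

lemma pd_eq_sum:
  assumes "smooth_fun U g" "z \<in> U"
  shows "pd v g z = (\<Sum>a\<in>Basis. (v \<bullet> a) * pd a g z)"
proof -
  have l: "linear (\<lambda>v. pd v g z)"
    using smooth_fun_has_derivative[OF assms] has_derivative_linear by blast
  have "pd v g z = pd (\<Sum>a\<in>Basis. (v \<bullet> a) *\<^sub>R a) g z" by (simp add: euclidean_representation)
  also have "\<dots> = (\<Sum>a\<in>Basis. (v \<bullet> a) * pd a g z)"
    by (simp add: linear_sum[OF l, simplified] linear_cmul[OF l, simplified])
  finally show ?thesis .
qed

text \<open>Mean value theorem on the segment from \<open>x\<close> to \<open>y\<close>, which
  changes no coordinate outside \<open>B\<close>; so the partial derivatives have to be bounded on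
  that slice only. The factor \<open>y - x\<close> gains one order.\<close>

lemma increment_bound:
  assumes g: "smooth_fun U g" and K: "convex K" "K \<subseteq> U" and B: "B \<subseteq> Basis" and C: "\<And>a. C a \<ge> 0"
    and xy: "x \<in> K" "y \<in> K" and off: "\<And>b. b \<in> Basis - B \<Longrightarrow> (y - x) \<bullet> b = 0"
    and bd: "\<And>a z. a \<in> B \<Longrightarrow> z \<in> K \<Longrightarrow> (\<And>b. b \<in> Basis - B \<Longrightarrow> (z - x) \<bullet> b = 0) \<Longrightarrow>
              \<bar>pd a g z\<bar> \<le> C a * norm (z - x) ^ k"
  shows "\<bar>g y - g x\<bar> \<le> (\<Sum>a\<in>B. C a) * norm (y - x) ^ Suc k"
proof -
  define \<gamma> where "\<gamma> = (\<lambda>t::real. x + t *\<^sub>R (y - x))"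
  have \<gamma>K: "\<gamma> t \<in> K" if "t \<in> {0..1}" for t
    using convexD_alt[OF K(1) xy, of t] that by (simp add: \<gamma>_def algebra_simps)
  have d: "((\<lambda>t. g (\<gamma> t)) has_derivative (\<lambda>s. pd (s *\<^sub>R (y - x)) g (\<gamma> t))) (at t within {0..1})"
    if "t \<in> {0..1}" for t
  proof (rule has_derivative_compose[where f = \<gamma> and f' = "\<lambda>s. s *\<^sub>R (y - x)"])
    show "(\<gamma> has_derivative (\<lambda>s. s *\<^sub>R (y - x))) (at t within {0..1})"
      unfolding \<gamma>_def by (auto intro!: derivative_eq_intros)
    show "(g has_derivative (\<lambda>v. pd v g (\<gamma> t))) (at (\<gamma> t))"
      using \<gamma>K[OF that] K(2) by (intro smooth_fun_has_derivative[OF g]) auto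
  qed
  obtain t where t: "t \<in> {0..1}" "g (\<gamma> 1) - g (\<gamma> 0) = pd ((1 - 0) *\<^sub>R (y - x)) g (\<gamma> t)"
    using mvt_very_simple[of 0 1 "\<lambda>t. g (\<gamma> t)", OF _ d] by auto
  define z where "z = \<gamma> t"
  have zK: "z \<in> K" using \<gamma>K[OF t(1)] by (simp add: z_def)
  have zx: "z - x = t *\<^sub>R (y - x)" by (simp add: z_def \<gamma>_def)
  have nz: "norm (z - x) \<le> norm (y - x)"
    using t(1) unfolding zx by (simp add: mult_left_le_one_le)
  have "g y - g x = pd (y - x) g z" using t(2) by (simp add: \<gamma>_def z_def)
  also have "\<dots> = (\<Sum>a\<in>Basis. ((y - x) \<bullet> a) * pd a g z)"
    using zK K(2) by (intro pd_eq_sum[OF g]) auto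
  also have "\<dots> = (\<Sum>a\<in>B. ((y - x) \<bullet> a) * pd a g z)"
    using B off by (intro sum.mono_neutral_right) auto
  finally have "\<bar>g y - g x\<bar> \<le> (\<Sum>a\<in>B. \<bar>((y - x) \<bullet> a) * pd a g z\<bar>)" by (simp add: sum_abs)
  also have "\<dots> \<le> (\<Sum>a\<in>B. norm (y - x) * (C a * norm (y - x) ^ k))"
  proof (rule sum_mono)
    fix a assume a: "a \<in> B"
    have "\<bar>pd a g z\<bar> \<le> C a * norm (z - x) ^ k"
      using a zK by (rule bd) (use off zx in auto)
    also have "\<dots> \<le> C a * norm (y - x) ^ k"
      using nz C by (intro mult_left_mono power_mono) auto
    finally have "\<bar>pd a g z\<bar> \<le> C a * norm (y - x) ^ k" .
    moreover have "\<bar>(y - x) \<bullet> a\<bar> \<le> norm (y - x)" using a B by (intro Basis_le_norm) auto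
    ultimately show "\<bar>((y - x) \<bullet> a) * pd a g z\<bar> \<le> norm (y - x) * (C a * norm (y - x) ^ k)"
      unfolding abs_mult by (intro mult_mono) auto
  qed
  also have "\<dots> = (\<Sum>a\<in>B. C a) * norm (y - x) ^ Suc k"
    by (simp add: sum_distrib_right mult_ac)
  finally show ?thesis .
qed

text \<open>A Taylor estimate without Taylor polynomials: the induction hypothesis bounds the
  increments of each \<open>pd a g\<close>, and the mean value bound raises the order by one. Lists
  are nonempty because \<open>g\<close> itself need not vanish at \<open>x\<close>. At the start,
  compactness of \<open>K\<close> bounds the first derivatives.\<close>

lemma flat_increment_bound:
  assumes U: "open U" and K: "compact K" "convex K" "K \<subseteq> U" and B: "B \<subseteq> Basis"
    and g: "smooth_fun U g"
  shows "\<exists>C\<ge>0. \<forall>x\<in>K. \<forall>y\<in>K. (\<forall>b\<in>Basis - B. (y - x) \<bullet> b = 0) \<and>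
    (\<forall>as. set as \<subseteq> B \<and> as \<noteq> [] \<and> length as \<le> k \<longrightarrow> foldr pd as g x = 0) \<longrightarrow>
    \<bar>g y - g x\<bar> \<le> C * norm (y - x) ^ Suc k"
  using g
proof (induction k arbitrary: g)
  case 0
  have "\<exists>C\<ge>0. \<forall>z\<in>K. \<bar>pd a g z\<bar> \<le> C" if "a \<in> B" for a
  proof -
    have "continuous_on K (pd a g)"
      using smooth_fun_continuous[OF smooth_fun_pd[OF 0 U]] that B K(3)
      by (meson continuous_on_subset subsetD)
    then have "bounded (pd a g ` K)" using K(1) by (intro compact_imp_bounded compact_continuous_image)
    then obtain M where "\<forall>z\<in>K. \<bar>pd a g z\<bar> \<le> M" by (auto simp: bounded_iff)
    then show ?thesis by (intro exI[where x = "max 0 M"]) auto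
  qed
  then obtain C where C: "\<And>a. a \<in> B \<Longrightarrow> C a \<ge> 0 \<and> (\<forall>z\<in>K. \<bar>pd a g z\<bar> \<le> C a)" by metis
  \<comment> \<open>Extended by zero, the constants are nonnegative for every \<open>a\<close>, as
    the mean value bound demands.\<close>
  define D where "D = (\<lambda>a. if a \<in> B then C a else 0)"
  have D: "D a \<ge> 0" for a using C by (auto simp: D_def)
  have "\<bar>g y - g x\<bar> \<le> (\<Sum>a\<in>B. D a) * norm (y - x) ^ Suc 0"
    if "x \<in> K" "y \<in> K" "\<And>b. b \<in> Basis - B \<Longrightarrow> (y - x) \<bullet> b = 0" for x y
    using C by (intro increment_bound[OF 0 K(2,3) B D that]) (auto simp: D_def)
  then show ?case using D by (intro exI[where x = "\<Sum>a\<in>B. D a"]) (auto intro: sum_nonneg)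
next
  case (Suc k)
  have sm: "smooth_fun U (pd a g)" if "a \<in> B" for a using smooth_fun_pd[OF Suc.prems U] that B by blast
  define Q where "Q = (\<lambda>a C. C \<ge> 0 \<and> (\<forall>x\<in>K. \<forall>y\<in>K. (\<forall>b\<in>Basis - B. (y - x) \<bullet> b = 0) \<and>
    (\<forall>as. set as \<subseteq> B \<and> as \<noteq> [] \<and> length as \<le> k \<longrightarrow> foldr pd as (pd a g) x = 0) \<longrightarrow>
    \<bar>pd a g y - pd a g x\<bar> \<le> C * norm (y - x) ^ Suc k))"
  have "\<exists>C. Q a C" if "a \<in> B" for a unfolding Q_def by (rule Suc.IH[OF sm[OF that]])
  then obtain C where "\<And>a. a \<in> B \<Longrightarrow> Q a (C a)" by metis
  then have C: "\<And>a. a \<in> B \<Longrightarrow> C a \<ge> 0"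
    and CQ: "\<And>a x y. a \<in> B \<Longrightarrow> x \<in> K \<Longrightarrow> y \<in> K \<Longrightarrow> (\<forall>b\<in>Basis - B. (y - x) \<bullet> b = 0) \<Longrightarrow>
    (\<forall>as. set as \<subseteq> B \<and> as \<noteq> [] \<and> length as \<le> k \<longrightarrow> foldr pd as (pd a g) x = 0) \<Longrightarrow>
    \<bar>pd a g y - pd a g x\<bar> \<le> C a * norm (y - x) ^ Suc k"
    unfolding Q_def by blast+
  define D where "D = (\<lambda>a. if a \<in> B then C a else 0)"
  have D: "D a \<ge> 0" for a using C by (auto simp: D_def)
  have "\<bar>g y - g x\<bar> \<le> (\<Sum>a\<in>B. D a) * norm (y - x) ^ Suc (Suc k)"
    if xy: "x \<in> K" "y \<in> K" "\<And>b. b \<in> Basis - B \<Longrightarrow> (y - x) \<bullet> b = 0"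
      and fl: "\<forall>as. set as \<subseteq> B \<and> as \<noteq> [] \<and> length as \<le> Suc k \<longrightarrow> foldr pd as g x = 0" for x y
  proof (rule increment_bound[OF Suc.prems K(2,3) B D xy])
    fix a z assume a: "a \<in> B" and z: "z \<in> K" and zx: "\<And>b. b \<in> Basis - B \<Longrightarrow> (z - x) \<bullet> b = 0"
    \<comment> \<open>The innermost derivative is the last entry of the list, so derivatives of
      \<open>pd a g\<close> belong to lists ending in \<open>a\<close>.\<close>
    have "foldr pd as (pd a g) x = 0" if "set as \<subseteq> B" "as \<noteq> []" "length as \<le> k" for as
      using fl[rule_format, of "as @ [a]"] that a by simp
    then have "\<bar>pd a g z - pd a g x\<bar> \<le> C a * norm (z - x) ^ Suc k"
      using CQ[OF a xy(1) z] zx by blast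
    moreover have "pd a g x = 0" using fl[rule_format, of "[a]"] a by simp
    ultimately show "\<bar>pd a g z\<bar> \<le> D a * norm (z - x) ^ Suc k" using a by (simp add: D_def)
  qed
  then show ?case using D by (intro exI[where x = "\<Sum>a\<in>B. D a"]) (auto intro: sum_nonneg)
qed

text \<open>A grid of mesh \<open>1/N\<close> has at most \<open>(3N)^d\<close> relevant cells, and
  on the part of \<open>S\<close> in one cell \<open>g\<close> varies by a multiple of
  \<open>N^-(d+1)\<close>. The total length is at most \<open>M/N\<close>. The exponent has to
  exceed the dimension, which is why derivatives up to order \<open>card B\<close> are
  controlled.\<close>

lemma negligible_flat_image:
  fixes g :: "'a::euclidean_space \<Rightarrow> real"
  assumes B: "B \<subseteq> Basis" and C: "C \<ge> 0"
    and near: "\<And>x. x \<in> S \<Longrightarrow> norm (x - x0) \<le> 1"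
    and off: "\<And>x y b. x \<in> S \<Longrightarrow> y \<in> S \<Longrightarrow> b \<in> Basis - B \<Longrightarrow> (y - x) \<bullet> b = 0"
    and bd: "\<And>x y. x \<in> S \<Longrightarrow> y \<in> S \<Longrightarrow> \<bar>g y - g x\<bar> \<le> C * norm (y - x) ^ Suc (card B)"
  shows "negligible (g ` S)"
  unfolding negligible_outer_le
proof (intro allI impI)
  fix e :: real assume e: "e > 0"
  define d where "d = card B"
  have fin: "finite B" using B finite_Basis finite_subset by blast
  \<comment> \<open>\<open>3 ^ d\<close> comes from \<open>2N + 1 \<le> 3N\<close> cells in each
    direction; the other factor is the length of an interval of radius \<open>\<delta>\<close>, two
    points of \<open>S\<close> in one cell being at most \<open>d/N\<close> apart.\<close>
  define M where "M = 3 ^ d * (2 * C * real d ^ Suc d)"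
  obtain N0 :: nat where N0: "M / e \<le> real N0" using real_arch_simple by blast
  define N where "N = Suc N0"
  have N: "N \<ge> 1" "M / e \<le> real N" using N0 by (auto simp: N_def)
  define cell where "cell = (\<lambda>x. \<lambda>b\<in>B. \<lfloor>real N * ((x - x0) \<bullet> b)\<rfloor>)"
  define P where "P = (\<Pi>\<^sub>E b\<in>B. {- int N .. int N})"
  have finP: "finite P" unfolding P_def by (intro finite_PiE fin) auto
  have cardP: "real (card P) \<le> (3 * real N) ^ d"
  proof -
    have "card P = (\<Prod>b\<in>B. card {- int N .. int N})" unfolding P_def by (rule card_PiE[OF fin])
    also have "card {- int N .. int N} = 2 * N + 1"
      unfolding card_atLeastAtMost_int by linarith
    finally have "card P = (2 * N + 1) ^ d" by (simp add: d_def)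
    then have "real (card P) = (2 * real N + 1) ^ d" by (simp add: add.commute)
    also have "\<dots> \<le> (3 * real N) ^ d" using N(1) by (intro power_mono) auto
    finally show ?thesis .
  qed
  have cellP: "cell x \<in> P" if "x \<in> S" for x
  proof -
    have "\<lfloor>real N * ((x - x0) \<bullet> b)\<rfloor> \<in> {- int N .. int N}" if "b \<in> B" for b
    proof -
      have "\<bar>(x - x0) \<bullet> b\<bar> \<le> 1" using near[OF \<open>x \<in> S\<close>] Basis_le_norm[of b "x - x0"] that B by auto
      then have "\<bar>real N * ((x - x0) \<bullet> b)\<bar> \<le> real N"
        by (simp add: abs_mult mult_left_le)
      then have "- real N \<le> real N * ((x - x0) \<bullet> b)" "real N * ((x - x0) \<bullet> b) \<le> real N" by linarith+
      then show ?thesis by (auto simp: le_floor_iff floor_le_iff)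
    qed
    then show ?thesis by (auto simp: cell_def P_def)
  qed
  have small: "norm (y - x) \<le> real d / real N" if xy: "x \<in> S" "y \<in> S" "cell x = cell y" for x y
  proof -
    have "norm (y - x) \<le> (\<Sum>b\<in>Basis. \<bar>(y - x) \<bullet> b\<bar>)" by (rule norm_le_l1)
    also have "\<dots> = (\<Sum>b\<in>B. \<bar>(y - x) \<bullet> b\<bar>)"
      using B off[OF xy(1,2)] by (intro sum.mono_neutral_right) auto
    also have "\<dots> \<le> (\<Sum>b\<in>B. 1 / real N)"
    proof (rule sum_mono)
      fix b assume b: "b \<in> B"
      have "\<lfloor>real N * ((x - x0) \<bullet> b)\<rfloor> = \<lfloor>real N * ((y - x0) \<bullet> b)\<rfloor>"
        using fun_cong[OF xy(3), of b] b by (simp add: cell_def)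
      then have "\<bar>real N * ((y - x0) \<bullet> b) - real N * ((x - x0) \<bullet> b)\<bar> \<le> 1" by linarith
      moreover have "real N * ((y - x0) \<bullet> b) - real N * ((x - x0) \<bullet> b) = real N * ((y - x) \<bullet> b)"
        by (simp add: inner_diff_left algebra_simps)
      ultimately have "real N * \<bar>(y - x) \<bullet> b\<bar> \<le> 1" by (simp add: abs_mult)
      then show "\<bar>(y - x) \<bullet> b\<bar> \<le> 1 / real N" using N(1) by (simp add: field_simps)
    qed
    finally show ?thesis by (simp add: d_def)
  qed
  define \<delta> where "\<delta> = C * (real d / real N) ^ Suc d"
  have \<delta>: "\<delta> \<ge> 0" using C by (simp add: \<delta>_def)
  \<comment> \<open>The representative is taken in \<open>S\<close>, not at the centre of the cell,
    because the increment bound holds between points of \<open>S\<close> only.\<close>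
  define r where "r = (\<lambda>q. SOME x. x \<in> S \<and> cell x = q)"
  have r: "r q \<in> S \<and> cell (r q) = q" if "q \<in> cell ` S" for q
    unfolding r_def by (rule someI_ex) (use that in blast)
  have finQ: "finite (cell ` S)" by (rule finite_subset[OF _ finP]) (use cellP in blast)
  let ?I = "\<lambda>q. {g (r q) - \<delta> .. g (r q) + \<delta>}"
  let ?T = "\<Union>q\<in>cell ` S. ?I q"
  have "g ` S \<subseteq> ?T"
  proof clarify
    fix x assume x: "x \<in> S"
    have rx: "r (cell x) \<in> S" "cell (r (cell x)) = cell x" using r x by blast+
    have "\<bar>g x - g (r (cell x))\<bar> \<le> C * norm (x - r (cell x)) ^ Suc d"
      unfolding d_def by (rule bd[OF rx(1) x])
    also have "\<dots> \<le> \<delta>"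
      unfolding \<delta>_def using C small[OF rx(1) x rx(2)] by (intro mult_left_mono power_mono) auto
    finally have "g x \<in> ?I (cell x)" by (auto simp: abs_le_iff)
    then show "g x \<in> ?T" using x by blast
  qed
  moreover have "?T \<in> lmeasurable" using finQ by (intro fmeasurable.finite_UN) auto
  moreover have "measure lebesgue ?T \<le> e"
  proof -
    have "measure lebesgue ?T \<le> (\<Sum>q\<in>cell ` S. measure lebesgue (?I q))"
      using finQ by (intro measure_UNION_le) auto
    also have "\<dots> = real (card (cell ` S)) * (2 * \<delta>)" using \<delta> by simp
    also have "\<dots> \<le> (3 * real N) ^ d * (2 * \<delta>)"
    proof (rule mult_right_mono)
      have "card (cell ` S) \<le> card P" by (rule card_mono[OF finP]) (use cellP in blast)
      then show "real (card (cell ` S)) \<le> (3 * real N) ^ d" using cardP by linarith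
    qed (use \<delta> in simp)
    also have "\<dots> = M / real N"
      using N(1) by (simp add: M_def \<delta>_def power_divide power_mult_distrib)
    also have "\<dots> \<le> e" using N e by (simp add: field_simps)
    finally show ?thesis .
  qed
  ultimately show "\<exists>T. g ` S \<subseteq> T \<and> T \<in> lmeasurable \<and> measure lebesgue T \<le> e" by blast
qed


section \<open>Sard's theorem for one component\<close>

text \<open>\<open>U\<close>, \<open>g\<close> and \<open>p\<close> vary in the induction, since
  straightening changes all of them. No base case is needed: for empty \<open>B\<close> there are no
  nonempty lists, so all of \<open>Z\<close> is flat and the grid argument applies in dimension
  0.\<close>

lemma scalar_sard:
  fixes g :: "'a::euclidean_space \<Rightarrow> real"
  assumes "B \<subseteq> Basis" "open U" "smooth_fun U g"
  shows "negligible (g ` {x \<in> U. (\<forall>b\<in>Basis - B. x \<bullet> b = p \<bullet> b) \<and> (\<forall>a\<in>B. pd a g x = 0)})"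
  using assms
proof (induction "card B" arbitrary: B U g p rule: less_induct)
  case less
  note B = less.prems(1) and U = less.prems(2) and g = less.prems(3)
  have fin: "finite B" using B finite_Basis finite_subset by blast
  define Z where "Z = {x \<in> U. (\<forall>b\<in>Basis - B. x \<bullet> b = p \<bullet> b) \<and> (\<forall>a\<in>B. pd a g x = 0)}"
  define flat where "flat = {x \<in> Z. \<forall>as. set as \<subseteq> B \<and> as \<noteq> [] \<and> length as \<le> card B \<longrightarrow> foldr pd as g x = 0}"
  \<comment> \<open>The points where the iterated derivative along \<open>as\<close> vanishes to
    first order in direction \<open>a\<close>, so that it can serve as a coordinate there.\<close>
  define jet where "jet = (\<lambda>a as. {x \<in> Z. foldr pd as g x = 0 \<and> pd a (foldr pd as g) x \<noteq> 0})"
  have sm: "smooth_fun U (foldr pd as g)" if "set as \<subseteq> B" for as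
    using that by (induction as) (use g smooth_fun_pd[OF _ U] B in auto)
  have neg_flat: "negligible (\<Union>x\<in>flat. {g x})"
  proof (rule negligible_UN_local)
    fix x0 assume "x0 \<in> flat"
    then have "x0 \<in> U" by (simp add: flat_def Z_def)
    then obtain r where r: "r > 0" "cball x0 r \<subseteq> U" using U open_contains_cball by blast
    define s where "s = min r 1"
    have s: "s > 0" "s \<le> 1" "cball x0 s \<subseteq> U" using r by (auto simp: s_def)
    obtain C where C: "C \<ge> 0" "\<And>x y. x \<in> cball x0 s \<Longrightarrow> y \<in> cball x0 s \<Longrightarrow> (\<forall>b\<in>Basis - B. (y - x) \<bullet> b = 0) \<Longrightarrow>
      (\<forall>as. set as \<subseteq> B \<and> as \<noteq> [] \<and> length as \<le> card B \<longrightarrow> foldr pd as g x = 0) \<Longrightarrow>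
      \<bar>g y - g x\<bar> \<le> C * norm (y - x) ^ Suc (card B)"
      using flat_increment_bound[OF U compact_cball convex_cball s(3) B g, of "card B"] by blast
    have "negligible (g ` (flat \<inter> ball x0 s))"
    proof (rule negligible_flat_image[OF B C(1)])
      fix x assume "x \<in> flat \<inter> ball x0 s"
      then show "norm (x - x0) \<le> 1" using s(2) by (simp add: dist_norm norm_minus_commute)
    next
      fix x y b assume "x \<in> flat \<inter> ball x0 s" "y \<in> flat \<inter> ball x0 s" "b \<in> Basis - B"
      then show "(y - x) \<bullet> b = 0" by (auto simp: flat_def Z_def inner_diff_left)
    next
      fix x y assume xy: "x \<in> flat \<inter> ball x0 s" "y \<in> flat \<inter> ball x0 s"
      show "\<bar>g y - g x\<bar> \<le> C * norm (y - x) ^ Suc (card B)"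
      proof (rule C(2))
        show "\<forall>b\<in>Basis - B. (y - x) \<bullet> b = 0"
          using xy by (auto simp: flat_def Z_def inner_diff_left)
      qed (use xy in \<open>auto simp: flat_def\<close>)
    qed
    moreover have "(\<Union>x\<in>flat \<inter> ball x0 s. {g x}) = g ` (flat \<inter> ball x0 s)" by auto
    ultimately show "\<exists>W. open W \<and> x0 \<in> W \<and> negligible (\<Union>x\<in>flat \<inter> W. {g x})"
      using s(1) by (intro exI[where x = "ball x0 s"]) simp
  qed
  have neg_jet: "negligible (\<Union>x\<in>jet a as. {g x})" if a: "a \<in> B" and as: "set as \<subseteq> B" for a as
  proof (rule negligible_UN_local)
    fix x0 assume x0: "x0 \<in> jet a as"
    define w where "w = foldr pd as g"
    have aB: "a \<in> Basis" using a B by blast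
    have x0U: "x0 \<in> U" "pd a w x0 \<noteq> 0" using x0 by (auto simp: jet_def Z_def w_def)
    obtain W V k c where W: "open W" "x0 \<in> W" "W \<subseteq> U" and V: "open V" "k ` V = W"
      and wk: "\<And>y. y \<in> V \<Longrightarrow> w (k y) = y \<bullet> a"
      and kb: "\<And>y b. y \<in> V \<Longrightarrow> b \<in> Basis \<Longrightarrow> b \<noteq> a \<Longrightarrow> k y \<bullet> b = y \<bullet> b"
      and ks: "\<And>f. smooth_fun U f \<Longrightarrow> smooth_fun V (\<lambda>y. f (k y))"
      and kpd: "\<And>f y b. smooth_fun U f \<Longrightarrow> y \<in> V \<Longrightarrow> b \<in> Basis \<Longrightarrow>
         pd b (\<lambda>y. f (k y)) y = pd b f (k y) + c b y * pd a f (k y)"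
      by (rule straighten[OF U sm[OF as, folded w_def] aB x0U]) (rule that; assumption)
    \<comment> \<open>After straightening, \<open>w\<close> is coordinate \<open>a\<close>. Its
      zeros have that coordinate 0, and the new base point fixes it at this value.\<close>
    define p' where "p' = p - (p \<bullet> a) *\<^sub>R a"
    have p'a: "p' \<bullet> a = 0" using aB by (simp add: p'_def inner_diff_left)
    have p'b: "p' \<bullet> b = p \<bullet> b" if "b \<in> Basis" "b \<noteq> a" for b
      using aB that by (simp add: p'_def inner_diff_left inner_not_same_Basis)
    let ?B = "B - {a}"
    have "card ?B < card B" using a fin by (rule card_Diff1_less[rotated])
    from less.hyps[OF this _ V(1) ks[OF g], of p']
    have "negligible ((\<lambda>y. g (k y)) ` {y \<in> V. (\<forall>b\<in>Basis - ?B. y \<bullet> b = p' \<bullet> b) \<and>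
        (\<forall>b\<in>?B. pd b (\<lambda>y. g (k y)) y = 0)})"
      using B by blast
    moreover have "(\<Union>x\<in>jet a as \<inter> W. {g x}) \<subseteq> (\<lambda>y. g (k y)) ` {y \<in> V. (\<forall>b\<in>Basis - ?B. y \<bullet> b = p' \<bullet> b) \<and>
        (\<forall>b\<in>?B. pd b (\<lambda>y. g (k y)) y = 0)}"
    proof clarify
      fix x assume x: "x \<in> jet a as" "x \<in> W"
      then obtain y where y: "y \<in> V" "x = k y" using V(2) by blast
      have "y \<bullet> b = p' \<bullet> b" if b: "b \<in> Basis - ?B" for b
      proof (cases "b = a")
        case True
        have "w x = 0" using x(1) by (simp add: jet_def w_def)
        then show ?thesis using wk[OF y(1)] y(2) p'a True by simp
      next
        case False
        then have "x \<bullet> b = p \<bullet> b" using x(1) b by (auto simp: jet_def Z_def)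
        then show ?thesis using kb[OF y(1) _ False] p'b[OF _ False] b y(2) by simp
      qed
      \<comment> \<open>The chain rule involves the partial derivatives of \<open>g\<close> along
        \<open>b\<close> and along \<open>a\<close>; both vanish on \<open>Z\<close>.\<close>
      moreover have "pd b (\<lambda>y. g (k y)) y = 0" if b: "b \<in> ?B" for b
        using kpd[OF g y(1), of b] b B a x(1) y(2) by (auto simp: jet_def Z_def)
      ultimately show "g x \<in> (\<lambda>y. g (k y)) ` {y \<in> V. (\<forall>b\<in>Basis - ?B. y \<bullet> b = p' \<bullet> b) \<and>
        (\<forall>b\<in>?B. pd b (\<lambda>y. g (k y)) y = 0)}"
        using y by blast
    qed
    ultimately have "negligible (\<Union>x\<in>jet a as \<inter> W. {g x})" by (rule negligible_subset)
    then show "\<exists>W. open W \<and> x0 \<in> W \<and> negligible (\<Union>x\<in>jet a as \<inter> W. {g x})"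
      using W by blast
  qed
  have cover: "Z \<subseteq> flat \<union> (\<Union>q\<in>B \<times> lists B. jet (fst q) (snd q))"
  proof
    fix x assume x: "x \<in> Z"
    show "x \<in> flat \<union> (\<Union>q\<in>B \<times> lists B. jet (fst q) (snd q))"
    proof (rule ccontr)
      assume no: "\<not> ?thesis"
      \<comment> \<open>Outside every \<open>jet a as\<close> vanishing passes from each derivative
        to the next, starting from the first derivatives, which vanish on \<open>Z\<close>.\<close>
      have "foldr pd as g x = 0" if "set as \<subseteq> B" "as \<noteq> []" for as
        using that
      proof (induction as)
        case (Cons a as)
        show ?case
        proof (cases "as = []")
          case True
          then show ?thesis using x Cons.prems by (auto simp: Z_def)
        next
          case False
          then have "foldr pd as g x = 0" using Cons by auto
          moreover have "x \<notin> jet a as" using no Cons.prems by force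
          ultimately show ?thesis using x by (simp add: jet_def)
        qed
      qed simp
      then have "x \<in> flat" using x by (simp add: flat_def)
      then show False using no by blast
    qed
  qed
  have "negligible (\<Union>((\<lambda>q. \<Union>x\<in>jet (fst q) (snd q). {g x}) ` (B \<times> lists B)))"
  proof (intro negligible_countable_Union countable_image)
    show "countable (B \<times> lists B)" using countable_finite[OF fin] by auto
    fix S assume "S \<in> (\<lambda>q. \<Union>x\<in>jet (fst q) (snd q). {g x}) ` (B \<times> lists B)"
    then obtain q where S: "S = (\<Union>x\<in>jet (fst q) (snd q). {g x})" "q \<in> B \<times> lists B" by blast
    show "negligible S" unfolding S(1) by (rule neg_jet) (use S(2) in auto)
  qed
  then have "negligible ((\<Union>x\<in>flat. {g x}) \<union> \<Union>((\<lambda>q. \<Union>x\<in>jet (fst q) (snd q). {g x}) ` (B \<times> lists B)))"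
    using neg_flat by (rule negligible_Un[rotated])
  moreover have "g ` Z \<subseteq> (\<Union>x\<in>flat. {g x}) \<union> \<Union>((\<lambda>q. \<Union>x\<in>jet (fst q) (snd q). {g x}) ` (B \<times> lists B))"
  proof
    fix y assume "y \<in> g ` Z"
    then obtain x where x: "x \<in> Z" "y = g x" by blast
    show "y \<in> (\<Union>x\<in>flat. {g x}) \<union> \<Union>((\<lambda>q. \<Union>x\<in>jet (fst q) (snd q). {g x}) ` (B \<times> lists B))"
      using subsetD[OF cover x(1)] x(2) by blast
  qed
  ultimately show ?case unfolding Z_def by (rule negligible_subset)
qed

section \<open>Critical points of several components and measurability of their values\<close>

text \<open>Failure of surjectivity is expressed by a nonzero covector \<open>l\<close> that
  annihilates the derivatives along \<open>B\<close>. This form can be normalised to a compact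
  sphere, and it allows one component to be eliminated at a time.\<close>

definition crit_points ::
  "'a::euclidean_space set \<Rightarrow> 'b set \<Rightarrow> 'a set \<Rightarrow> ('b \<Rightarrow> 'a \<Rightarrow> real) \<Rightarrow> 'a \<Rightarrow> 'a set" where
  "crit_points B B' U f p = {x \<in> U. (\<forall>b\<in>Basis - B. x \<bullet> b = p \<bullet> b) \<and>
     (\<exists>l. (\<exists>b\<in>B'. l b \<noteq> 0) \<and> (\<forall>a\<in>B. (\<Sum>b\<in>B'. l b * pd a (f b) x) = 0))}"

text \<open>With \<open>l\<close> on the unit sphere, the pairs of a covector and a point satisfying
  the relations form a closed set. Projecting along a compact factor preserves closedness, and an
  open set is a countable union of compact sets.\<close>

lemma crit_points_Fsigma:
  fixes B :: "'a::euclidean_space set" and B' :: "'b::euclidean_space set"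
  assumes B: "B \<subseteq> Basis" and B': "B' \<subseteq> Basis" and U: "open U" and f: "\<And>b. b \<in> B' \<Longrightarrow> smooth_fun U (f b)"
  obtains K :: "nat \<Rightarrow> 'a set" where "\<And>n. compact (K n)" "(\<Union>n. K n) = crit_points B B' U f p"
proof -
  have finB: "finite B" and finB': "finite B'" using B B' finite_Basis finite_subset by blast+
  define S :: "'b set" where "S = sphere 0 1 \<inter> {l. \<forall>b\<in>Basis - B'. l \<bullet> b = 0}"
  have "{l::'b. \<forall>b\<in>Basis - B'. l \<bullet> b = 0} = (\<Inter>b\<in>Basis - B'. {l. l \<bullet> b = 0})" by blast
  then have "closed {l::'b. \<forall>b\<in>Basis - B'. l \<bullet> b = 0}"
    by (auto intro!: closed_Collect_eq continuous_intros)
  then have S: "compact S" unfolding S_def by (intro compact_Int_closed compact_sphere)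
  \<comment> \<open>A sum of squares encodes the finitely many relations as a single
    equation.\<close>
  define \<Phi> where "\<Phi> = (\<lambda>z::'b \<times> 'a. \<Sum>a\<in>B. (\<Sum>b\<in>B'. (fst z \<bullet> b) * pd a (f b) (snd z))\<^sup>2)"
  have cont: "continuous_on (S \<times> U) \<Phi>"
    unfolding \<Phi>_def
  proof (intro continuous_on_sum continuous_on_power continuous_on_mult continuous_on_inner
      continuous_on_fst continuous_on_const continuous_on_id)
    fix a b assume "a \<in> B" "b \<in> B'"
    then have "continuous_on U (pd a (f b))"
      using f U B by (intro smooth_fun_continuous smooth_fun_pd) auto
    then show "continuous_on (S \<times> U) (\<lambda>z. pd a (f b) (snd z))"
      by (rule continuous_on_compose2) (auto intro: continuous_on_snd)
  qed
  have "closedin (top_of_set (S \<times> U)) {z \<in> S \<times> U. \<Phi> z = 0}"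
    by (rule continuous_closedin_preimage_constant[OF cont])
  from closedin_compact_projection[OF S this]
  have "closedin (top_of_set U) {y. \<exists>x. x \<in> S \<and> (x, y) \<in> {z \<in> S \<times> U. \<Phi> z = 0}}" .
  then obtain C where C: "closed C" "{y. \<exists>x. x \<in> S \<and> (x, y) \<in> {z \<in> S \<times> U. \<Phi> z = 0}} = U \<inter> C"
    unfolding closedin_closed by auto
  define D where "D = {x::'a. \<forall>b\<in>Basis - B. x \<bullet> b = p \<bullet> b}"
  have "D = (\<Inter>b\<in>Basis - B. {x. x \<bullet> b = p \<bullet> b})" by (auto simp: D_def)
  then have D: "closed D"
    by (auto intro!: closed_Collect_eq continuous_intros)
  have \<Phi>0: "\<Phi> (l, x) = 0 \<longleftrightarrow> (\<forall>a\<in>B. (\<Sum>b\<in>B'. (l \<bullet> b) * pd a (f b) x) = 0)" for l x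
    unfolding \<Phi>_def using finB by (subst sum_nonneg_eq_0_iff) auto
  have eq: "crit_points B B' U f p = U \<inter> C \<inter> D"
  proof (intro equalityI subsetI)
    fix x assume "x \<in> crit_points B B' U f p"
    then obtain l where x: "x \<in> U" "x \<in> D" and l: "\<exists>b\<in>B'. l b \<noteq> 0" "\<forall>a\<in>B. (\<Sum>b\<in>B'. l b * pd a (f b) x) = 0"
      by (auto simp: crit_points_def D_def)
    define v where "v = (\<Sum>b\<in>B'. l b *\<^sub>R b)"
    have vb: "v \<bullet> b = (if b \<in> B' then l b else 0)" if "b \<in> Basis" for b
      unfolding v_def inner_sum_left using that B' finB'
      by (simp add: inner_Basis subset_eq if_distrib sum.delta' cong: sum.cong if_cong)
    obtain b0 where b0: "b0 \<in> B'" "l b0 \<noteq> 0" using l(1) by blast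
    then have "v \<noteq> 0" using vb[of b0] B' by auto
    define u where "u = v /\<^sub>R norm v"
    have "u \<in> S" using \<open>v \<noteq> 0\<close> vb by (auto simp: S_def u_def)
    moreover have "(\<Sum>b\<in>B'. (u \<bullet> b) * pd a (f b) x) = 0" if "a \<in> B" for a
    proof -
      have "(\<Sum>b\<in>B'. (u \<bullet> b) * pd a (f b) x) = (\<Sum>b\<in>B'. inverse (norm v) * (l b * pd a (f b) x))"
        by (rule sum.cong) (use vb B' in \<open>auto simp: u_def\<close>)
      also have "\<dots> = 0" using l(2) that by (simp flip: sum_distrib_left)
      finally show ?thesis .
    qed
    ultimately have "x \<in> U \<inter> C" using x(1) unfolding C(2)[symmetric] by (auto simp: \<Phi>0)
    then show "x \<in> U \<inter> C \<inter> D" using x(2) by blast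
  next
    fix x assume x: "x \<in> U \<inter> C \<inter> D"
    then have "x \<in> {y. \<exists>x. x \<in> S \<and> (x, y) \<in> {z \<in> S \<times> U. \<Phi> z = 0}}" unfolding C(2) by blast
    then obtain l where l: "l \<in> S" "\<Phi> (l, x) = 0" by auto
    have "\<exists>b\<in>B'. l \<bullet> b \<noteq> 0"
    proof (rule ccontr)
      assume "\<not> ?thesis"
      then have "\<forall>b\<in>Basis. l \<bullet> b = 0" using l(1) by (auto simp: S_def)
      then have "l = 0" by (simp add: euclidean_all_zero_iff)
      then show False using l(1) by (simp add: S_def)
    qed
    then show "x \<in> crit_points B B' U f p"
      using x l(2) unfolding \<Phi>0 by (auto simp: crit_points_def D_def intro!: exI[where x = "\<lambda>b. l \<bullet> b"])
  qed
  obtain L :: "nat \<Rightarrow> 'a set" where L: "\<And>n. compact (L n)" "\<And>n. L n \<subseteq> U" "(\<Union>n. L n) = U"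
    using open_Union_compact_subsets[OF U] by metis
  show ?thesis
  proof (rule that[of "\<lambda>n. L n \<inter> (C \<inter> D)"])
    show "compact (L n \<inter> (C \<inter> D))" for n using L(1) C(1) D by (intro compact_Int_closed closed_Int)
    show "(\<Union>n. L n \<inter> (C \<inter> D)) = crit_points B B' U f p" unfolding eq using L(3) by blast
  qed
qed

text \<open>Continuous images of compact sets are compact, and the cylinder over a compact set is
  its preimage under the continuous projection \<open>P\<close>. Fubini's theorem is applied to
  these sets.\<close>

lemma borel_crit_values:
  fixes B :: "'a::euclidean_space set" and B' :: "'b::euclidean_space set"
  assumes B: "B \<subseteq> Basis" and B': "B' \<subseteq> Basis" and U: "open U" and f: "\<And>b. b \<in> B' \<Longrightarrow> smooth_fun U (f b)"
  shows "(\<Union>x\<in>crit_points B B' U f p. {y::'b. \<forall>b\<in>B'. y \<bullet> b = f b x}) \<in> sets borel"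
proof -
  have finB': "finite B'" using B' finite_Basis finite_subset by blast
  obtain K :: "nat \<Rightarrow> 'a set" where K: "\<And>n. compact (K n)" "(\<Union>n. K n) = crit_points B B' U f p"
    by (rule crit_points_Fsigma[where f = f and p = p, OF B B' U f]) (assumption, rule that, assumption+)
  define F where "F = (\<lambda>x. \<Sum>b\<in>B'. f b x *\<^sub>R b)"
  define P where "P = (\<lambda>y::'b. \<Sum>b\<in>B'. (y \<bullet> b) *\<^sub>R b)"
  have coord: "(\<Sum>b\<in>B'. h b *\<^sub>R b) \<bullet> c = h c" if "c \<in> B'" for h c
    unfolding inner_sum_left using that B' finB'
    by (simp add: inner_Basis subset_eq if_distrib sum.delta cong: sum.cong if_cong)
  have iff: "(\<forall>b\<in>B'. y \<bullet> b = f b x) \<longleftrightarrow> P y = F x" for x y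
  proof
    assume eq: "P y = F x"
    show "\<forall>b\<in>B'. y \<bullet> b = f b x"
    proof
      fix b assume b: "b \<in> B'"
      have "P y \<bullet> b = F x \<bullet> b" using eq by simp
      then show "y \<bullet> b = f b x" unfolding P_def F_def coord[OF b] .
    qed
  qed (simp add: P_def F_def)
  have "closed (P -` (F ` K n))" for n
  proof (rule closed_vimage)
    have "K n \<subseteq> U" using K(2) by (auto simp: crit_points_def)
    then have "continuous_on (K n) F"
      unfolding F_def using smooth_fun_continuous[OF f]
      by (intro continuous_on_sum continuous_on_scaleR continuous_on_const) (auto intro: continuous_on_subset)
    then show "closed (F ` K n)" using K(1) by (intro compact_imp_closed compact_continuous_image)
    show "continuous_on UNIV P" unfolding P_def by (intro continuous_intros)
  qed
  then have "(\<Union>n. P -` (F ` K n)) \<in> sets borel" by (intro sets.countable_UN) auto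
  moreover have "(\<Union>x\<in>crit_points B B' U f p. {y. \<forall>b\<in>B'. y \<bullet> b = f b x}) = (\<Union>n. P -` (F ` K n))"
    unfolding K(2)[symmetric] iff by auto
  ultimately show ?thesis by simp
qed

text \<open>Where some partial derivative is nonzero, one coordinate is removed from source and
  target simultaneously, so the induction is on \<open>card B'\<close>. The value set constrains the
  coordinates in \<open>B'\<close> only, which lets the slices be cylinders of the same
  kind.\<close>

theorem sard:
  fixes B :: "'a::euclidean_space set" and B' :: "'b::euclidean_space set"
  assumes "B \<subseteq> Basis" "B' \<subseteq> Basis" "open U" "\<And>b. b \<in> B' \<Longrightarrow> smooth_fun U (f b)"
  shows "negligible (\<Union>x\<in>crit_points B B' U f p. {y::'b. \<forall>b\<in>B'. y \<bullet> b = f b x})"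
  using assms
proof (induction "card B'" arbitrary: B B' U f p rule: less_induct)
  case less
  note B = less.prems(1) and B' = less.prems(2) and U = less.prems(3) and f = less.prems(4)
  have finB: "finite B" and finB': "finite B'" using B B' finite_Basis finite_subset by blast+
  let ?Z = "crit_points B B' U f p"
  let ?T = "\<lambda>x. {y::'b. \<forall>b\<in>B'. y \<bullet> b = f b x}"
  define Z0 where "Z0 = {x \<in> ?Z. \<forall>a\<in>B. \<forall>b\<in>B'. pd a (f b) x = 0}"
  have neg0: "negligible (\<Union>x\<in>Z0. ?T x)"
  proof (cases "B' = {}")
    case True
    then show ?thesis by (simp add: Z0_def crit_points_def)
  next
    case False
    then obtain b where b: "b \<in> B'" by blast
    have "negligible (f b ` {x \<in> U. (\<forall>b\<in>Basis - B. x \<bullet> b = p \<bullet> b) \<and> (\<forall>a\<in>B. pd a (f b) x = 0)})"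
      by (rule scalar_sard[OF B U f[OF b]])
    then have "negligible (f b ` Z0)"
      by (rule negligible_subset) (use b in \<open>auto simp: Z0_def crit_points_def\<close>)
    from negligible_strip[OF this, of b] b B' have "negligible {y. y \<bullet> b \<in> f b ` Z0}" by blast
    then show ?thesis by (rule negligible_subset) (use b in auto)
  qed
  have neg1: "negligible (\<Union>x\<in>?Z - Z0. ?T x)"
  proof (rule negligible_UN_local)
    fix x0 assume x0: "x0 \<in> ?Z - Z0"
    then obtain a b1 where a: "a \<in> B" and b1: "b1 \<in> B'" and nz: "pd a (f b1) x0 \<noteq> 0"
      by (auto simp: Z0_def)
    have aB: "a \<in> Basis" and b1B: "b1 \<in> Basis" using a b1 B B' by blast+
    have x0U: "x0 \<in> U" using x0 by (simp add: crit_points_def)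
    obtain W V k c where W: "open W" "x0 \<in> W" "W \<subseteq> U" and V: "open V" "k ` V = W"
      and fk: "\<And>y. y \<in> V \<Longrightarrow> f b1 (k y) = y \<bullet> a"
      and kb: "\<And>y b. y \<in> V \<Longrightarrow> b \<in> Basis \<Longrightarrow> b \<noteq> a \<Longrightarrow> k y \<bullet> b = y \<bullet> b"
      and ks: "\<And>f. smooth_fun U f \<Longrightarrow> smooth_fun V (\<lambda>y. f (k y))"
      and kpd: "\<And>f y b. smooth_fun U f \<Longrightarrow> y \<in> V \<Longrightarrow> b \<in> Basis \<Longrightarrow>
         pd b (\<lambda>y. f (k y)) y = pd b f (k y) + c b y * pd a f (k y)"
      by (rule straighten[OF U f[OF b1] aB x0U nz]) (rule that; assumption)
    define F where "F = (\<lambda>b y. f b (k y))"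
    have F: "smooth_fun V (F b)" if "b \<in> B'" for b unfolding F_def by (rule ks[OF f[OF that]])
    let ?S = "\<lambda>y. {z::'b. \<forall>b\<in>B'. z \<bullet> b = F b y}"
    define A where "A = (\<Union>y\<in>crit_points B B' V F p. ?S y)"
    let ?B = "B - {a}" and ?B' = "B' - {b1}"
    have card: "card ?B' < card B'" using b1 finB' by (rule card_Diff1_less[rotated])
    have F1: "pd a' (F b1) y = (if a' = a then 1 else 0)" if "y \<in> V" "a' \<in> Basis" for a' y
    proof -
      have "(F b1 has_derivative (\<lambda>v. v \<bullet> a)) (at y)"
      proof (rule has_derivative_transform_within_open[OF _ V(1) that(1)])
        show "((\<lambda>y. y \<bullet> a) has_derivative (\<lambda>v. v \<bullet> a)) (at y)" by (auto intro!: derivative_eq_intros)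
      qed (simp add: F_def fk)
      then show ?thesis using aB that(2) by (simp add: pd_eq inner_Basis)
    qed
    have "A \<in> sets borel" unfolding A_def by (rule borel_crit_values[OF B B' V(1) F])
    then have "negligible A"
    proof (rule negligible_slices[OF _ b1B])
      fix t :: real
      \<comment> \<open>\<open>F b1\<close> is coordinate \<open>a\<close>, so the target slice at
        \<open>t\<close> involves exactly the source points with this coordinate equal to
        \<open>t\<close>.\<close>
      define p' where "p' = p + (t - p \<bullet> a) *\<^sub>R a"
      have p'a: "p' \<bullet> a = t" using aB by (simp add: p'_def inner_add_left)
      have p'b: "p' \<bullet> b = p \<bullet> b" if "b \<in> Basis" "b \<noteq> a" for b
        using aB that by (simp add: p'_def inner_add_left inner_not_same_Basis)
      have "negligible (\<Union>y\<in>crit_points ?B ?B' V F p'. {z::'b. \<forall>b\<in>?B'. z \<bullet> b = F b y})"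
        using B B' F by (intro less.hyps[OF card] V(1)) auto
      then show "negligible {z. z + (t - z \<bullet> b1) *\<^sub>R b1 \<in> A}"
      proof (rule negligible_subset, intro subsetI)
        fix z assume "z \<in> {z. z + (t - z \<bullet> b1) *\<^sub>R b1 \<in> A}"
        then obtain y where y: "y \<in> crit_points B B' V F p"
          and z: "\<forall>b\<in>B'. (z + (t - z \<bullet> b1) *\<^sub>R b1) \<bullet> b = F b y" by (auto simp: A_def)
        have yV: "y \<in> V" using y by (simp add: crit_points_def)
        have "y \<bullet> a = t" using z[rule_format, OF b1] b1B fk[OF yV] by (simp add: inner_add_left F_def)
        moreover obtain l where off: "\<forall>b\<in>Basis - B. y \<bullet> b = p \<bullet> b" and l: "\<exists>b\<in>B'. l b \<noteq> 0"
          and ls: "\<And>a'. a' \<in> B \<Longrightarrow> (\<Sum>b\<in>B'. l b * pd a' (F b) y) = 0"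
          using y unfolding crit_points_def by blast
        have split: "(\<Sum>b\<in>B'. l b * pd a' (F b) y) = l b1 * pd a' (F b1) y + (\<Sum>b\<in>?B'. l b * pd a' (F b) y)" for a'
          using finB' b1 by (rule sum.remove)
        \<comment> \<open>If only \<open>l b1\<close> were left, the relation in direction
          \<open>a\<close>, where \<open>F b1\<close> has derivative 1, would give
          \<open>l b1 = 0\<close>. In the other directions \<open>F b1\<close> has derivative 0, so
          the remaining components inherit the relation.\<close>
        have "\<exists>b\<in>?B'. l b \<noteq> 0"
        proof (rule ccontr)
          assume "\<not> ?thesis"
          then have z': "\<forall>b\<in>?B'. l b = 0" by blast
          then have "l b1 = 0" using ls[OF a] split[of a] F1[OF yV aB] by simp
          then show False using z' l by blast
        qed
        moreover have "(\<Sum>b\<in>?B'. l b * pd a' (F b) y) = 0" if "a' \<in> ?B" for a'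
          using ls[of a'] split[of a'] F1[OF yV, of a'] that B by auto
        moreover have "\<forall>b\<in>Basis - ?B. y \<bullet> b = p' \<bullet> b"
        proof
          fix b assume "b \<in> Basis - ?B"
          then show "y \<bullet> b = p' \<bullet> b"
            using off p'a p'b[of b] \<open>y \<bullet> a = t\<close> by (cases "b = a") auto
        qed
        ultimately have "y \<in> crit_points ?B ?B' V F p'" using yV unfolding crit_points_def by blast
        moreover have "z \<bullet> b = F b y" if "b \<in> ?B'" for b
        proof -
          have "b1 \<bullet> b = 0" using that b1B B' by (intro inner_not_same_Basis) auto
          then show ?thesis using z[rule_format, of b] that by (simp add: inner_add_left)
        qed
        ultimately show "z \<in> (\<Union>y\<in>crit_points ?B ?B' V F p'. {z. \<forall>b\<in>?B'. z \<bullet> b = F b y})" by blast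
      qed
    qed
    moreover have "(\<Union>x\<in>(?Z - Z0) \<inter> W. ?T x) \<subseteq> A"
    proof clarify
      fix x z assume x: "x \<in> ?Z" "x \<in> W" and z: "\<forall>b\<in>B'. z \<bullet> b = f b x"
      obtain y where y: "y \<in> V" "x = k y" using x(2) V(2) by blast
      obtain l where off: "\<forall>b\<in>Basis - B. x \<bullet> b = p \<bullet> b" and l: "\<exists>b\<in>B'. l b \<noteq> 0"
        and ls: "\<And>a'. a' \<in> B \<Longrightarrow> (\<Sum>b\<in>B'. l b * pd a' (f b) x) = 0"
        using x(1) unfolding crit_points_def by blast
      \<comment> \<open>The same covector works after the change of coordinates: the chain rule adds
        only a multiple of the relation in direction \<open>a\<close>.\<close>
      have "(\<Sum>b\<in>B'. l b * pd a' (F b) y) = 0" if "a' \<in> B" for a'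
      proof -
        have "(\<Sum>b\<in>B'. l b * pd a' (F b) y) = (\<Sum>b\<in>B'. l b * pd a' (f b) x + c a' y * (l b * pd a (f b) x))"
          using that B y(2) unfolding F_def
          by (intro sum.cong refl) (subst kpd[OF f y(1)], auto simp: algebra_simps)
        also have "\<dots> = 0" using ls[OF that] ls[OF a] by (simp add: sum.distrib flip: sum_distrib_left)
        finally show ?thesis .
      qed
      moreover have "\<forall>b\<in>Basis - B. y \<bullet> b = p \<bullet> b" using off kb[OF y(1)] y(2) a by fastforce
      ultimately have "y \<in> crit_points B B' V F p" using y(1) l unfolding crit_points_def by blast
      then show "z \<in> A" unfolding A_def using z y(2) by (auto simp: F_def)
    qed
    ultimately have "negligible (\<Union>x\<in>(?Z - Z0) \<inter> W. ?T x)" by (rule negligible_subset)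
    then show "\<exists>W. open W \<and> x0 \<in> W \<and> negligible (\<Union>x\<in>(?Z - Z0) \<inter> W. ?T x)" using W by blast
  qed
  have "(\<Union>x\<in>?Z. ?T x) \<subseteq> (\<Union>x\<in>Z0. ?T x) \<union> (\<Union>x\<in>?Z - Z0. ?T x)" by blast
  then show ?case using negligible_Un[OF neg0 neg1] negligible_subset by blast
qed

section \<open>Coordinate subspaces and cylinders\<close>

definition coord_proj :: "'a::euclidean_space set \<Rightarrow> 'a \<Rightarrow> 'a" where
  "coord_proj B x = (\<Sum>b\<in>B. (x \<bullet> b) *\<^sub>R b)"

lemma bounded_linear_coord_proj: "bounded_linear (coord_proj B)"
  unfolding coord_proj_def
  by (intro bounded_linear_sum bounded_linear_scaleR_const bounded_linear_inner_left)

lemmas linear_coord_proj = bounded_linear.linear[OF bounded_linear_coord_proj]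

lemma coord_proj_in_span: "coord_proj B x \<in> span B"
  unfolding coord_proj_def by (intro span_sum span_scale span_base)

lemma coord_proj_inner:
  assumes "B \<subseteq> Basis" "b \<in> Basis"
  shows "coord_proj B x \<bullet> b = (if b \<in> B then x \<bullet> b else 0)"
proof -
  have "finite B" using assms(1) finite_Basis finite_subset by blast
  moreover have "coord_proj B x \<bullet> b = (\<Sum>c\<in>B. (x \<bullet> c) * (if c = b then 1 else 0))"
    unfolding coord_proj_def inner_sum_left using assms
    by (intro sum.cong) (auto simp: inner_Basis)
  ultimately show ?thesis by (simp add: if_distrib cong: if_cong)
qed

lemma coord_proj_span:
  assumes "B \<subseteq> Basis" "x \<in> span B"
  shows "coord_proj B x = x"
proof (rule euclidean_eqI)
  fix b :: 'a assume b: "b \<in> Basis"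
  have "b \<notin> B \<Longrightarrow> x \<bullet> b = 0" using assms b by (simp add: span_substd_basis)
  then show "coord_proj B x \<bullet> b = x \<bullet> b" using coord_proj_inner[OF assms(1) b, of x] by auto
qed

lemma coord_proj_eq_iff:
  assumes "B \<subseteq> Basis"
  shows "coord_proj B x = coord_proj B y \<longleftrightarrow> (\<forall>b\<in>B. x \<bullet> b = y \<bullet> b)"
proof
  assume "coord_proj B x = coord_proj B y"
  then show "\<forall>b\<in>B. x \<bullet> b = y \<bullet> b" using coord_proj_inner[OF assms] assms by (metis subsetD)
qed (simp add: coord_proj_def)

lemma open_coord_proj_vimage:
  assumes "openin (top_of_set (span B)) D"
  shows "open (coord_proj B -` D)"
proof -
  obtain T where T: "open T" "D = span B \<inter> T" using assms by (auto simp: openin_open)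
  have "coord_proj B -` D = coord_proj B -` T" using T(2) coord_proj_in_span by blast
  then show ?thesis
    using T(1) by (simp add: open_vimage linear_continuous_on[OF bounded_linear_coord_proj])
qed

section \<open>Derivatives within open subsets of \<open>span B\<close>\<close>

lemma has_derivative_chain_within:
  assumes "(f has_derivative f') (at x within S)" "(g has_derivative g') (at (f x) within T)" "f ` S \<subseteq> T"
  shows "((\<lambda>x. g (f x)) has_derivative (\<lambda>v. g' (f' v))) (at x within S)"
  using has_derivative_in_compose[OF assms(1) has_derivative_subset[OF assms(2,3)]] .

lemma has_derivative_coord_proj:
  assumes "openin (top_of_set (span B)) D" "(f has_derivative f') (at (coord_proj B x) within D)"
    "coord_proj B x \<in> D"
  shows "((\<lambda>x. f (coord_proj B x)) has_derivative (\<lambda>v. f' (coord_proj B v))) (at x)"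
proof -
  have "((\<lambda>x. f (coord_proj B x)) has_derivative (\<lambda>v. f' (coord_proj B v))) (at x within coord_proj B -` D)"
    by (rule has_derivative_chain_within[OF bounded_linear_imp_has_derivative[OF bounded_linear_coord_proj] assms(2)])
      auto
  then show ?thesis
    using at_within_open[OF _ open_coord_proj_vimage[OF assms(1)]] assms(3) by simp
qed

text \<open>The coordinates of \<open>f\<close> outside \<open>B'\<close> vanish on
  \<open>D\<close>. Composed with the projection they vanish on an open set, where uniqueness of
  derivatives applies.\<close>

lemma derivative_into_span:
  assumes B: "B \<subseteq> Basis" and B': "B' \<subseteq> Basis" and D: "openin (top_of_set (span B)) D" and u: "u \<in> D"
    and f: "f ` D \<subseteq> span B'" and d: "(f has_derivative f') (at u within D)"
  shows "f' ` span B \<subseteq> span B'"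
proof
  fix w assume "w \<in> f' ` span B"
  then obtain v where v: "v \<in> span B" "w = f' v" by blast
  have uB: "u \<in> span B" using D u openin_imp_subset by blast
  have pu: "coord_proj B u = u" by (rule coord_proj_span[OF B uB])
  have F: "((\<lambda>x. f (coord_proj B x)) has_derivative (\<lambda>v. f' (coord_proj B v))) (at u)"
    by (rule has_derivative_coord_proj[OF D]) (use d u pu in auto)
  have "f' v \<bullet> b = 0" if b: "b \<in> Basis - B'" for b
  proof -
    have 1: "((\<lambda>x. f (coord_proj B x) \<bullet> b) has_derivative (\<lambda>v. f' (coord_proj B v) \<bullet> b)) (at u)"
      using F by (auto intro!: derivative_eq_intros)
    have 2: "((\<lambda>x. f (coord_proj B x) \<bullet> b) has_derivative (\<lambda>v. 0)) (at u)"
    proof (rule has_derivative_transform_within_open[OF _ open_coord_proj_vimage[OF D]])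
      show "0 = f (coord_proj B x) \<bullet> b" if "x \<in> coord_proj B -` D" for x
        using that f b B' by (auto simp: span_substd_basis)
    qed (use u pu in auto)
    have "(\<lambda>v. f' (coord_proj B v) \<bullet> b) = (\<lambda>v. 0)" using has_derivative_unique[OF 1 2] .
    then show ?thesis using coord_proj_span[OF B v(1)] by metis
  qed
  then show "w \<in> span B'" using v B' by (auto simp: span_substd_basis)
qed

text \<open>If \<open>span B\<close> is a proper subspace, a derivative within \<open>D\<close> is
  arbitrary in transversal directions; this is the uniqueness that remains.\<close>

lemma derivative_unique_span:
  assumes B: "B \<subseteq> Basis" and D: "openin (top_of_set (span B)) D" and u: "u \<in> D"
    and d: "(f has_derivative f1) (at u within D)" "(f has_derivative f2) (at u within D)" and v: "v \<in> span B"
  shows "f1 v = f2 v"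
proof -
  have pu: "coord_proj B u = u" by (rule coord_proj_span[OF B]) (use D u openin_imp_subset in blast)
  have "((\<lambda>x. f (coord_proj B x)) has_derivative (\<lambda>v. f1 (coord_proj B v))) (at u)"
    "((\<lambda>x. f (coord_proj B x)) has_derivative (\<lambda>v. f2 (coord_proj B v))) (at u)"
    by (rule has_derivative_coord_proj[OF D]; use d u pu in simp)+
  then have "(\<lambda>v. f1 (coord_proj B v)) = (\<lambda>v. f2 (coord_proj B v))" by (rule has_derivative_unique)
  then show ?thesis using coord_proj_span[OF B v] by metis
qed

section \<open>Cylinders and null sets of coordinate subspaces\<close>

definition cylinder :: "'b::euclidean_space set \<Rightarrow> 'b set \<Rightarrow> 'b set" where
  "cylinder B N = {y. coord_proj B y \<in> N}"

lemma cylinder_mono: "M \<subseteq> N \<Longrightarrow> cylinder B M \<subseteq> cylinder B N"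
  by (auto simp: cylinder_def)

lemma not_negligible_cylinder:
  assumes B: "B \<subseteq> Basis" and D: "openin (top_of_set (span B)) D" and u: "u \<in> D"
  shows "\<not> negligible (cylinder B D)"
proof (rule open_not_negligible)
  show "open (cylinder B D)" using open_coord_proj_vimage[OF D] by (simp add: cylinder_def vimage_def)
  have "coord_proj B u = u" by (rule coord_proj_span[OF B]) (use D u openin_imp_subset in blast)
  then have "u \<in> cylinder B D" using u by (simp add: cylinder_def)
  then show "cylinder B D \<noteq> {}" by blast
qed

text \<open>Product measure splits into the coordinates in \<open>B\<close> and the rest. Almost
  every slice of a null set containing the cylinder is null, and each slice contains the coordinate
  vectors of \<open>N\<close>, so one null slice suffices.\<close>

lemma lebesgue_null_if_cylinder:
  fixes B :: "'b::euclidean_space set"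
  assumes B: "B \<subseteq> Basis" and N: "N \<subseteq> span B" and neg: "negligible (cylinder B N)"
  shows "lebesgue_null B N"
proof -
  define I where "I = Basis - B"
  define P where "P = (\<lambda>J::'b set. \<Pi>\<^sub>M b\<in>J. (lborel :: real measure))"
  define c where "c = (\<lambda>x::'b. \<lambda>b\<in>B. x \<bullet> b)"
  define d where "d = (\<lambda>f. (\<Sum>b\<in>Basis. f b *\<^sub>R (b::'b)))"
  have fin: "finite B" "finite I" using finite_subset[OF B finite_Basis] by (auto simp: I_def)
  have BI: "B \<inter> I = {}" "B \<union> I = Basis" using B by (auto simp: I_def)
  interpret product_sigma_finite "\<lambda>_::'b. lborel :: real measure" ..
  interpret PB: sigma_finite_measure "P B" unfolding P_def by (rule sigma_finite[OF fin(1)])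
  interpret PI: sigma_finite_measure "P I" unfolding P_def by (rule sigma_finite[OF fin(2)])
  interpret pair_sigma_finite "P B" "P I" ..
  obtain A where A: "A \<in> null_sets lborel" "cylinder B N \<subseteq> A"
    using neg unfolding negligible_iff_null_sets null_sets_completion_iff2 by blast
  have bA: "A \<in> sets borel" using null_setsD2[OF A(1)] by simp
  have mm: "merge B I \<in> measurable (P B \<Otimes>\<^sub>M P I) (P Basis)"
    unfolding P_def BI(2)[symmetric] by (rule measurable_merge)
  have dm: "d \<in> measurable (P Basis) borel"
    unfolding d_def P_def by (intro borel_measurable_sum borel_measurable_scaleR borel_measurable_const)
      (rule measurable_component_singleton[where M = "\<lambda>_. lborel", simplified])
  define F where "F = (\<lambda>z. d (merge B I z))"
  have Fm: "F \<in> measurable (P B \<Otimes>\<^sub>M P I) borel"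
    unfolding F_def using measurable_compose[OF mm dm] .
  have "lborel = distr (P Basis) borel d" unfolding P_def d_def by (rule lborel_eq)
  also have "P Basis = distr (P B \<Otimes>\<^sub>M P I) (P Basis) (merge B I)"
    unfolding P_def BI(2)[symmetric] by (rule distr_merge[OF BI(1) fin, symmetric])
  also have "distr \<dots> borel d = distr (P B \<Otimes>\<^sub>M P I) borel F"
    unfolding F_def using distr_distr[OF dm mm] by (simp add: comp_def)
  finally have lb: "lborel = distr (P B \<Otimes>\<^sub>M P I) borel F" .
  have "emeasure (P B \<Otimes>\<^sub>M P I) (F -` A \<inter> space (P B \<Otimes>\<^sub>M P I)) = 0"
    using null_setsD1[OF A(1)] emeasure_distr[OF Fm bA] unfolding lb by simp
  moreover have S: "F -` A \<inter> space (P B \<Otimes>\<^sub>M P I) \<in> sets (P B \<Otimes>\<^sub>M P I)"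
    using Fm bA by (rule measurable_sets)
  ultimately have "(\<integral>\<^sup>+y. emeasure (P B) ((\<lambda>x. (x, y)) -` (F -` A \<inter> space (P B \<Otimes>\<^sub>M P I))) \<partial>P I) = 0"
    using emeasure_pair_measure_alt2[OF S] by simp
  then have ae: "AE y in P I. emeasure (P B) ((\<lambda>x. (x, y)) -` (F -` A \<inter> space (P B \<Otimes>\<^sub>M P I))) = 0"
    by (subst (asm) nn_integral_0_iff_AE) (use measurable_emeasure_Pair2[OF S] in auto)
  \<comment> \<open>The complementary factor has nonzero total measure, equal to 1 if
    \<open>I\<close> is empty; hence a property that holds almost everywhere holds
    somewhere.\<close>
  have nF: "\<not> (AE y in P I. False)"
  proof -
    have "emeasure (P I) (space (P I)) = (\<Prod>b\<in>I. emeasure lborel (UNIV::real set))"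
      unfolding P_def space_PiM using emeasure_PiM[OF fin(2), of "\<lambda>_. UNIV"] by simp
    then have "emeasure (P I) (space (P I)) \<noteq> 0" by (simp add: prod_zero_iff fin emeasure_lborel_UNIV)
    then show ?thesis by (subst AE_iff_measurable[of "space (P I)"]) auto
  qed
  have "\<exists>y\<in>space (P I). emeasure (P B) ((\<lambda>x. (x, y)) -` (F -` A \<inter> space (P B \<Otimes>\<^sub>M P I))) = 0"
    (is "\<exists>y\<in>_. ?Q y")
  proof (rule ccontr)
    assume "\<not> ?thesis"
    then have "AE y in P I. ?Q y \<longrightarrow> False" by (intro AE_I2) blast
    with ae have "AE y in P I. False" by (rule AE_mp)
    with nF show False by blast
  qed
  then obtain y where y: "y \<in> space (P I)"
    and y0: "emeasure (P B) ((\<lambda>x. (x, y)) -` (F -` A \<inter> space (P B \<Otimes>\<^sub>M P I))) = 0" by blast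
  let ?S = "(\<lambda>x. (x, y)) -` (F -` A \<inter> space (P B \<Otimes>\<^sub>M P I))"
  have "?S \<in> null_sets (P B)" using y0 sets_Pair2[OF S] by (intro null_setsI) auto
  moreover have "c ` N \<subseteq> ?S"
  proof (rule image_subsetI)
    fix x assume x: "x \<in> N"
    have xs: "c x \<in> space (P B)" by (auto simp: c_def P_def space_PiM)
    have db: "d (merge B I (c x, y)) \<bullet> b = x \<bullet> b" if b: "b \<in> B" for b
    proof -
      have "b \<in> Basis" using b B by blast
      then have "d (merge B I (c x, y)) \<bullet> b = merge B I (c x, y) b"
        by (simp add: d_def)
      then show ?thesis using b by (simp add: merge_def c_def)
    qed
    have "coord_proj B (F (c x, y)) = coord_proj B x"
      unfolding coord_proj_eq_iff[OF B] F_def using db by blast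
    also have "\<dots> = x" using N x by (intro coord_proj_span[OF B]) auto
    finally have "F (c x, y) \<in> A" using A(2) x by (auto simp: cylinder_def)
    then show "c x \<in> ?S"
      using xs y by (simp add: space_pair_measure)
  qed
  ultimately show ?thesis
    unfolding lebesgue_null_def null_sets_completion_iff2 P_def c_def by blast
qed

section \<open>Sard's theorem on coordinate subspaces\<close>

lemma smooth_on_differentiable: "smooth_on E D f \<Longrightarrow> x \<in> D \<Longrightarrow> f differentiable (at x within D)"
  using Ck_on.simps(2)[of 0 E D f] unfolding smooth_on_def by blast

lemma smooth_on_derivative:
  "smooth_on E D f \<Longrightarrow> v \<in> E \<Longrightarrow> smooth_on E D (\<lambda>x. frechet_derivative f (at x within D) v)"
  unfolding smooth_on_def by (metis Ck_on.simps(2))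

text \<open>The derivative of the composite in direction \<open>v\<close> is the derivative of
  \<open>f\<close> in the direction of the projected \<open>v\<close>, composed with the projection.
  So the components of such composites are closed under partial derivatives.\<close>

lemma smooth_fun_coord_proj:
  fixes B :: "'a::euclidean_space set" and f :: "'a \<Rightarrow> 'b::euclidean_space"
  assumes D: "openin (top_of_set (span B)) D" and f: "smooth_on (span B) D f"
  shows "smooth_fun (coord_proj B -` D) (\<lambda>x. f (coord_proj B x) \<bullet> b)"
proof (rule smooth_fun_coinduct[where X = "\<lambda>F. \<exists>f::'a \<Rightarrow> 'b. smooth_on (span B) D f \<and> F = (\<lambda>x. f (coord_proj B x) \<bullet> b)"])
  show "\<exists>g. smooth_on (span B) D g \<and> (\<lambda>x. f (coord_proj B x) \<bullet> b) = (\<lambda>x. g (coord_proj B x) \<bullet> b)"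
    using f by blast
  fix F assume "\<exists>f::'a \<Rightarrow> 'b. smooth_on (span B) D f \<and> F = (\<lambda>x. f (coord_proj B x) \<bullet> b)"
  then obtain f :: "'a \<Rightarrow> 'b" where f: "smooth_on (span B) D f" and F: "F = (\<lambda>x. f (coord_proj B x) \<bullet> b)" by blast
  define F' where "F' = (\<lambda>x v. frechet_derivative f (at (coord_proj B x) within D) (coord_proj B v) \<bullet> b)"
  have "(F has_derivative F' x) (at x)" if "x \<in> coord_proj B -` D" for x
  proof -
    have "(f has_derivative frechet_derivative f (at (coord_proj B x) within D)) (at (coord_proj B x) within D)"
      using smooth_on_differentiable[OF f] that frechet_derivative_works by blast
    from has_derivative_coord_proj[OF D this] that show ?thesis
      unfolding F F'_def by (auto intro!: derivative_eq_intros)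
  qed
  moreover have "\<exists>g::'a \<Rightarrow> 'b. smooth_on (span B) D g \<and> (\<lambda>x. F' x v) = (\<lambda>x. g (coord_proj B x) \<bullet> b)" for v
    unfolding F'_def
    by (rule exI[where x = "\<lambda>x. frechet_derivative f (at x within D) (coord_proj B v)"])
      (simp add: smooth_on_derivative[OF f coord_proj_in_span])
  ultimately show "\<exists>f'. (\<forall>x\<in>coord_proj B -` D. (F has_derivative f' x) (at x)) \<and>
      (\<forall>v\<in>Basis. \<exists>g::'a \<Rightarrow> 'b. smooth_on (span B) D g \<and> (\<lambda>x. f' x v) = (\<lambda>x. g (coord_proj B x) \<bullet> b))"
    by blast
qed

text \<open>If the derivative is not onto, its image has a nonzero orthogonal vector in
  \<open>span B'\<close>, whose coordinates are the required covector. The base point is 0, since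
  points of \<open>span B\<close> have no other coordinates.\<close>

theorem sard_span:
  fixes B :: "'a::euclidean_space set" and B' :: "'b::euclidean_space set"
  assumes B: "B \<subseteq> Basis" and B': "B' \<subseteq> Basis" and D: "openin (top_of_set (span B)) D"
    and f: "smooth_on (span B) D f" and fD: "f ` D \<subseteq> span B'"
  shows "negligible (cylinder B' (f ` {u \<in> D. frechet_derivative f (at u within D) ` span B \<noteq> span B'}))"
proof -
  define U where "U = coord_proj B -` D"
  define F where "F = (\<lambda>b x. f (coord_proj B x) \<bullet> b)"
  have "negligible (\<Union>x\<in>crit_points B B' U F 0. {y. \<forall>b\<in>B'. y \<bullet> b = F b x})"
    unfolding U_def F_def using open_coord_proj_vimage[OF D] smooth_fun_coord_proj[OF D f]
    by (intro sard B B') auto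
  moreover have "cylinder B' (f ` {u \<in> D. frechet_derivative f (at u within D) ` span B \<noteq> span B'}) \<subseteq>
    (\<Union>x\<in>crit_points B B' U F 0. {y. \<forall>b\<in>B'. y \<bullet> b = F b x})"
  proof
    fix y assume "y \<in> cylinder B' (f ` {u \<in> D. frechet_derivative f (at u within D) ` span B \<noteq> span B'})"
    then obtain u where u: "u \<in> D" "coord_proj B' y = f u"
      and ne: "frechet_derivative f (at u within D) ` span B \<noteq> span B'" by (auto simp: cylinder_def)
    let ?f' = "frechet_derivative f (at u within D)"
    have uB: "u \<in> span B" using D u(1) openin_imp_subset by blast
    have pu: "coord_proj B u = u" by (rule coord_proj_span[OF B uB])
    have der: "(f has_derivative ?f') (at u within D)"
      using smooth_on_differentiable[OF f u(1)] frechet_derivative_works by blast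
    have lin: "linear ?f'" by (rule has_derivative_linear[OF der])
    have sub: "?f' ` span B \<subseteq> span B'" by (rule derivative_into_span[OF B B' D u(1) fD der])
    have "span (?f' ` span B) = ?f' ` span B"
      by (simp add: linear_subspace_image[OF lin] span_eq_iff)
    then have "span (?f' ` span B) \<subset> span B'" using sub ne by blast
    then obtain l where l: "l \<noteq> 0" "l \<in> span B'" "\<And>y. y \<in> span (?f' ` span B) \<Longrightarrow> orthogonal l y"
      by (rule orthogonal_to_subspace_exists_gen) (rule that; assumption)
    have FD: "(F b has_derivative (\<lambda>v. ?f' (coord_proj B v) \<bullet> b)) (at u)" for b
      unfolding F_def using has_derivative_coord_proj[OF D, of f ?f' u] der pu u(1)
      by (auto intro!: derivative_eq_intros)
    have sumB': "(\<Sum>b\<in>B'. (l \<bullet> b) * (w \<bullet> b)) = l \<bullet> w" for w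
    proof -
      have "(\<Sum>b\<in>B'. (l \<bullet> b) * (w \<bullet> b)) = (\<Sum>b\<in>Basis. (l \<bullet> b) * (w \<bullet> b))"
        using l(2) B' by (intro sum.mono_neutral_left) (auto simp: span_substd_basis)
      then show ?thesis by (simp add: euclidean_inner[of l w])
    qed
    have "(\<Sum>b\<in>B'. (l \<bullet> b) * pd a (F b) u) = 0" if "a \<in> B" for a
    proof -
      have "(\<Sum>b\<in>B'. (l \<bullet> b) * pd a (F b) u) = l \<bullet> ?f' a"
        using that by (simp add: pd_eq[OF FD] sumB' coord_proj_span[OF B] span_base)
      also have "\<dots> = 0" using l(3)[of "?f' a"] that by (simp add: orthogonal_def span_base)
      finally show ?thesis .
    qed
    moreover have "\<exists>b\<in>B'. l \<bullet> b \<noteq> 0"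
    proof (rule ccontr)
      assume "\<not> ?thesis"
      then have "\<forall>b\<in>Basis. l \<bullet> b = 0" using l(2) B' by (auto simp: span_substd_basis)
      then show False using l(1) by (simp add: euclidean_all_zero_iff)
    qed
    moreover have "\<forall>b\<in>Basis - B. u \<bullet> b = 0 \<bullet> b" using uB B by (auto simp: span_substd_basis)
    ultimately have "u \<in> crit_points B B' U F 0"
      using u(1) pu unfolding crit_points_def U_def by (auto intro!: exI[where x = "\<lambda>b. l \<bullet> b"])
    moreover have "y \<bullet> b = F b u" if "b \<in> B'" for b
      using coord_proj_inner[OF B', of b y] that B' u(2) pu by (auto simp: F_def)
    ultimately show "y \<in> (\<Union>x\<in>crit_points B B' U F 0. {y. \<forall>b\<in>B'. y \<bullet> b = F b x})" by blast
  qed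
  ultimately show ?thesis by (rule negligible_subset)
qed

section \<open>Derivatives of maps related by finitely many diffeomorphisms\<close>

text \<open>If \<open>x\<close> avoids \<open>S g\<close> and \<open>y\<close> lies in it, all
  \<open>x + n y\<close> avoid \<open>S g\<close>. Two of them share one of the remaining subspaces,
  which then contains a nonzero multiple of \<open>y\<close>. So \<open>S g\<close> can be
  discarded.\<close>

lemma subspace_covered_by_finite_subspaces:
  assumes "finite G" "\<And>g. g \<in> G \<Longrightarrow> subspace (S g)" "subspace E" "E \<subseteq> (\<Union>g\<in>G. S g)"
  shows "\<exists>g\<in>G. E \<subseteq> S g"
  using assms
proof (induction G)
  case empty
  then show ?case using subspace_0 by blast
next
  case (insert g G)
  show ?case
  proof (cases "E \<subseteq> S g")
    case False
    then obtain x where x: "x \<in> E" "x \<notin> S g" by blast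
    have "E \<subseteq> (\<Union>h\<in>G. S h)"
    proof
      fix y assume y: "y \<in> E"
      show "y \<in> (\<Union>h\<in>G. S h)"
      proof (cases "y \<in> S g")
        case False
        then show ?thesis using y insert.prems by blast
      next
        case True
        have "\<exists>h\<in>G. x + real n *\<^sub>R y \<in> S h" for n
        proof -
          have "x + real n *\<^sub>R y \<in> E" using x(1) y insert.prems(2) by (simp add: subspace_add subspace_scale)
          moreover have "x + real n *\<^sub>R y \<notin> S g"
            using x(2) True insert.prems(1) subspace_scale subspace_diff[of "S g" "x + real n *\<^sub>R y" "real n *\<^sub>R y"]
            by force
          ultimately show ?thesis using insert.prems(3) by blast
        qed
        then obtain h where h: "\<And>n. h n \<in> G \<and> x + real n *\<^sub>R y \<in> S (h n)" by metis
        have "\<not> inj h"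
          using h insert.hyps(1) by (meson finite_imageD finite_subset image_subsetI infinite_UNIV_nat)
        then obtain m n where mn: "m \<noteq> n" "h m = h n" by (auto simp: inj_def)
        have sub: "subspace (S (h m))" using h insert.prems(1) by blast
        have "(x + real m *\<^sub>R y) - (x + real n *\<^sub>R y) \<in> S (h m)"
          using h[of m] h[of n] mn(2) by (intro subspace_diff[OF sub]) auto
        then have "(real m - real n) *\<^sub>R y \<in> S (h m)" by (simp add: algebra_simps)
        from subspace_scale[OF sub this, of "inverse (real m - real n)"]
        have "y \<in> S (h m)" using mn(1) by simp
        then show ?thesis using h by blast
      qed
    qed
    then show ?thesis using insert.IH insert.prems by blast
  qed blast
qed

text \<open>Meant for the difference of two curves: with different velocities they cannot agree at
  nonzero parameters near 0.\<close>

lemma eventually_nonzero_if_derivative: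
  fixes h :: "real \<Rightarrow> 'b::real_normed_vector"
  assumes "(h has_derivative (\<lambda>s. s *\<^sub>R d)) (at 0)" "d \<noteq> 0"
  shows "\<forall>\<^sub>F t in at 0. h t \<noteq> 0"
proof (cases "h 0 = 0")
  case False
  have "(h \<longlongrightarrow> h 0) (at 0)" using has_derivative_continuous[OF assms(1)] by (simp add: continuous_at)
  then show ?thesis using False by (rule tendsto_imp_eventually_ne)
next
  case True
  obtain \<delta> where \<delta>: "\<delta> > 0" "\<And>y. norm (y - 0) < \<delta> \<Longrightarrow> norm (h y - h 0 - (y - 0) *\<^sub>R d) \<le> norm d / 2 * norm (y - 0)"
    using assms unfolding has_derivative_at_alt by (meson half_gt_zero zero_less_norm_iff)
  have "h t \<noteq> 0" if "t \<noteq> 0" "\<bar>t\<bar> < \<delta>" for t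
  proof
    assume "h t = 0"
    then have "\<bar>t\<bar> * norm d \<le> norm d / 2 * \<bar>t\<bar>" using \<delta>(2)[of t] that(2) True by simp
    then show False using that(1) assms(2) by (simp add: field_simps)
  qed
  then show ?thesis unfolding eventually_at using \<delta>(1) by (intro exI[where x = \<delta>]) auto
qed

text \<open>Along each direction, some \<open>\<tau> g\<close> relates \<open>\<alpha>\<close> and \<open>\<alpha>'\<close> at points arbitrarily close to \<open>u\<close>, so the
  derivatives satisfy the same relation in this direction. The directions belonging to a fixed \<open>g\<close>
  form a subspace, hence one \<open>g\<close> serves for all of them.\<close>

lemma derivative_onto_transfer:
  fixes B :: "'a::euclidean_space set" and B' :: "'b::euclidean_space set"
    and \<tau> :: "'g \<Rightarrow> 'b \<Rightarrow> 'b"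
  assumes B: "B \<subseteq> Basis" and D: "openin (top_of_set (span B)) D" and u: "u \<in> D"
    and A: "(\<alpha> has_derivative A) (at u within D)" "A ` span B = span B'"
    and A': "(\<alpha>' has_derivative A') (at u within D)" "A' ` span B \<subseteq> span B'"
    and G: "finite G" and eq: "\<And>w. w \<in> D \<Longrightarrow> \<exists>g\<in>G. \<alpha> w = \<tau> g (\<alpha>' w)"
    and \<tau>: "\<And>g. g \<in> G \<Longrightarrow> \<tau> g differentiable (at (\<alpha>' u) within R)" and R: "\<alpha>' ` D \<subseteq> R"
  shows "A' ` span B = span B'"
proof -
  obtain T where T: "\<And>g. g \<in> G \<Longrightarrow> (\<tau> g has_derivative T g) (at (\<alpha>' u) within R)"
    using \<tau> unfolding differentiable_def by metis
  have lin: "linear A" "linear A'" "\<And>g. g \<in> G \<Longrightarrow> linear (T g)"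
    using A(1) A'(1) T has_derivative_linear by blast+
  have dir: "\<exists>g\<in>G. A v = T g (A' v)" if v: "v \<in> span B" for v
  proof (rule ccontr)
    assume no: "\<not> ?thesis"
    define \<gamma> where "\<gamma> = (\<lambda>t::real. u + t *\<^sub>R v)"
    obtain V where V: "open V" "D = span B \<inter> V" using D by (auto simp: openin_open)
    define S where "S = \<gamma> -` V"
    have "continuous_on UNIV \<gamma>" unfolding \<gamma>_def by (intro continuous_intros)
    then have S: "open S" unfolding S_def using V(1) by (intro open_vimage)
    have S0: "0 \<in> S" using u V(2) by (simp add: S_def \<gamma>_def)
    have \<gamma>D: "\<gamma> ` S \<subseteq> D"
      using u v V(2) by (auto simp: S_def \<gamma>_def intro: span_add span_scale)
    have \<gamma>d: "(\<gamma> has_derivative (\<lambda>s. s *\<^sub>R v)) (at 0 within S)"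
      unfolding \<gamma>_def by (auto intro!: derivative_eq_intros)
    have \<gamma>0: "\<gamma> 0 = u" by (simp add: \<gamma>_def)
    have \<alpha>d: "((\<lambda>t. \<alpha> (\<gamma> t)) has_derivative (\<lambda>s. A (s *\<^sub>R v))) (at 0 within S)"
      using has_derivative_chain_within[OF \<gamma>d _ \<gamma>D] A(1) \<gamma>0 by metis
    have \<alpha>'d: "((\<lambda>t. \<alpha>' (\<gamma> t)) has_derivative (\<lambda>s. A' (s *\<^sub>R v))) (at 0 within S)"
      using has_derivative_chain_within[OF \<gamma>d _ \<gamma>D] A'(1) \<gamma>0 by metis
    have "\<forall>\<^sub>F t in at 0. \<alpha> (\<gamma> t) - \<tau> g (\<alpha>' (\<gamma> t)) \<noteq> 0" if g: "g \<in> G" for g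
    proof (rule eventually_nonzero_if_derivative)
      have "((\<lambda>t. \<tau> g (\<alpha>' (\<gamma> t))) has_derivative (\<lambda>s. T g (A' (s *\<^sub>R v)))) (at 0 within S)"
        by (rule has_derivative_chain_within[OF \<alpha>'d, where T = R]) (use T[OF g] \<gamma>0 \<gamma>D R in auto)
      from has_derivative_diff[OF \<alpha>d this]
      show "((\<lambda>t. \<alpha> (\<gamma> t) - \<tau> g (\<alpha>' (\<gamma> t))) has_derivative (\<lambda>s. s *\<^sub>R (A v - T g (A' v)))) (at 0)"
        using lin(1,2) lin(3)[OF g] at_within_open[OF S0 S]
        by (simp add: linear_cmul scaleR_diff_right)
      show "A v - T g (A' v) \<noteq> 0" using no g by simp
    qed
    \<comment> \<open>Finiteness of \<open>G\<close> is essential: finitely many punctured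
      neighbourhoods have a common one, on which no \<open>g\<close> relates the two curves.\<close>
    then have "\<forall>\<^sub>F t in at 0. \<forall>g\<in>G. \<alpha> (\<gamma> t) - \<tau> g (\<alpha>' (\<gamma> t)) \<noteq> 0"
      using G by (simp add: eventually_ball_finite)
    moreover have "\<forall>\<^sub>F t in at 0. t \<in> S" using S S0 by (rule eventually_at_in_open')
    ultimately have "\<forall>\<^sub>F t in at (0::real). False"
    proof eventually_elim
      case (elim t)
      then show ?case using eq[of "\<gamma> t"] \<gamma>D by auto
    qed
    then show False by (simp add: eventually_False)
  qed
  define S where "S = (\<lambda>g. {v. A v = T g (A' v)})"
  have "subspace (S g)" if "g \<in> G" for g
    unfolding S_def subspace_def using lin(1,2) lin(3)[OF that] by (auto simp: linear_0 linear_add linear_cmul)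
  moreover have "span B \<subseteq> (\<Union>g\<in>G. S g)" using dir by (auto simp: S_def)
  ultimately obtain g where g: "g \<in> G" "span B \<subseteq> S g"
    using subspace_covered_by_finite_subspaces[OF G] subspace_span by metis
  \<comment> \<open>A single linear map carries the image of \<open>A'\<close> onto
    \<open>span B'\<close>, so the image has full dimension; \<open>T g\<close> need not be
    invertible.\<close>
  have "span B' = T g ` (A' ` span B)"
    unfolding image_image A(2)[symmetric] using g(2) by (intro image_cong) (auto simp: S_def)
  then have "dim (span B') \<le> dim (A' ` span B)" using dim_image_le[OF lin(3)[OF g(1)]] by metis
  then show ?thesis
    using A'(2) by (intro subspace_dim_equal linear_subspace_image lin subspace_span) auto
qed

section \<open>Open embeddings between open subsets of \<open>span B\<close>\<close>

text \<open>Differentiability with surjective derivative is retained instead of smoothness.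
  Derivatives occur existentially because they are determined on \<open>span B\<close> only.\<close>

definition open_embedding :: "'a::euclidean_space set \<Rightarrow> 'a set \<Rightarrow> ('a \<Rightarrow> 'a) \<Rightarrow> bool" where
  "open_embedding B D f \<longleftrightarrow> f ` D \<subseteq> span B \<and> inj_on f D \<and>
     (\<forall>u\<in>D. \<exists>f'. (f has_derivative f') (at u within D) \<and> f' ` span B = span B)"

lemma open_embedding_compose:
  assumes f: "open_embedding B D f" and g: "open_embedding B D' g" and sub: "f ` D \<subseteq> D'"
  shows "open_embedding B D (\<lambda>x. g (f x))"
  unfolding open_embedding_def
proof (intro conjI ballI)
  show "(\<lambda>x. g (f x)) ` D \<subseteq> span B" using g sub by (auto simp: open_embedding_def)
  show "inj_on (\<lambda>x. g (f x)) D"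
    using comp_inj_on[of f D g] inj_on_subset[OF _ sub, of g] f g by (simp add: open_embedding_def comp_def)
  fix u assume u: "u \<in> D"
  obtain f' where f': "(f has_derivative f') (at u within D)" "f' ` span B = span B"
    using f u by (auto simp: open_embedding_def)
  have "f u \<in> D'" using u sub by blast
  then obtain g' where g': "(g has_derivative g') (at (f u) within D')" "g' ` span B = span B"
    using g unfolding open_embedding_def by blast
  show "\<exists>h. ((\<lambda>x. g (f x)) has_derivative h) (at u within D) \<and> h ` span B = span B"
    using has_derivative_chain_within[OF f'(1) g'(1) sub] f'(2) g'(2)
    by (intro exI[where x = "\<lambda>v. g' (f' v)"]) (metis image_image)
qed

text \<open>Invariance of domain gives openness without continuity of the derivative.\<close>

lemma open_embedding_open_image:
  assumes "open_embedding B D f" "openin (top_of_set (span B)) S" "S \<subseteq> D"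
  shows "openin (top_of_set (span B)) (f ` S)"
proof (rule invariance_of_domain_subspaces[OF assms(2)])
  have "f differentiable (at u within D)" if "u \<in> D" for u
    using assms(1) that by (auto simp: open_embedding_def differentiable_def)
  then have "continuous_on D f" by (simp add: continuous_on_eq_continuous_within differentiable_imp_continuous_within)
  then show "continuous_on S f" using assms(3) by (rule continuous_on_subset)
  show "f \<in> S \<rightarrow> span B" "inj_on f S"
    using assms(1,3) by (auto simp: open_embedding_def inj_on_subset)
qed auto

text \<open>The map and its inverse are extended by the identity in the complementary directions, so
  that the derivative rule for inverses at a point of the whole space applies. Continuity of the
  inverse, which that rule needs, comes from openness of \<open>f\<close>.\<close>

lemma open_embedding_inverse:
  assumes B: "B \<subseteq> Basis" and f: "open_embedding B D f" and D: "openin (top_of_set (span B)) D" and u: "u \<in> D"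
  shows "the_inv_into D f differentiable (at (f u) within f ` D)"
proof -
  define q where "q = the_inv_into D f"
  let ?p = "coord_proj B"
  have inj: "inj_on f D" and fD: "f ` D \<subseteq> span B" using f by (auto simp: open_embedding_def)
  have qf: "q (f x) = x" if "x \<in> D" for x using the_inv_into_f_f[OF inj that] by (simp add: q_def)
  have DB: "D \<subseteq> span B" using D openin_imp_subset by blast
  obtain f' where f': "(f has_derivative f') (at u within D)" "f' ` span B = span B"
    using f u by (auto simp: open_embedding_def)
  have ld: "linear f'" using has_derivative_linear[OF f'(1)] .
  have cq: "continuous_on (f ` D) q"
  proof (rule continuous_on_inverse_open_map[where f = f and S = D])
    have "f differentiable (at u within D)" if "u \<in> D" for u
      using f that by (auto simp: open_embedding_def differentiable_def)
    then show "continuous_on D f"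
      by (simp add: continuous_on_eq_continuous_within differentiable_imp_continuous_within)
    fix S assume "openin (top_of_set D) S"
    then have S: "openin (top_of_set (span B)) S" "S \<subseteq> D"
      using openin_trans D openin_imp_subset by blast+
    have "openin (top_of_set (span B)) (f ` S)" by (rule open_embedding_open_image[OF f S])
    then show "openin (top_of_set (f ` D)) (f ` S)"
      using S(2) fD by (meson image_mono openin_subset_trans)
  qed (use qf in auto)
  have pp: "?p (x + (w - ?p w)) = x" if "x \<in> span B" for x w
    using coord_proj_span[OF B that] coord_proj_span[OF B coord_proj_in_span]
    by (simp add: linear_add[OF linear_coord_proj] linear_diff[OF linear_coord_proj])
  define M where "M = (\<lambda>v. f' (?p v) + (v - ?p v))"
  have "bounded_linear M"
    unfolding M_def
    by (intro bounded_linear_add bounded_linear_sub bounded_linear_ident bounded_linear_coord_proj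
        bounded_linear_compose[OF has_derivative_bounded_linear[OF f'(1)] bounded_linear_coord_proj])
  then have lM: "linear M" by (rule bounded_linear.linear)
  have "surj M"
  proof (rule surjI)
    fix w
    define x where "x = inv_into (span B) f' (?p w)"
    have "?p w \<in> f' ` span B" using f'(2) coord_proj_in_span by blast
    then have x: "x \<in> span B" "f' x = ?p w" unfolding x_def by (auto intro: inv_into_into f_inv_into_f)
    show "M (inv_into (span B) f' (?p w) + (w - ?p w)) = w"
      unfolding M_def x_def[symmetric] pp[OF x(1)] x(2) by simp
  qed
  then have "inj M" using linear_surjective_imp_injective[OF lM] by blast
  then obtain N where N: "linear N" "N \<circ> M = id" using linear_injective_left_inverse[OF lM] by blast
  define F where "F = (\<lambda>x. f (?p x) + (x - ?p x))"
  define Q where "Q = (\<lambda>y. q (?p y) + (y - ?p y))"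
  define T where "T = ?p -` (f ` D)"
  have T: "open T"
    unfolding T_def by (rule open_coord_proj_vimage[OF open_embedding_open_image[OF f D order_refl]])
  have pf: "?p (f x) = f x" if "x \<in> D" for x using that fD by (intro coord_proj_span[OF B]) auto
  have pu: "?p u = u" using u DB by (intro coord_proj_span[OF B]) auto
  have Qf: "Q (f x) = x" if "x \<in> D" for x using qf[OF that] by (simp add: Q_def pf[OF that])
  have "(Q has_derivative N) (at (f u))"
  proof (rule has_derivative_inverse_basic[OF _ _ N(2) _ T])
    show "(F has_derivative M) (at (Q (f u)))"
      unfolding F_def M_def Qf[OF u]
      by (intro has_derivative_add has_derivative_diff has_derivative_ident
          bounded_linear_imp_has_derivative[OF bounded_linear_coord_proj] has_derivative_coord_proj[OF D])
        (use f'(1) pu u in auto)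
    show "bounded_linear N" using N(1) by (simp add: linear_conv_bounded_linear)
    have "continuous_on T (\<lambda>y. q (?p y))"
      by (rule continuous_on_compose2[OF cq linear_continuous_on[OF bounded_linear_coord_proj]]) (auto simp: T_def)
    then have "continuous_on T Q"
      unfolding Q_def by (intro continuous_intros linear_continuous_on[OF bounded_linear_coord_proj])
    moreover show fT: "f u \<in> T" using u pf[OF u] by (simp add: T_def)
    ultimately show "continuous (at (f u)) Q" using T by (simp add: continuous_on_eq_continuous_at)
    fix z assume "z \<in> T"
    then obtain x where x: "x \<in> D" "?p z = f x" by (auto simp: T_def)
    have Qz: "Q z = x + (z - ?p z)" using qf[OF x(1)] by (simp add: Q_def x(2))
    have pQ: "?p (Q z) = x" unfolding Qz using x(1) DB by (intro pp) auto
    show "F (Q z) = z" unfolding F_def pQ unfolding Qz x(2) by simp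
  qed
  then have "(Q has_derivative N) (at (f u) within f ` D)" by (rule has_derivative_at_withinI)
  then have "(q has_derivative N) (at (f u) within f ` D)"
    by (rule has_derivative_transform[rotated 2]) (use u qf Qf in auto)
  then show ?thesis unfolding q_def differentiable_def by blast
qed

lemma onto_derivative_if_injective:
  assumes B: "B \<subseteq> Basis" and D: "openin (top_of_set (span B)) D" and u: "u \<in> D"
    and f: "f ` D \<subseteq> span B" and d: "(f has_derivative f') (at u within D)" and inj: "inj_on f' (span B)"
  shows "f' ` span B = span B"
proof (rule subspace_dim_equal)
  have l: "linear f'" by (rule has_derivative_linear[OF d])
  show "subspace (f' ` span B)" by (intro linear_subspace_image l subspace_span)
  show "f' ` span B \<subseteq> span B" by (rule derivative_into_span[OF B B D u f d])
  show "dim (span B) \<le> dim (f' ` span B)"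
    using dim_image_eq[OF l, of "span B"] inj by (simp add: span_span)
qed (rule subspace_span)

text \<open>Extended by the identity in the complementary coordinates, \<open>f\<close> becomes a
  differentiable map between sets of the full space, and such maps preserve null sets.\<close>

lemma negligible_cylinder_image:
  assumes B: "B \<subseteq> Basis" and K: "negligible (cylinder B K)" "K \<subseteq> span B"
    and f: "f differentiable_on K" "f ` K \<subseteq> span B"
  shows "negligible (cylinder B (f ` K))"
proof -
  let ?p = "coord_proj B"
  define F where "F = (\<lambda>y. f (?p y) + (y - ?p y))"
  have pd: "(?p has_derivative ?p) net" for net
    by (rule bounded_linear_imp_has_derivative[OF bounded_linear_coord_proj])
  have "F differentiable_on cylinder B K"
    unfolding differentiable_on_def
  proof
    fix y assume y: "y \<in> cylinder B K"
    then obtain f' where f': "(f has_derivative f') (at (?p y) within K)"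
      using f(1) by (auto simp: differentiable_on_def differentiable_def cylinder_def)
    have "((\<lambda>y. f (?p y)) has_derivative (\<lambda>v. f' (?p v))) (at y within cylinder B K)"
      by (rule has_derivative_chain_within[OF pd f']) (auto simp: cylinder_def)
    then have "(F has_derivative (\<lambda>v. f' (?p v) + (v - ?p v))) (at y within cylinder B K)"
      unfolding F_def by (intro has_derivative_add has_derivative_diff has_derivative_ident pd)
    then show "F differentiable (at y within cylinder B K)" unfolding differentiable_def by blast
  qed
  then have "negligible (F ` cylinder B K)"
    by (rule negligible_differentiable_image_negligible[OF order_refl K(1)])
  moreover have "cylinder B (f ` K) \<subseteq> F ` cylinder B K"
  proof
    fix y assume "y \<in> cylinder B (f ` K)"
    then obtain x where x: "x \<in> K" "?p y = f x" by (auto simp: cylinder_def)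
    have xB: "?p x = x" using x(1) K(2) by (intro coord_proj_span[OF B]) auto
    have z: "?p (x + (y - ?p y)) = x"
      using xB coord_proj_span[OF B coord_proj_in_span]
      by (simp add: linear_add[OF linear_coord_proj] linear_diff[OF linear_coord_proj])
    have "y = F (x + (y - ?p y))" unfolding F_def z x(2)[symmetric] by simp
    moreover have "x + (y - ?p y) \<in> cylinder B K" using z x(1) by (simp add: cylinder_def)
    ultimately show "y \<in> F ` cylinder B K" by (rule image_eqI)
  qed
  ultimately show ?thesis by (rule negligible_subset)
qed


section \<open>Charts and local lifts\<close>

context
  fixes B :: "'a::euclidean_space set" and X :: "'x topology" and c :: "('a, 'x, 'g) orb_chart"
  assumes B: "B \<subseteq> Basis" and chart: "orbifold_chart B X c"
begin

interpretation group_action "chart_group c" "chart_dom c" "chart_action c"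
  using chart by (simp add: orbifold_chart_def faithful_action_def)

interpretation group "chart_group c"
  using group_hom by (simp add: group_hom_def)

lemma chart_dom_open: "openin (top_of_set (span B)) (chart_dom c)"
  using chart by (simp add: orbifold_chart_def)

lemma chart_dom_span: "chart_dom c \<subseteq> span B"
  using chart_dom_open openin_imp_subset by blast

lemma chart_nbhd_open: "openin X (chart_nbhd c)"
  using chart by (simp add: orbifold_chart_def)

lemma chart_zero: "0 \<in> chart_dom c" "chart_proj c 0 = chart_center c"
  using chart by (simp_all add: orbifold_chart_def)

lemma chart_center_nbhd: "chart_center c \<in> chart_nbhd c"
  using chart by (simp add: orbifold_chart_def)

lemma chart_group_finite: "finite (carrier (chart_group c))"
  using chart by (simp add: orbifold_chart_def)

lemma chart_homeo:
  "homeomorphic_map (orbit_space (chart_group c) (chart_dom c) (chart_action c))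
     (subtopology X (chart_nbhd c)) (chart_homeo c)"
  using chart by (simp add: orbifold_chart_def)

lemma chart_homeo_image:
  "chart_homeo c ` orbits (chart_group c) (chart_dom c) (chart_action c) = chart_nbhd c"
proof -
  have "chart_nbhd c \<subseteq> topspace X" using chart_nbhd_open openin_subset by blast
  then show ?thesis
    using homeomorphic_imp_surjective_map[OF chart_homeo] by (simp add: topspace_orbit_space Int_absorb1)
qed

lemma chart_proj_image: "chart_proj c ` chart_dom c = chart_nbhd c"
  using chart_homeo_image by (auto simp: chart_proj_def orbits_def)

lemma chart_proj_eqD:
  assumes "u \<in> chart_dom c" "w \<in> chart_dom c" "chart_proj c u = chart_proj c w"
  obtains g where "g \<in> carrier (chart_group c)" "chart_action c g u = w"
proof -
  let ?orb = "orbit (chart_group c) (chart_action c)"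
  have "?orb u = ?orb w"
    using homeomorphic_imp_injective_map[OF chart_homeo] assms
    unfolding topspace_orbit_space chart_proj_def orbits_def by (auto dest: inj_onD)
  moreover have "w \<in> ?orb w"
  proof -
    have "chart_action c \<one>\<^bsub>chart_group c\<^esub> w = w" using id_eq_one assms(2) by (metis restrict_apply')
    then show ?thesis unfolding orbit_def by force
  qed
  ultimately have "w \<in> ?orb u" by simp
  then show ?thesis using that by (auto simp: orbit_def)
qed

lemma chart_action_dom:
  "g \<in> carrier (chart_group c) \<Longrightarrow> u \<in> chart_dom c \<Longrightarrow> chart_action c g u \<in> chart_dom c"
  by (rule element_image) auto

lemma chart_proj_action:
  assumes g: "g \<in> carrier (chart_group c)" and u: "u \<in> chart_dom c"
  shows "chart_proj c (chart_action c g u) = chart_proj c u"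
proof -
  have "orbit (chart_group c) (chart_action c) (chart_action c g u) = orbit (chart_group c) (chart_action c) u"
  proof (intro equalityI subsetI)
    fix z assume "z \<in> orbit (chart_group c) (chart_action c) (chart_action c g u)"
    then obtain h where "h \<in> carrier (chart_group c)" "z = chart_action c h (chart_action c g u)"
      by (auto simp: orbit_def)
    then have "z = chart_action c (h \<otimes>\<^bsub>chart_group c\<^esub> g) u" "h \<otimes>\<^bsub>chart_group c\<^esub> g \<in> carrier (chart_group c)"
      using composition_rule[OF u _ g] g by auto
    then show "z \<in> orbit (chart_group c) (chart_action c) u" by (auto simp: orbit_def)
  next
    fix z assume "z \<in> orbit (chart_group c) (chart_action c) u"
    then obtain h where h: "h \<in> carrier (chart_group c)" "z = chart_action c h u" by (auto simp: orbit_def)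
    let ?k = "h \<otimes>\<^bsub>chart_group c\<^esub> m_inv (chart_group c) g"
    have k: "?k \<in> carrier (chart_group c)" using h(1) g by simp
    have "chart_action c ?k (chart_action c g u) = chart_action c (?k \<otimes>\<^bsub>chart_group c\<^esub> g) u"
      using composition_rule[OF u k g] by simp
    also have "?k \<otimes>\<^bsub>chart_group c\<^esub> g = h" using h(1) g by (simp add: m_assoc)
    finally have "z = chart_action c ?k (chart_action c g u)" using h(2) by simp
    then show "z \<in> orbit (chart_group c) (chart_action c) (chart_action c g u)"
      using k by (auto simp: orbit_def)
  qed
  then show ?thesis by (simp add: chart_proj_def)
qed

lemma chart_action_differentiable:
  assumes "g \<in> carrier (chart_group c)" "u \<in> chart_dom c"
  shows "chart_action c g differentiable (at u within chart_dom c)"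
  using chart assms by (intro smooth_on_differentiable[of "span B"]) (auto simp: orbifold_chart_def)

text \<open>The derivative of the inverse group element is a left inverse on \<open>span B\<close>,
  and equality of dimensions turns injectivity into surjectivity.\<close>

lemma chart_action_embedding:
  assumes g: "g \<in> carrier (chart_group c)"
  shows "open_embedding B (chart_dom c) (chart_action c g)"
  unfolding open_embedding_def
proof (intro conjI ballI)
  let ?D = "chart_dom c"
  show im: "chart_action c g ` ?D \<subseteq> span B" using chart_action_dom[OF g] chart_dom_span by blast
  show "inj_on (chart_action c g) ?D" by (rule inj_prop[OF g])
  fix u assume u: "u \<in> ?D"
  let ?h = "m_inv (chart_group c) g"
  have h: "?h \<in> carrier (chart_group c)" using g by simp
  obtain A where A: "(chart_action c g has_derivative A) (at u within ?D)"
    using chart_action_differentiable[OF g u] by (auto simp: differentiable_def)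
  obtain A' where A': "(chart_action c ?h has_derivative A') (at (chart_action c g u) within ?D)"
    using chart_action_differentiable[OF h chart_action_dom[OF g u]] by (auto simp: differentiable_def)
  have "((\<lambda>x. chart_action c ?h (chart_action c g x)) has_derivative (\<lambda>v. A' (A v))) (at u within ?D)"
    by (rule has_derivative_chain_within[OF A A']) (use chart_action_dom[OF g] in blast)
  then have 1: "((\<lambda>x. x) has_derivative (\<lambda>v. A' (A v))) (at u within ?D)"
    by (rule has_derivative_transform[rotated 2]) (use u orbit_sym_aux[OF g] in auto)
  have "A' (A v) = v" if "v \<in> span B" for v
    using derivative_unique_span[OF B chart_dom_open u 1 has_derivative_ident that] .
  then have "inj_on A (span B)" by (rule inj_on_inverseI)
  then have "A ` span B = span B"
    by (rule onto_derivative_if_injective[OF B chart_dom_open u im A])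
  then show "\<exists>f'. (chart_action c g has_derivative f') (at u within ?D) \<and> f' ` span B = span B"
    using A by blast
qed

lemma chart_proj_continuous: "continuous_map (top_of_set (chart_dom c)) X (chart_proj c)"
proof -
  have "continuous_map (top_of_set (chart_dom c)) (subtopology X (chart_nbhd c))
      (chart_homeo c \<circ> orbit (chart_group c) (chart_action c))"
    using quotient_imp_continuous_map[OF quotient_map_orbit] homeomorphic_imp_continuous_map[OF chart_homeo]
    by (rule continuous_map_compose)
  then show ?thesis
    unfolding comp_def chart_proj_def[symmetric] by (simp add: continuous_map_in_subtopology)
qed

end

section \<open>Coordinate changes between charts\<close>

text \<open>Compatibility provides an embedding that sends \<open>u\<close> merely into the orbit of
  \<open>w\<close>; composing it with a group element corrects the value.\<close>

lemma chart_transition: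
  assumes B: "B \<subseteq> Basis" and e: "orbifold_chart B X e" and c: "orbifold_chart B X c"
    and comp: "chart_compatible B e c" and u: "u \<in> chart_dom e" and w: "w \<in> chart_dom c"
    and uw: "chart_proj e u = chart_proj c w"
  obtains \<psi> where "open_embedding B (chart_dom e) \<psi>" "\<psi> u = w" "\<psi> ` chart_dom e \<subseteq> chart_dom c"
    "\<And>x. x \<in> chart_dom e \<Longrightarrow> chart_proj c (\<psi> x) = chart_proj e x"
proof -
  obtain \<phi> where emb: "smooth_embedding (span B) (chart_dom e) (chart_dom c) \<phi>"
    and cov: "\<And>x. x \<in> chart_dom e \<Longrightarrow> chart_proj c (\<phi> x) = chart_proj e x"
    using comp unfolding chart_compatible_def by blast
  have im: "\<phi> ` chart_dom e \<subseteq> chart_dom c" using emb by (simp add: smooth_embedding_def)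
  have imB: "\<phi> ` chart_dom e \<subseteq> span B" using im chart_dom_span[OF B c] by blast
  have "chart_proj c (\<phi> u) = chart_proj c w" using cov[OF u] uw by simp
  then obtain g where g: "g \<in> carrier (chart_group c)" "chart_action c g (\<phi> u) = w"
    using chart_proj_eqD[OF B c] im u w by (metis image_subset_iff)
  have "open_embedding B (chart_dom e) \<phi>"
    unfolding open_embedding_def
  proof (intro conjI ballI imB)
    have "homeomorphic_map (top_of_set (chart_dom e)) (subtopology (top_of_set (chart_dom c)) (\<phi> ` chart_dom e)) \<phi>"
      using emb by (simp add: smooth_embedding_def embedding_map_def)
    from homeomorphic_imp_injective_map[OF this] show "inj_on \<phi> (chart_dom e)" by simp
    fix x assume x: "x \<in> chart_dom e"
    let ?d = "frechet_derivative \<phi> (at x within chart_dom e)"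
    have d: "(\<phi> has_derivative ?d) (at x within chart_dom e)"
      using emb x smooth_on_differentiable[of "span B"] frechet_derivative_works
      by (metis smooth_embedding_def)
    have "inj_on ?d (span B)" using emb x by (simp add: smooth_embedding_def)
    then have "?d ` span B = span B"
      by (rule onto_derivative_if_injective[OF B chart_dom_open[OF B e] x imB d])
    then show "\<exists>f'. (\<phi> has_derivative f') (at x within chart_dom e) \<and> f' ` span B = span B"
      using d by blast
  qed
  then have "open_embedding B (chart_dom e) (\<lambda>x. chart_action c g (\<phi> x))"
    using chart_action_embedding[OF B c g(1)] im by (rule open_embedding_compose)
  then show ?thesis
  proof (rule that)
    show "(\<lambda>x. chart_action c g (\<phi> x)) ` chart_dom e \<subseteq> chart_dom c"
      using chart_action_dom[OF B c g(1)] im by blast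
    show "chart_proj c (chart_action c g (\<phi> x)) = chart_proj e x" if "x \<in> chart_dom e" for x
      using chart_proj_action[OF B c g(1)] cov[OF that] im that by (simp add: image_subset_iff)
  qed (rule g(2))
qed

lemma smooth_orbifoldD:
  assumes "smooth_orbifold \<O>"
  shows "orb_coords \<O> \<subseteq> Basis" "paracompact_space (orb_space \<O>)"
    "\<And>c. c \<in> orb_charts \<O> \<Longrightarrow> orbifold_chart (orb_coords \<O>) (orb_space \<O>) c"
    "\<And>x U. openin (orb_space \<O>) U \<Longrightarrow> x \<in> U \<Longrightarrow> \<exists>c\<in>orb_charts \<O>. chart_center c = x \<and> chart_nbhd c \<subseteq> U"
    "\<And>c d. c \<in> orb_charts \<O> \<Longrightarrow> d \<in> orb_charts \<O> \<Longrightarrow> chart_nbhd c \<subseteq> chart_nbhd d \<Longrightarrow>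
      chart_compatible (orb_coords \<O>) c d"
  using assms by (simp_all add: smooth_orbifold_def)

text \<open>A chart centred at the common point and contained in both neighbourhoods maps into both
  charts. Prescribing the images of its origin makes it a common coordinate system at
  \<open>u\<close> and \<open>w\<close>.\<close>

lemma common_refinement:
  assumes O: "smooth_orbifold \<O>" and c: "c \<in> orb_charts \<O>" and d: "d \<in> orb_charts \<O>"
    and u: "u \<in> chart_dom c" and w: "w \<in> chart_dom d" and eq: "chart_proj c u = chart_proj d w"
  obtains e \<psi> \<eta> where "e \<in> orb_charts \<O>" "open_embedding (orb_coords \<O>) (chart_dom e) \<psi>"
    "open_embedding (orb_coords \<O>) (chart_dom e) \<eta>" "\<psi> 0 = u" "\<eta> 0 = w"
    "\<psi> ` chart_dom e \<subseteq> chart_dom c" "\<eta> ` chart_dom e \<subseteq> chart_dom d"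
    "\<And>x. x \<in> chart_dom e \<Longrightarrow> chart_proj c (\<psi> x) = chart_proj e x"
    "\<And>x. x \<in> chart_dom e \<Longrightarrow> chart_proj d (\<eta> x) = chart_proj e x"
proof -
  let ?B = "orb_coords \<O>"
  note B = smooth_orbifoldD(1)[OF O] and ch = smooth_orbifoldD(3)[OF O]
    and base = smooth_orbifoldD(4)[OF O] and comp = smooth_orbifoldD(5)[OF O]
  have "openin (orb_space \<O>) (chart_nbhd c \<inter> chart_nbhd d)"
    using chart_nbhd_open[OF B ch[OF c]] chart_nbhd_open[OF B ch[OF d]] by (rule openin_Int)
  moreover have "chart_proj c u \<in> chart_nbhd c \<inter> chart_nbhd d"
    using imageI[OF u, of "chart_proj c"] imageI[OF w, of "chart_proj d"] eq
    unfolding chart_proj_image[OF B ch[OF c]] chart_proj_image[OF B ch[OF d]] by simp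
  ultimately obtain e where e: "e \<in> orb_charts \<O>" "chart_center e = chart_proj c u"
    "chart_nbhd e \<subseteq> chart_nbhd c" "chart_nbhd e \<subseteq> chart_nbhd d"
    using base by (metis le_inf_iff)
  note e0 = chart_zero[OF B ch[OF e(1)]]
  obtain \<psi> where \<psi>: "open_embedding ?B (chart_dom e) \<psi>" "\<psi> 0 = u" "\<psi> ` chart_dom e \<subseteq> chart_dom c"
    "\<And>x. x \<in> chart_dom e \<Longrightarrow> chart_proj c (\<psi> x) = chart_proj e x"
    using chart_transition[OF B ch[OF e(1)] ch[OF c] comp[OF e(1) c e(3)] e0(1) u] e0(2) e(2) by metis
  obtain \<eta> where \<eta>: "open_embedding ?B (chart_dom e) \<eta>" "\<eta> 0 = w" "\<eta> ` chart_dom e \<subseteq> chart_dom d"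
    "\<And>x. x \<in> chart_dom e \<Longrightarrow> chart_proj d (\<eta> x) = chart_proj e x"
    using chart_transition[OF B ch[OF e(1)] ch[OF d] comp[OF e(1) d e(4)] e0(1) w] e0(2) e(2) eq by metis
  show ?thesis by (rule that[OF e(1) \<psi>(1) \<eta>(1) \<psi>(2) \<eta>(2) \<psi>(3) \<eta>(3) \<psi>(4) \<eta>(4)])
qed


section \<open>Lifts in charts and their critical points\<close>

definition local_lift ::
  "('a::euclidean_space, 'x, 'g) orbifold \<Rightarrow> ('b::euclidean_space, 'y, 'h) orbifold \<Rightarrow> ('x \<Rightarrow> 'y) \<Rightarrow>
   ('a, 'x, 'g) orb_chart \<Rightarrow> ('b, 'y, 'h) orb_chart \<Rightarrow> ('a \<Rightarrow> 'b) \<Rightarrow> bool" where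
  "local_lift \<O> \<P> f c d L \<longleftrightarrow> c \<in> orb_charts \<O> \<and> d \<in> orb_charts \<P> \<and>
     L ` chart_dom c \<subseteq> chart_dom d \<and> smooth_on (span (orb_coords \<O>)) (chart_dom c) L \<and>
     (\<forall>u\<in>chart_dom c. f (chart_proj c u) = chart_proj d (L u))"

lemma local_liftD:
  assumes "local_lift \<O> \<P> f c d L"
  shows "c \<in> orb_charts \<O>" "d \<in> orb_charts \<P>" "L ` chart_dom c \<subseteq> chart_dom d"
    "smooth_on (span (orb_coords \<O>)) (chart_dom c) L"
    "\<And>u. u \<in> chart_dom c \<Longrightarrow> f (chart_proj c u) = chart_proj d (L u)"
    "\<And>u. u \<in> chart_dom c \<Longrightarrow>
      (L has_derivative frechet_derivative L (at u within chart_dom c)) (at u within chart_dom c)"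
  using assms smooth_on_differentiable frechet_derivative_works unfolding local_lift_def by blast+

text \<open>Formulated at arbitrary points of a chart, so that a single lift can account for all
  points of its neighbourhood.\<close>

definition critical_at :: "('a::euclidean_space, 'x, 'g) orbifold \<Rightarrow> ('b::euclidean_space, 'y, 'h) orbifold \<Rightarrow>
   ('a, 'x, 'g) orb_chart \<Rightarrow> ('a \<Rightarrow> 'b) \<Rightarrow> 'a \<Rightarrow> bool" where
  "critical_at \<O> \<P> c L u \<longleftrightarrow>
     frechet_derivative L (at u within chart_dom c) ` span (orb_coords \<O>) \<noteq> span (orb_coords \<P>)"

text \<open>Read in common charts of source and target, the lifts cover the same map, so at each
  point an element of the finite group of \<open>d\<close> relates them. It may vary without
  continuity, and the comparison of derivatives allows for that.\<close>

lemma critical_at_transfer: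
  fixes \<O> :: "('a::euclidean_space, 'x, 'g) orbifold" and \<P> :: "('b::euclidean_space, 'y, 'h) orbifold"
  assumes O: "smooth_orbifold \<O>" and P: "smooth_orbifold \<P>"
    and L: "local_lift \<O> \<P> f c d L" and L': "local_lift \<O> \<P> f c' d' L'"
    and u: "u \<in> chart_dom c" and u': "u' \<in> chart_dom c'" and uu': "chart_proj c u = chart_proj c' u'"
    and crit: "critical_at \<O> \<P> c' L' u'"
  shows "critical_at \<O> \<P> c L u"
proof (rule ccontr)
  assume "\<not> critical_at \<O> \<P> c L u"
  let ?B = "orb_coords \<O>" and ?B' = "orb_coords \<P>"
  have onto: "frechet_derivative L (at u within chart_dom c) ` span ?B = span ?B'"
    using \<open>\<not> critical_at \<O> \<P> c L u\<close> by (simp add: critical_at_def)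
  note L = local_liftD[OF L] and L' = local_liftD[OF L']
  note B = smooth_orbifoldD(1)[OF O] and ch = smooth_orbifoldD(3)[OF O]
    and B' = smooth_orbifoldD(1)[OF P] and ch' = smooth_orbifoldD(3)[OF P]
  obtain e \<psi> \<psi>' where e: "e \<in> orb_charts \<O>" and \<psi>: "open_embedding ?B (chart_dom e) \<psi>"
    and \<psi>': "open_embedding ?B (chart_dom e) \<psi>'" and \<psi>0: "\<psi> 0 = u" "\<psi>' 0 = u'"
    and \<psi>im: "\<psi> ` chart_dom e \<subseteq> chart_dom c" "\<psi>' ` chart_dom e \<subseteq> chart_dom c'"
    and \<psi>cov: "\<And>x. x \<in> chart_dom e \<Longrightarrow> chart_proj c (\<psi> x) = chart_proj e x"
      "\<And>x. x \<in> chart_dom e \<Longrightarrow> chart_proj c' (\<psi>' x) = chart_proj e x"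
    by (rule common_refinement[OF O L(1) L'(1) u u' uu']) (rule that; assumption)
  have Lu: "L u \<in> chart_dom d" "L' u' \<in> chart_dom d'" using L(3) L'(3) u u' by blast+
  have "chart_proj d (L u) = chart_proj d' (L' u')" using L(5)[OF u] L'(5)[OF u'] uu' by simp
  then obtain k \<eta> \<eta>' where k: "k \<in> orb_charts \<P>" and \<eta>: "open_embedding ?B' (chart_dom k) \<eta>"
    and \<eta>': "open_embedding ?B' (chart_dom k) \<eta>'" and \<eta>0: "\<eta> 0 = L u" "\<eta>' 0 = L' u'"
    and \<eta>im: "\<eta> ` chart_dom k \<subseteq> chart_dom d" "\<eta>' ` chart_dom k \<subseteq> chart_dom d'"
    and \<eta>cov: "\<And>x. x \<in> chart_dom k \<Longrightarrow> chart_proj d (\<eta> x) = chart_proj k x"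
      "\<And>x. x \<in> chart_dom k \<Longrightarrow> chart_proj d' (\<eta>' x) = chart_proj k x"
    by (rule common_refinement[OF P L(2) L'(2) Lu]) (rule that; assumption)
  have e0: "0 \<in> chart_dom e" and k0: "0 \<in> chart_dom k"
    using chart_zero[OF B ch[OF e]] chart_zero[OF B' ch'[OF k]] by auto
  note kd = chart_dom_open[OF B' ch'[OF k]] and ed = chart_dom_open[OF B ch[OF e]]
  define R where "R = \<eta>' ` chart_dom k"
  have R: "openin (top_of_set (span ?B')) R"
    unfolding R_def by (rule open_embedding_open_image[OF \<eta>' kd order_refl])
  define q where "q = the_inv_into (chart_dom k) \<eta>'"
  have inj: "inj_on \<eta>' (chart_dom k)" using \<eta>' by (simp add: open_embedding_def)
  have q\<eta>: "q (\<eta>' z) = z" if "z \<in> chart_dom k" for z using the_inv_into_f_f[OF inj that] by (simp add: q_def)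
  \<comment> \<open>On this neighbourhood the values of the second lift stay in the image of
    \<open>\<eta>'\<close>, so they can be moved to \<open>k\<close> by its inverse.\<close>
  define W where "W = {w \<in> chart_dom e. L' (\<psi>' w) \<in> R}"
  obtain P\<psi> P\<psi>' where P\<psi>: "(\<psi> has_derivative P\<psi>) (at 0 within chart_dom e)" "P\<psi> ` span ?B = span ?B"
    and P\<psi>': "(\<psi>' has_derivative P\<psi>') (at 0 within chart_dom e)" "P\<psi>' ` span ?B = span ?B"
    using \<psi> \<psi>' e0 unfolding open_embedding_def by blast
  have im': "(\<lambda>w. L' (\<psi>' w)) ` chart_dom e \<subseteq> span ?B'"
    using \<psi>im(2) L'(3) chart_dom_span[OF B' ch'[OF L'(2)]] by blast
  have "(\<lambda>w. L' (\<psi>' w)) differentiable (at w within chart_dom e)" if w: "w \<in> chart_dom e" for w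
  proof -
    have "\<psi>' w \<in> chart_dom c'" using \<psi>im(2) w by blast
    moreover obtain D where "(\<psi>' has_derivative D) (at w within chart_dom e)"
      using \<psi>' w unfolding open_embedding_def by blast
    ultimately show ?thesis
      using has_derivative_chain_within[OF _ L'(6) \<psi>im(2)] unfolding differentiable_def by blast
  qed
  then have "continuous_on (chart_dom e) (\<lambda>w. L' (\<psi>' w))"
    by (simp add: continuous_on_eq_continuous_within differentiable_imp_continuous_within)
  then have "openin (top_of_set (chart_dom e)) (chart_dom e \<inter> (\<lambda>w. L' (\<psi>' w)) -` R)"
    using im' R by (intro continuous_openin_preimage) auto
  moreover have "chart_dom e \<inter> (\<lambda>w. L' (\<psi>' w)) -` R = W" by (auto simp: W_def)
  ultimately have W: "openin (top_of_set (span ?B)) W" using ed openin_trans by metis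
  have We: "W \<subseteq> chart_dom e" by (auto simp: W_def)
  have "\<eta>' 0 \<in> R" using k0 by (simp add: R_def)
  then have W0: "0 \<in> W" using e0 \<psi>0 \<eta>0 by (simp add: W_def)
  let ?L = "frechet_derivative L (at u within chart_dom c)"
  let ?L' = "frechet_derivative L' (at u' within chart_dom c')"
  have A: "((\<lambda>w. L (\<psi> w)) has_derivative (\<lambda>v. ?L (P\<psi> v))) (at 0 within W)"
    using has_derivative_subset[OF has_derivative_chain_within[OF P\<psi>(1) _ \<psi>im(1)] We] L(6)[OF u] \<psi>0 by metis
  have A': "((\<lambda>w. L' (\<psi>' w)) has_derivative (\<lambda>v. ?L' (P\<psi>' v))) (at 0 within chart_dom e)"
    using has_derivative_chain_within[OF P\<psi>'(1) _ \<psi>im(2)] L'(6)[OF u'] \<psi>0 by metis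
  define \<tau> where "\<tau> = (\<lambda>g w. chart_action d g (\<eta> (q w)))"
  have "(\<lambda>v. ?L' (P\<psi>' v)) ` span ?B = span ?B'"
  proof (rule derivative_onto_transfer[OF B W W0 A _ has_derivative_subset[OF A' We]])
    show "(\<lambda>v. ?L (P\<psi> v)) ` span ?B = span ?B'" using P\<psi>(2) onto by (metis image_image)
    show "(\<lambda>v. ?L' (P\<psi>' v)) ` span ?B \<subseteq> span ?B'"
      by (rule derivative_into_span[OF B B' ed e0 im' A'])
    show "finite (carrier (chart_group d))" by (rule chart_group_finite[OF B' ch'[OF L(2)]])
    show "(\<lambda>w. L' (\<psi>' w)) ` W \<subseteq> R" by (auto simp: W_def)
    fix w assume w: "w \<in> W"
    then obtain z where z: "z \<in> chart_dom k" "L' (\<psi>' w) = \<eta>' z" by (auto simp: W_def R_def)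
    have we: "w \<in> chart_dom e" using w We by blast
    have mem: "\<psi> w \<in> chart_dom c" "\<psi>' w \<in> chart_dom c'" "\<eta> z \<in> chart_dom d" "L (\<psi> w) \<in> chart_dom d"
      using \<psi>im \<eta>im we z L(3) by blast+
    have "chart_proj d (\<eta> z) = chart_proj d' (L' (\<psi>' w))" using \<eta>cov z by simp
    also have "\<dots> = chart_proj d (L (\<psi> w))"
      using L(5)[OF mem(1)] L'(5)[OF mem(2)] \<psi>cov we by simp
    finally obtain g where "g \<in> carrier (chart_group d)" "chart_action d g (\<eta> z) = L (\<psi> w)"
      by (rule chart_proj_eqD[OF B' ch'[OF L(2)] mem(3,4)])
    then show "\<exists>g\<in>carrier (chart_group d). L (\<psi> w) = \<tau> g (L' (\<psi>' w))"
      using q\<eta>[OF z(1)] z(2) unfolding \<tau>_def by metis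
  next
    fix g assume g: "g \<in> carrier (chart_group d)"
    obtain Q where Q: "(q has_derivative Q) (at (\<eta>' 0) within R)"
      using open_embedding_inverse[OF B' \<eta>' kd k0] unfolding q_def R_def differentiable_def by blast
    obtain H where H: "(\<eta> has_derivative H) (at 0 within chart_dom k)"
      using \<eta> k0 unfolding open_embedding_def by blast
    obtain A where A: "(chart_action d g has_derivative A) (at (\<eta> 0) within chart_dom d)"
      using chart_action_differentiable[OF B' ch'[OF L(2)] g] \<eta>im k0 unfolding differentiable_def by blast
    have "((\<lambda>z. chart_action d g (\<eta> z)) has_derivative (\<lambda>v. A (H v))) (at 0 within chart_dom k)"
      by (rule has_derivative_chain_within[OF H A \<eta>im(1)])
    then have AH: "((\<lambda>z. chart_action d g (\<eta> z)) has_derivative (\<lambda>v. A (H v))) (at (q (\<eta>' 0)) within chart_dom k)"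
      using q\<eta>[OF k0] by simp
    have "(\<tau> g has_derivative (\<lambda>v. A (H (Q v)))) (at (\<eta>' 0) within R)"
      unfolding \<tau>_def by (rule has_derivative_chain_within[OF Q AH]) (auto simp: R_def q\<eta>)
    then show "\<tau> g differentiable (at (L' (\<psi>' 0)) within R)"
      unfolding differentiable_def \<psi>0 \<eta>0 by blast
  qed
  then have "?L' ` span ?B = span ?B'" using P\<psi>'(2) by (metis image_image)
  then show False using crit by (simp add: critical_at_def)
qed

text \<open>Sard's theorem gives a null set in \<open>chart_dom d\<close>, but \<open>d'\<close> is
  any other chart. Near each of its points the set is carried over by finitely many differentiable
  maps, one for each group element of \<open>d\<close>.\<close>

lemma negligible_critical_values_in_chart:
  fixes \<O> :: "('a::euclidean_space, 'x, 'g) orbifold" and \<P> :: "('b::euclidean_space, 'y, 'h) orbifold"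
  assumes O: "smooth_orbifold \<O>" and P: "smooth_orbifold \<P>"
    and L: "local_lift \<O> \<P> f c d L" and d': "d' \<in> orb_charts \<P>"
  shows "negligible (cylinder (orb_coords \<P>) {v \<in> chart_dom d'.
    \<exists>u\<in>chart_dom c. critical_at \<O> \<P> c L u \<and> chart_proj d' v = f (chart_proj c u)})"
    (is "negligible (cylinder ?B' ?N)")
proof -
  let ?B = "orb_coords \<O>" and ?p = "coord_proj (orb_coords \<P>)"
  note L = local_liftD[OF L]
  note B = smooth_orbifoldD(1)[OF O] and ch = smooth_orbifoldD(3)[OF O]
    and B' = smooth_orbifoldD(1)[OF P] and ch' = smooth_orbifoldD(3)[OF P]
  have dB: "chart_dom d \<subseteq> span ?B'" by (rule chart_dom_span[OF B' ch'[OF L(2)]])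
  define K where "K = L ` {u \<in> chart_dom c. critical_at \<O> \<P> c L u}"
  have K: "negligible (cylinder ?B' K)"
    unfolding K_def critical_at_def using L(3) dB
    by (intro sard_span[OF B B' chart_dom_open[OF B ch[OF L(1)]] L(4)]) auto
  have Kd: "K \<subseteq> chart_dom d" using L(3) by (auto simp: K_def)
  have "negligible (\<Union>v\<in>?N. {y. ?p y = v})"
  proof (rule negligible_UN_local)
    fix v0 assume "v0 \<in> ?N"
    then obtain u where v0: "v0 \<in> chart_dom d'" and u: "u \<in> chart_dom c" "critical_at \<O> \<P> c L u"
      and vu: "chart_proj d' v0 = f (chart_proj c u)" by blast
    have Lu: "L u \<in> chart_dom d" using L(3) u by blast
    have "chart_proj d (L u) = chart_proj d' v0" using vu L(5)[OF u(1)] by simp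
    then obtain k \<eta> \<eta>' where k: "k \<in> orb_charts \<P>" and \<eta>: "open_embedding ?B' (chart_dom k) \<eta>"
      and \<eta>': "open_embedding ?B' (chart_dom k) \<eta>'" and \<eta>0: "\<eta> 0 = L u" "\<eta>' 0 = v0"
      and \<eta>im: "\<eta> ` chart_dom k \<subseteq> chart_dom d" "\<eta>' ` chart_dom k \<subseteq> chart_dom d'"
      and \<eta>cov: "\<And>x. x \<in> chart_dom k \<Longrightarrow> chart_proj d (\<eta> x) = chart_proj k x"
        "\<And>x. x \<in> chart_dom k \<Longrightarrow> chart_proj d' (\<eta>' x) = chart_proj k x"
      by (rule common_refinement[OF P L(2) d' Lu v0]) (rule that; assumption)
    have k0: "0 \<in> chart_dom k" using chart_zero[OF B' ch'[OF k]] by auto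
    note kd = chart_dom_open[OF B' ch'[OF k]]
    define q where "q = the_inv_into (chart_dom k) \<eta>"
    have inj: "inj_on \<eta> (chart_dom k)" using \<eta> by (simp add: open_embedding_def)
    have q\<eta>: "q (\<eta> z) = z" if "z \<in> chart_dom k" for z using the_inv_into_f_f[OF inj that] by (simp add: q_def)
    define W where "W = ?p -` (\<eta>' ` chart_dom k)"
    have W: "open W"
      unfolding W_def by (rule open_coord_proj_vimage[OF open_embedding_open_image[OF \<eta>' kd order_refl]])
    have \<eta>'B: "\<eta>' ` chart_dom k \<subseteq> span ?B'" using \<eta>' by (simp add: open_embedding_def)
    have pv: "?p v = v" if "v \<in> chart_dom d'" for v
      using that chart_dom_span[OF B' ch'[OF d']] by (intro coord_proj_span[OF B']) auto
    have v0W: "v0 \<in> W" using pv[OF v0] \<eta>0(2) k0 by (force simp: W_def)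
    \<comment> \<open>\<open>L u\<close> and the transported point agree only up to the group of
      \<open>d\<close>. \<open>R g\<close> collects the critical values that \<open>g\<close> moves
      into the overlap, from where \<open>\<tau> g\<close> leads to \<open>d'\<close>.\<close>
    define R where "R = (\<lambda>g. {w \<in> K. chart_action d g w \<in> \<eta> ` chart_dom k})"
    define \<tau> where "\<tau> = (\<lambda>g w. \<eta>' (q (chart_action d g w)))"
    have neg: "negligible (cylinder ?B' (\<tau> g ` R g))" if g: "g \<in> carrier (chart_group d)" for g
    proof (rule negligible_cylinder_image[OF B'])
      show "negligible (cylinder ?B' (R g))"
        by (rule negligible_subset[OF K cylinder_mono]) (auto simp: R_def)
      show "R g \<subseteq> span ?B'" using Kd dB by (auto simp: R_def)
      show "\<tau> g ` R g \<subseteq> span ?B'" using \<eta>'B q\<eta> by (auto simp: R_def \<tau>_def)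
      show "\<tau> g differentiable_on R g"
        unfolding differentiable_on_def
      proof
        fix w assume w: "w \<in> R g"
        then obtain z where z: "z \<in> chart_dom k" "chart_action d g w = \<eta> z" by (auto simp: R_def)
        have wd: "w \<in> chart_dom d" using w Kd by (auto simp: R_def)
        obtain A where A: "(chart_action d g has_derivative A) (at w within chart_dom d)"
          using chart_action_differentiable[OF B' ch'[OF L(2)] g wd] unfolding differentiable_def by blast
        have A: "(chart_action d g has_derivative A) (at w within R g)"
          using A by (rule has_derivative_subset) (use Kd in \<open>auto simp: R_def\<close>)
        obtain Q where Q: "(q has_derivative Q) (at (chart_action d g w) within \<eta> ` chart_dom k)"
          using open_embedding_inverse[OF B' \<eta> kd z(1)] unfolding q_def differentiable_def z(2) by blast
        obtain H where "(\<eta>' has_derivative H) (at z within chart_dom k)"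
          using \<eta>' z(1) unfolding open_embedding_def by blast
        then have H: "(\<eta>' has_derivative H) (at (q (chart_action d g w)) within chart_dom k)"
          using q\<eta>[OF z(1)] z(2) by simp
        have qA: "((\<lambda>w. q (chart_action d g w)) has_derivative (\<lambda>v. Q (A v))) (at w within R g)"
          by (rule has_derivative_chain_within[OF A Q]) (auto simp: R_def)
        have "(\<tau> g has_derivative (\<lambda>v. H (Q (A v)))) (at w within R g)"
          unfolding \<tau>_def
          by (rule has_derivative_chain_within[OF qA H])
            (auto simp: R_def q\<eta>)
        then show "\<tau> g differentiable (at w within R g)" unfolding differentiable_def by blast
      qed
    qed
    have "negligible (\<Union>g\<in>carrier (chart_group d). cylinder ?B' (\<tau> g ` R g))"
      using neg chart_group_finite[OF B' ch'[OF L(2)]] by (intro negligible_Union) auto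
    moreover have "(\<Union>v\<in>?N \<inter> W. {y. ?p y = v}) \<subseteq> (\<Union>g\<in>carrier (chart_group d). cylinder ?B' (\<tau> g ` R g))"
    proof
      fix y assume "y \<in> (\<Union>v\<in>?N \<inter> W. {y. ?p y = v})"
      then obtain v u where v: "v \<in> chart_dom d'" "v \<in> W" "?p y = v"
        and u: "u \<in> chart_dom c" "critical_at \<O> \<P> c L u" "chart_proj d' v = f (chart_proj c u)" by blast
      obtain z where z: "z \<in> chart_dom k" "v = \<eta>' z" using v(2) pv[OF v(1)] by (auto simp: W_def)
      have mem: "L u \<in> chart_dom d" "\<eta> z \<in> chart_dom d" using L(3) u(1) \<eta>im(1) z(1) by blast+
      have "chart_proj d (L u) = chart_proj d (\<eta> z)"
        using u(3) L(5)[OF u(1)] \<eta>cov z by simp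
      then obtain g where g: "g \<in> carrier (chart_group d)" "chart_action d g (L u) = \<eta> z"
        by (rule chart_proj_eqD[OF B' ch'[OF L(2)] mem])
      have "L u \<in> R g" using u g(2) z(1) by (auto simp: R_def K_def)
      moreover have "\<tau> g (L u) = ?p y" using g(2) q\<eta>[OF z(1)] z(2) v(3) by (simp add: \<tau>_def)
      ultimately show "y \<in> (\<Union>g\<in>carrier (chart_group d). cylinder ?B' (\<tau> g ` R g))"
        using g(1) unfolding cylinder_def by (metis (mono_tags, lifting) UN_iff imageI mem_Collect_eq)
    qed
    ultimately have "negligible (\<Union>v\<in>?N \<inter> W. {y. ?p y = v})" by (rule negligible_subset)
    then show "\<exists>W. open W \<and> v0 \<in> W \<and> negligible (\<Union>v\<in>?N \<inter> W. {y. ?p y = v})"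
      using W v0W by blast
  qed
  moreover have "(\<Union>v\<in>?N. {y. ?p y = v}) = cylinder ?B' ?N" by (auto simp: cylinder_def)
  ultimately show ?thesis by simp
qed

section \<open>Countable covers by charts\<close>

text \<open>Members of a locally finite cover by Lindelof sets meet only countably many others; the
  members that are linked to a given one by a finite chain therefore form a countable family, and
  their union is open and closed.\<close>

lemma countable_subcover:
  fixes \<O> :: "('a::euclidean_space, 'x, 'g) orbifold"
  assumes O: "smooth_orbifold \<O>" and cc: "countable (connected_components_of (orb_space \<O>))"
    and N: "\<And>x. x \<in> topspace (orb_space \<O>) \<Longrightarrow> openin (orb_space \<O>) (N x) \<and> x \<in> N x"
  obtains I where "countable I" "I \<subseteq> topspace (orb_space \<O>)" "topspace (orb_space \<O>) \<subseteq> (\<Union>x\<in>I. N x)"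
proof -
  let ?X = "orb_space \<O>" and ?B = "orb_coords \<O>"
  note B = smooth_orbifoldD(1)[OF O] and ch = smooth_orbifoldD(3)[OF O]
  \<comment> \<open>Refining chart neighbourhoods rather than the sets \<open>N x\<close> places
    every member of the refinement in one chart; containment in some \<open>N x\<close> yields the
    index set at the end.\<close>
  define \<U> where "\<U> = {chart_nbhd c |c. c \<in> orb_charts \<O> \<and> (\<exists>x\<in>topspace ?X. chart_nbhd c \<subseteq> N x)}"
  have Uopen: "openin ?X S" if "S \<in> \<U>" for S
    using that chart_nbhd_open[OF B ch] by (auto simp: \<U>_def)
  have "\<Union>\<U> = topspace ?X"
  proof
    show "\<Union>\<U> \<subseteq> topspace ?X" using Uopen openin_subset by blast
    show "topspace ?X \<subseteq> \<Union>\<U>"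
    proof
      fix x assume x: "x \<in> topspace ?X"
      obtain c where c: "c \<in> orb_charts \<O>" "chart_center c = x" "chart_nbhd c \<subseteq> N x"
        using smooth_orbifoldD(4)[OF O] N[OF x] by blast
      then have "x \<in> chart_nbhd c" using chart_center_nbhd[OF B ch[OF c(1)]] by simp
      then show "x \<in> \<Union>\<U>" using c x unfolding \<U>_def by blast
    qed
  qed
  with Uopen have "(\<forall>S\<in>\<U>. openin ?X S) \<and> \<Union>\<U> = topspace ?X" by blast
  then have "\<exists>\<V>. (\<forall>V\<in>\<V>. openin ?X V) \<and> \<Union>\<V> = topspace ?X \<and>
      (\<forall>V\<in>\<V>. \<exists>S\<in>\<U>. V \<subseteq> S) \<and> locally_finite_in ?X \<V>"
    using smooth_orbifoldD(2)[OF O] by (simp add: paracompact_space_def)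
  then obtain \<V> where V: "\<forall>V\<in>\<V>. openin ?X V" and Vcov: "\<Union>\<V> = topspace ?X"
    and V': "\<forall>V\<in>\<V>. \<exists>S\<in>\<U>. V \<subseteq> S" and Vfin: "locally_finite_in ?X \<V>"
    by (elim exE conjE) (rule that)
  note Vopen = bspec[OF V] and Vref = bspec[OF V']
  define r where "r = {(V, V'). V \<in> \<V> \<and> V' \<in> \<V> \<and> V \<inter> V' \<noteq> {}}"
  have r1: "countable (r `` {V})" for V
  proof (cases "V \<in> \<V>")
    case False
    then have "r `` {V} = {}" by (auto simp: r_def)
    then show ?thesis by simp
  next
    case True
    obtain c where c: "c \<in> orb_charts \<O>" "V \<subseteq> chart_nbhd c" using Vref[OF True] by (auto simp: \<U>_def)
    let ?D = "chart_dom c" and ?\<pi> = "chart_proj c"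
    have \<pi>V: "\<exists>z\<in>?D. ?\<pi> z = x" if "x \<in> V" for x
      using that c(2) chart_proj_image[OF B ch[OF c(1)]] by (metis imageE subsetD)
    have "\<forall>z\<in>?D. \<exists>M. openin ?X M \<and> ?\<pi> z \<in> M \<and> finite {S \<in> \<V>. S \<inter> M \<noteq> {}}"
    proof
      fix z assume "z \<in> ?D"
      have "?\<pi> z \<in> topspace ?X"
        using chart_proj_image[OF B ch[OF c(1)]] openin_subset[OF chart_nbhd_open[OF B ch[OF c(1)]]] \<open>z \<in> ?D\<close> by blast
      then show "\<exists>M. openin ?X M \<and> ?\<pi> z \<in> M \<and> finite {S \<in> \<V>. S \<inter> M \<noteq> {}}"
        using Vfin by (simp add: locally_finite_in_def)
    qed
    from bchoice[OF this] obtain M where M: "\<And>z. z \<in> ?D \<Longrightarrow> openin ?X (M z) \<and> ?\<pi> z \<in> M z \<and> finite {S \<in> \<V>. S \<inter> M z \<noteq> {}}"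
      by blast
    \<comment> \<open>Open sets meeting finitely many members are pulled back to the chart domain,
      where Lindelof's theorem is available.\<close>
    define P where "P = (\<lambda>z. {w \<in> ?D. ?\<pi> w \<in> M z})"
    have P: "openin (top_of_set ?D) S" if "S \<in> P ` ?D" for S
      using openin_continuous_map_preimage[OF chart_proj_continuous[OF B ch[OF c(1)]]] M that
      by (force simp: P_def)
    obtain \<F> where F: "\<F> \<subseteq> P ` ?D" "countable \<F>" "\<Union>\<F> = \<Union>(P ` ?D)"
      by (rule Lindelof_openin[OF P]) (assumption, rule that)
    then obtain J where J: "countable J" "J \<subseteq> ?D" "\<F> = P ` J"
      using countable_subset_image[of \<F> P ?D] by blast
    have "r `` {V} \<subseteq> (\<Union>z\<in>J. {S \<in> \<V>. S \<inter> M z \<noteq> {}})"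
    proof
      fix V' assume "V' \<in> r `` {V}"
      then obtain x where x: "x \<in> V" "x \<in> V'" "V' \<in> \<V>" by (auto simp: r_def)
      obtain w where w: "w \<in> ?D" "?\<pi> w = x" using \<pi>V[OF x(1)] by blast
      then have "w \<in> P w" using M[OF w(1)] by (simp add: P_def)
      then have "w \<in> \<Union>\<F>" using w(1) F(3) by blast
      then obtain z where "z \<in> J" "w \<in> P z" using J(3) by blast
      then show "V' \<in> (\<Union>z\<in>J. {S \<in> \<V>. S \<inter> M z \<noteq> {}})" using w(2) x by (auto simp: P_def)
    qed
    moreover have "countable (\<Union>z\<in>J. {S \<in> \<V>. S \<inter> M z \<noteq> {}})"
    proof (intro countable_UN J(1) countable_finite)
      show "finite {S \<in> \<V>. S \<inter> M z \<noteq> {}}" if "z \<in> J" for z using M J(2) that by blast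
    qed
    ultimately show ?thesis by (rule countable_subset)
  qed
  have rY: "countable (r `` Y)" if "countable Y" for Y
  proof -
    have "r `` Y = (\<Union>V\<in>Y. r `` {V})" by blast
    then show ?thesis using that r1 by auto
  qed
  have "\<exists>V\<in>\<V>. V \<inter> C \<noteq> {}" if "C \<in> connected_components_of ?X" for C
    using that nonempty_connected_components_of connected_components_of_subset Vcov
    by (metis Int_emptyI UnionE disjoint_iff ex_in_conv subsetD)
  \<comment> \<open>One seed for every component; countability of the components makes the generated
    family countable.\<close>
  then obtain v where v: "\<And>C. C \<in> connected_components_of ?X \<Longrightarrow> v C \<in> \<V> \<and> v C \<inter> C \<noteq> {}" by metis
  define \<W> where "\<W> = r\<^sup>* `` (v ` connected_components_of ?X)"
  have Wc: "countable \<W>" unfolding \<W>_def using rY cc by (intro countable_rtrancl) auto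
  have step: "V' \<in> \<W>" if "V \<in> \<W>" "(V, V') \<in> r" for V V'
    using that unfolding \<W>_def by (meson Image_iff rtrancl.rtrancl_into_rtrancl)
  have WV: "\<W> \<subseteq> \<V>"
  proof
    fix V assume "V \<in> \<W>"
    then obtain C where C: "C \<in> connected_components_of ?X" "(v C, V) \<in> r\<^sup>*" by (auto simp: \<W>_def)
    from C(2) show "V \<in> \<V>" by (cases rule: rtranclE) (use v[OF C(1)] in \<open>auto simp: r_def\<close>)
  qed
  have "openin ?X (\<Union>\<W>)" using WV Vopen by blast
  moreover have "closedin ?X (\<Union>\<W>)"
  proof -
    \<comment> \<open>A member outside the family cannot meet one inside it, so the complement is a
      union of open members.\<close>
    have "topspace ?X - \<Union>\<W> = \<Union>(\<V> - \<W>)"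
    proof (intro equalityI subsetI)
      fix x assume "x \<in> topspace ?X - \<Union>\<W>"
      then show "x \<in> \<Union>(\<V> - \<W>)" using Vcov by blast
    next
      fix x assume "x \<in> \<Union>(\<V> - \<W>)"
      then obtain V where V: "V \<in> \<V>" "V \<notin> \<W>" "x \<in> V" by blast
      have "x \<notin> \<Union>\<W>"
      proof
        assume "x \<in> \<Union>\<W>"
        then obtain V' where V': "V' \<in> \<W>" "x \<in> V'" by blast
        then have "(V', V) \<in> r" using V WV by (auto simp: r_def)
        then show False using step[OF V'(1)] V(2) by blast
      qed
      then show "x \<in> topspace ?X - \<Union>\<W>" using V Vcov by blast
    qed
    moreover have "openin ?X (\<Union>(\<V> - \<W>))" using Vopen by blast
    moreover have "\<Union>\<W> \<subseteq> topspace ?X" using WV Vcov by blast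
    ultimately show ?thesis by (simp add: closedin_def)
  qed
  ultimately have "C \<subseteq> \<Union>\<W>" if C: "C \<in> connected_components_of ?X" for C
  proof -
    assume "openin ?X (\<Union>\<W>)" "closedin ?X (\<Union>\<W>)"
    then have "C \<subseteq> \<Union>\<W> \<or> disjnt C (\<Union>\<W>)"
      using connectedin_clopen_cases[OF connectedin_connected_components_of[OF C]] by blast
    moreover have "v C \<in> \<W>" using C by (auto simp: \<W>_def)
    moreover have "v C \<inter> C \<noteq> {}" using v[OF C] by blast
    ultimately show "C \<subseteq> \<Union>\<W>" by (auto simp: disjnt_def)
  qed
  then have cov: "topspace ?X \<subseteq> \<Union>\<W>" using Union_connected_components_of[of ?X] by blast
  have "\<exists>x\<in>topspace ?X. V \<subseteq> N x" if VW: "V \<in> \<W>" for V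
  proof -
    obtain S where "S \<in> \<U>" "V \<subseteq> S" using Vref[OF subsetD[OF WV VW]] by blast
    then show ?thesis unfolding \<U>_def by blast
  qed
  then obtain n where n: "\<And>V. V \<in> \<W> \<Longrightarrow> n V \<in> topspace ?X \<and> V \<subseteq> N (n V)" by metis
  show ?thesis
  proof (rule that[of "n ` \<W>"])
    show "countable (n ` \<W>)" using Wc by simp
    show "n ` \<W> \<subseteq> topspace ?X" using n by blast
    show "topspace ?X \<subseteq> (\<Union>x\<in>n ` \<W>. N x)" using cov n by blast
  qed
qed

section \<open>Critical values of a complete orbifold map\<close>

lemma local_lift_map_lift:
  assumes "complete_orbifold_map \<O> \<P> F" "x \<in> topspace (orb_space \<O>)"
  shows "local_lift \<O> \<P> (map_fun F) (map_src F x) (map_tgt F x) (map_lift F x)"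
  using assms by (simp add: complete_orbifold_map_def local_lift_def)

lemma negligible_critical_values:
  fixes \<O> :: "('a::euclidean_space, 'x, 'g) orbifold"
    and \<P> :: "('b::euclidean_space, 'y, 'h) orbifold"
  assumes O: "smooth_orbifold \<O>" and P: "smooth_orbifold \<P>"
    and cc: "countable (connected_components_of (orb_space \<O>))"
    and F: "complete_orbifold_map \<O> \<P> F" and d: "d \<in> orb_charts \<P>"
  shows "negligible (cylinder (orb_coords \<P>) {v \<in> chart_dom d. chart_proj d v \<in> critical_values \<O> \<P> F})"
proof -
  let ?X = "orb_space \<O>"
  note B = smooth_orbifoldD(1)[OF O] and ch = smooth_orbifoldD(3)[OF O]
  have src: "map_src F x \<in> orb_charts \<O>" "chart_center (map_src F x) = x" if "x \<in> topspace ?X" for x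
    using F that by (simp_all add: complete_orbifold_map_def)
  have "openin ?X (chart_nbhd (map_src F x)) \<and> x \<in> chart_nbhd (map_src F x)" if "x \<in> topspace ?X" for x
    using chart_nbhd_open[OF B ch[OF src(1)[OF that]]] chart_center_nbhd[OF B ch[OF src(1)[OF that]]] src(2)[OF that]
    by simp
  then obtain I where I: "countable I" "I \<subseteq> topspace ?X" "topspace ?X \<subseteq> (\<Union>x\<in>I. chart_nbhd (map_src F x))"
    by (rule countable_subcover[OF O cc])
  define K where "K = (\<lambda>i. {v \<in> chart_dom d. \<exists>u\<in>chart_dom (map_src F i).
    critical_at \<O> \<P> (map_src F i) (map_lift F i) u \<and> chart_proj d v = map_fun F (chart_proj (map_src F i) u)})"
  have "negligible (\<Union>((\<lambda>i. cylinder (orb_coords \<P>) (K i)) ` I))"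
  proof (intro negligible_countable_Union)
    fix S assume "S \<in> (\<lambda>i. cylinder (orb_coords \<P>) (K i)) ` I"
    then obtain i where i: "i \<in> I" "S = cylinder (orb_coords \<P>) (K i)" by blast
    show "negligible S"
      unfolding i(2) K_def using i(1) I(2)
      by (intro negligible_critical_values_in_chart[OF O P local_lift_map_lift[OF F] d]) auto
  qed (use I(1) in simp)
  moreover have "{v \<in> chart_dom d. chart_proj d v \<in> critical_values \<O> \<P> F} \<subseteq> (\<Union>i\<in>I. K i)"
  proof clarify
    fix v assume v: "v \<in> chart_dom d" "chart_proj d v \<in> critical_values \<O> \<P> F"
    then obtain x where x: "x \<in> topspace ?X" "map_fun F x = chart_proj d v"
      and crit: "critical_at \<O> \<P> (map_src F x) (map_lift F x) 0"
      unfolding critical_values_def regular_values_def critical_at_def by blast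
    obtain i where i: "i \<in> I" "x \<in> chart_nbhd (map_src F i)" using I(3) x(1) by blast
    have iX: "i \<in> topspace ?X" using i(1) I(2) by blast
    obtain u where u: "u \<in> chart_dom (map_src F i)" "x = chart_proj (map_src F i) u"
      using i(2) chart_proj_image[OF B ch[OF src(1)[OF iX]]] by blast
    note z = chart_zero[OF B ch[OF src(1)[OF x(1)]]]
    \<comment> \<open>The lift chosen at \<open>x\<close> is replaced by the lift at
      \<open>i\<close>, one of countably many; criticality moves from the centre to the point
      \<open>u\<close> over \<open>x\<close>.\<close>
    have "critical_at \<O> \<P> (map_src F i) (map_lift F i) u"
      using critical_at_transfer[OF O P local_lift_map_lift[OF F iX] local_lift_map_lift[OF F x(1)] u(1) z(1) _ crit]
        z(2) src(2)[OF x(1)] u(2) by simp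
    then have "v \<in> K i" using v(1) x(2) u unfolding K_def by auto
    then show "v \<in> (\<Union>i\<in>I. K i)" using i(1) by blast
  qed
  then have "cylinder (orb_coords \<P>) {v \<in> chart_dom d. chart_proj d v \<in> critical_values \<O> \<P> F} \<subseteq>
      \<Union>((\<lambda>i. cylinder (orb_coords \<P>) (K i)) ` I)"
    by (auto simp: cylinder_def)
  ultimately show ?thesis by (rule negligible_subset)
qed

theorem theorem12:
  fixes \<O> :: "('a::euclidean_space, 'x, 'g) orbifold"
    and \<P> :: "('b::euclidean_space, 'y, 'h) orbifold"
    and F :: "('a, 'x, 'g, 'b, 'y, 'h) orb_map"
  assumes "smooth_orbifold \<O>"
    and "smooth_orbifold \<P>"
    and "countable (connected_components_of (orb_space \<O>))"
    and "complete_orbifold_map \<O> \<P> F"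
  shows "orbifold_null \<P> (critical_values \<O> \<P> F) \<and>
         orb_space \<P> closure_of (regular_values \<O> \<P> F) = topspace (orb_space \<P>)"
proof
  let ?Y = "orb_space \<P>"
  note B = smooth_orbifoldD(1)[OF assms(2)] and ch = smooth_orbifoldD(3)[OF assms(2)]
  note neg = negligible_critical_values[OF assms]
  show "orbifold_null \<P> (critical_values \<O> \<P> F)"
    unfolding orbifold_null_def
  proof
    fix d assume d: "d \<in> orb_charts \<P>"
    show "lebesgue_null (orb_coords \<P>) {v \<in> chart_dom d. chart_proj d v \<in> critical_values \<O> \<P> F}"
      using chart_dom_span[OF B ch[OF d]] by (intro lebesgue_null_if_cylinder[OF B _ neg[OF d]]) auto
  qed
  have "topspace ?Y \<subseteq> ?Y closure_of (regular_values \<O> \<P> F)"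
  proof
    fix p assume p: "p \<in> topspace ?Y"
    show "p \<in> ?Y closure_of (regular_values \<O> \<P> F)"
      unfolding in_closure_of
    proof (intro conjI p allI impI)
      fix T assume "p \<in> T \<and> openin ?Y T"
      then obtain d where d: "d \<in> orb_charts \<P>" "chart_nbhd d \<subseteq> T"
        using smooth_orbifoldD(4)[OF assms(2)] by blast
      \<comment> \<open>If all points of the chart were critical values, this cylinder would be
        null, yet it is open and nonempty.\<close>
      have "\<not> negligible (cylinder (orb_coords \<P>) (chart_dom d))"
        by (rule not_negligible_cylinder[OF B chart_dom_open[OF B ch[OF d(1)]] chart_zero(1)[OF B ch[OF d(1)]]])
      then have "chart_dom d \<noteq> {v \<in> chart_dom d. chart_proj d v \<in> critical_values \<O> \<P> F}"
        using neg[OF d(1)] by metis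
      then obtain v where v: "v \<in> chart_dom d" "chart_proj d v \<notin> critical_values \<O> \<P> F" by blast
      have vd: "chart_proj d v \<in> chart_nbhd d" using chart_proj_image[OF B ch[OF d(1)]] v(1) by blast
      then have "chart_proj d v \<in> topspace ?Y"
        using openin_subset[OF chart_nbhd_open[OF B ch[OF d(1)]]] by blast
      then have "chart_proj d v \<in> regular_values \<O> \<P> F" using v(2) by (simp add: critical_values_def)
      then show "\<exists>y. y \<in> regular_values \<O> \<P> F \<and> y \<in> T" using vd d(2) by blast
    qed
  qed
  then show "?Y closure_of (regular_values \<O> \<P> F) = topspace ?Y"
    by (rule subset_antisym[OF closure_of_subset_topspace])
qed

end
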